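(* Let $M$ be a type $\mathrm{II}_1$ factor with a faithful normal tracial state $\tau$, and set $\kappa=\operatorname{dens}L^2(M,\tau)$. If $\kappa>\aleph_0$, then there is a family $(s_i)_{i\in I}$ of self-adjoint unitaries in $M$, indexed by a set $I$ with $|I|=\kappa$, such that $\{\widehat{s_i}:i\in I\}$ is a Hilbert-space orthonormal basis of $L^2(M,\tau)$.
   Context: $L^2(M,\tau)$ is the Hilbert space completion of $M$ for the norm $\|x\|_2=\tau(x^*x)^{1/2}$, with inner product $\langle\widehat x,\widehat y\rangle_2=\tau(y^*x)$; $\widehat x$ denotes the image of $x\in M$ in $L^2(M,\tau)$. $\operatorname{dens}L^2(M,\tau)$ is the density character, i.e. the least cardinality of a $\|\cdot\|_2$-dense subset. A Hilbert-space orthonormal basis is an orthonormal family (possibly uncountable) whose closed linear span is the whole Hilbert space. *)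

theory Defs
  imports "HOL-Analysis.Analysis"
begin

unbundle cardinal_syntax

section \<open>Complex Hilbert spaces\<close>

text \<open>The underlying real Hilbert space is the library's; the complex inner product is linear in
  its first argument and its real part is the real inner product. Positive definiteness and
  \<open>norm x = sqrt (Re (cinner x x))\<close> are inherited from \<^class>\<open>real_inner\<close>.\<close>

class complex_hilbert_space = real_inner + complete_space +
  fixes scaleC :: "complex \<Rightarrow> 'a \<Rightarrow> 'a" (infixr \<open>*\<^sub>C\<close> 75)
    and cinner :: "'a \<Rightarrow> 'a \<Rightarrow> complex"
  assumes scaleC_add_right: "c *\<^sub>C (x + y) = c *\<^sub>C x + c *\<^sub>C y"
    and scaleC_add_left: "(c + d) *\<^sub>C x = c *\<^sub>C x + d *\<^sub>C x"
    and scaleC_scaleC: "c *\<^sub>C (d *\<^sub>C x) = (c * d) *\<^sub>C x"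
    and scaleR_scaleC: "r *\<^sub>R x = complex_of_real r *\<^sub>C x"
    and cinner_commute: "cinner x y = cnj (cinner y x)"
    and cinner_add_left: "cinner (x + y) z = cinner x z + cinner y z"
    and cinner_scaleC_left: "cinner (c *\<^sub>C x) y = c * cinner x y"
    and inner_eq_Re_cinner: "inner x y = Re (cinner x y)"

global_interpretation complex_vector:
  vector_space "scaleC :: complex \<Rightarrow> 'a \<Rightarrow> 'a::complex_hilbert_space"
  defines cspan = complex_vector.span
proof
  fix x :: 'a
  show "1 *\<^sub>C x = x"
    using scaleR_scaleC[of 1 x] by simp
qed (simp_all add: scaleC_add_right scaleC_add_left scaleC_scaleC)

definition orthonormal_basis_on :: "'i set \<Rightarrow> ('i \<Rightarrow> 'a::complex_hilbert_space) \<Rightarrow> bool" where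
  "orthonormal_basis_on I e \<longleftrightarrow>
     (\<forall>i\<in>I. \<forall>j\<in>I. cinner (e i) (e j) = (if i = j then 1 else 0)) \<and>
     closure (cspan (e ` I)) = UNIV"


section \<open>Density character\<close>

text \<open>The least cardinality of a dense subset, as the cardinal order of a dense set of least
  cardinality (determined up to \<open>=o\<close>).\<close>

definition least_dense_subset :: "'a::topological_space set \<Rightarrow> 'a set \<Rightarrow> bool" where
  "least_dense_subset X D \<longleftrightarrow>
     D \<subseteq> X \<and> X \<subseteq> closure D \<and> (\<forall>E. E \<subseteq> X \<and> X \<subseteq> closure E \<longrightarrow> |D| \<le>o |E| )"

definition dens :: "'a::topological_space set \<Rightarrow> 'a rel" where
  "dens X = |SOME D. least_dense_subset X D|"

lemma least_dense_subset_exists: "\<exists>D. least_dense_subset X D"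
proof -
  let ?R = "{ |E| | E. E \<subseteq> X \<and> X \<subseteq> closure E}"
  have "|X| \<in> ?R"
    using closure_subset by blast
  moreover have "\<forall>r\<in>?R. Well_order r"
    using card_of_Well_order by blast
  ultimately obtain r where "r \<in> ?R" "\<forall>r'\<in>?R. r \<le>o r'"
    using exists_minim_Well_order[of ?R] by blast
  then show ?thesis
    unfolding least_dense_subset_def by blast
qed

lemma dens_least_dense_subset:
  obtains D where "least_dense_subset X D" and "dens X = |D|"
  unfolding dens_def using someI_ex[OF least_dense_subset_exists] by blast


section \<open>Von Neumann algebras of bounded operators\<close>

text \<open>\<open>blinfun\<close> consists of the bounded real-linear maps, so \<open>B(H)\<close> is cut out by
  complex-linearity.\<close>

type_synonym 'h op = "'h \<Rightarrow>\<^sub>L 'h"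

definition bounded_ops :: "'h::complex_hilbert_space op set" where
  "bounded_ops = {T. \<forall>c \<xi>. blinfun_apply T (c *\<^sub>C \<xi>) = c *\<^sub>C blinfun_apply T \<xi>}"

definition adj :: "'h::complex_hilbert_space op \<Rightarrow> 'h op" where
  "adj T = (THE S. \<forall>\<xi> \<eta>. cinner (blinfun_apply T \<xi>) \<eta> = cinner \<xi> (blinfun_apply S \<eta>))"

definition scalar_op :: "complex \<Rightarrow> 'h::complex_hilbert_space op" where
  "scalar_op c = Blinfun (\<lambda>\<xi>. c *\<^sub>C \<xi>)"

definition commutant :: "'h::complex_hilbert_space op set \<Rightarrow> 'h op set" where
  "commutant S = {T \<in> bounded_ops. \<forall>A\<in>S. T o\<^sub>L A = A o\<^sub>L T}"

definition von_neumann_algebra :: "'h::complex_hilbert_space op set \<Rightarrow> bool" where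
  "von_neumann_algebra M \<longleftrightarrow>
     M \<subseteq> bounded_ops \<and> (\<forall>x\<in>M. adj x \<in> M) \<and> commutant (commutant M) = M"

definition factor :: "'h::complex_hilbert_space op set \<Rightarrow> bool" where
  "factor M \<longleftrightarrow> von_neumann_algebra M \<and> M \<inter> commutant M = range scalar_op"

definition positive_op :: "'h::complex_hilbert_space op \<Rightarrow> bool" where
  "positive_op T \<longleftrightarrow> T \<in> bounded_ops \<and> (\<forall>\<xi>. cinner (blinfun_apply T \<xi>) \<xi> \<in> \<real>\<^sub>\<ge>\<^sub>0)"

definition op_le :: "'h::complex_hilbert_space op \<Rightarrow> 'h op \<Rightarrow> bool" where
  "op_le A B \<longleftrightarrow> positive_op (B - A)"

definition projections :: "'h::complex_hilbert_space op set \<Rightarrow> 'h op set" where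
  "projections M = {p \<in> M. adj p = p \<and> p o\<^sub>L p = p}"

definition minimal_projection :: "'h::complex_hilbert_space op set \<Rightarrow> 'h op \<Rightarrow> bool" where
  "minimal_projection M p \<longleftrightarrow>
     p \<in> projections M \<and> p \<noteq> 0 \<and> (\<forall>q\<in>projections M. op_le q p \<longrightarrow> q = 0 \<or> q = p)"

definition mvn_equivalent :: "'h::complex_hilbert_space op set \<Rightarrow> 'h op \<Rightarrow> 'h op \<Rightarrow> bool" where
  "mvn_equivalent M p q \<longleftrightarrow> (\<exists>v\<in>M. adj v o\<^sub>L v = p \<and> v o\<^sub>L adj v = q)"

definition finite_projection :: "'h::complex_hilbert_space op set \<Rightarrow> 'h op \<Rightarrow> bool" where
  "finite_projection M p \<longleftrightarrow>
     p \<in> projections M \<and> (\<forall>q\<in>projections M. op_le q p \<and> mvn_equivalent M p q \<longrightarrow> q = p)"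

text \<open>Murray--von Neumann: a factor is of type II if it has a nonzero finite projection but no
  minimal one, and of type II\<open>\<^sub>1\<close> if moreover the identity is finite.\<close>

definition type_II1_factor :: "'h::complex_hilbert_space op set \<Rightarrow> bool" where
  "type_II1_factor M \<longleftrightarrow>
     factor M \<and> (\<nexists>p. minimal_projection M p) \<and>
     finite_projection M id_blinfun \<and> (id_blinfun :: 'h op) \<noteq> 0"

definition self_adjoint_unitary :: "'h::complex_hilbert_space op \<Rightarrow> bool" where
  "self_adjoint_unitary u \<longleftrightarrow>
     adj u = u \<and> adj u o\<^sub>L u = id_blinfun \<and> u o\<^sub>L adj u = id_blinfun"


section \<open>Traces and the standard Hilbert space\<close>

text \<open>Functionals on \<open>M\<close> are total functions of which only the values on \<open>M\<close> matter.\<close>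

definition state_on :: "'h::complex_hilbert_space op set \<Rightarrow> ('h op \<Rightarrow> complex) \<Rightarrow> bool" where
  "state_on M \<tau> \<longleftrightarrow>
     (\<forall>x\<in>M. \<forall>y\<in>M. \<tau> (x + y) = \<tau> x + \<tau> y) \<and>
     (\<forall>c. \<forall>x\<in>M. \<tau> (scalar_op c o\<^sub>L x) = c * \<tau> x) \<and>
     (\<forall>x\<in>M. \<tau> (adj x o\<^sub>L x) \<in> \<real>\<^sub>\<ge>\<^sub>0) \<and>
     \<tau> id_blinfun = 1"

text \<open>Normality: suprema of bounded upward directed sets of positive elements are preserved.\<close>

definition normal_on :: "'h::complex_hilbert_space op set \<Rightarrow> ('h op \<Rightarrow> complex) \<Rightarrow> bool" where
  "normal_on M \<tau> \<longleftrightarrow>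
     (\<forall>D x. D \<noteq> {} \<and> D \<subseteq> {a \<in> M. positive_op a} \<and>
        (\<forall>a\<in>D. \<forall>b\<in>D. \<exists>c\<in>D. op_le a c \<and> op_le b c) \<and>
        x \<in> M \<and> (\<forall>a\<in>D. op_le a x) \<and> (\<forall>y\<in>M. (\<forall>a\<in>D. op_le a y) \<longrightarrow> op_le x y)
        \<longrightarrow> Re (\<tau> x) = (SUP a\<in>D. Re (\<tau> a)))"

definition faithful_normal_tracial_state ::
    "'h::complex_hilbert_space op set \<Rightarrow> ('h op \<Rightarrow> complex) \<Rightarrow> bool" where
  "faithful_normal_tracial_state M \<tau> \<longleftrightarrow>
     state_on M \<tau> \<and> normal_on M \<tau> \<and>
     (\<forall>x\<in>M. \<tau> (adj x o\<^sub>L x) = 0 \<longrightarrow> x = 0) \<and>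
     (\<forall>x\<in>M. \<forall>y\<in>M. \<tau> (x o\<^sub>L y) = \<tau> (y o\<^sub>L x))"

text \<open>\<open>hat\<close> exhibits the Hilbert space \<open>'k\<close> as the completion \<open>L\<^sup>2(M, \<tau>)\<close> of \<open>M\<close>: a linear map
  with dense range that carries \<open>\<tau>(y\<^sup>*x)\<close> to the inner product. This determines \<open>'k\<close> and \<open>hat\<close> up
  to a unique unitary.\<close>

definition L2_completion ::
    "'h::complex_hilbert_space op set \<Rightarrow> ('h op \<Rightarrow> complex) \<Rightarrow>
     ('h op \<Rightarrow> 'k::complex_hilbert_space) \<Rightarrow> bool" where
  "L2_completion M \<tau> hat \<longleftrightarrow>
     (\<forall>x\<in>M. \<forall>y\<in>M. hat (x + y) = hat x + hat y) \<and>
     (\<forall>c. \<forall>x\<in>M. hat (scalar_op c o\<^sub>L x) = c *\<^sub>C hat x) \<and>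
     (\<forall>x\<in>M. \<forall>y\<in>M. cinner (hat x) (hat y) = \<tau> (adj y o\<^sub>L x)) \<and>
     closure (hat ` M) = UNIV"

end

(*
  The self-adjoint unit ball B of M is a closed symmetric convex subset of L^2(M), complete although
  M is represented on an arbitrary Hilbert space, and its unit vectors are exactly the self-adjoint
  unitaries.

  A closed subspace V that is invariant under the metric projection of B has an orthogonal projection
  mapping B into itself. Such V exist above any small set, so L^2(M)_sa can be cut transfinitely into
  separable pieces and has an orthonormal basis Y of bounded vectors.

  If a in B has norm < 1 and G is a set of fewer than kappa vectors of M_sa, there is b <> 0 orthogonal
  to G with a + b in B: put c = 1 - a^2; elements of c M_sa c can be added to a after scaling, and if
  they were never orthogonal to G, then averaging the conjugates of c^2 to a nonzero scalar would
  bound the density of M by |G|. Hence every a in B extends, orthogonally to G, to a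
  self-adjoint unitary. A greedy expansion of the vectors of Y, a countable block of Y at a time,
  turns Y into an orthonormal basis of self-adjoint unitaries.
*)
theory Submission imports Defs begin

section \<open>Metric projections in Hilbert spaces\<close>

text \<open>Gram-Schmidt turns bounded vectors into bounded vectors but not unitaries into
  unitaries, and the orthogonal projection onto an arbitrary closed subspace need not even preserve
  boundedness. Invariance under the metric projection of B is closure under a single continuous map,
  so it can be imposed without raising the density; it takes the place of subalgebras and
  conditional expectations. The link between extension and approximation is this: if a unitary u
  extends a = z/c and u - a is orthogonal to z, then u has inner product norm z ^ 2 / c with z, so
  subtracting that component of z is measurable progress. Fewer than kappa constraints are imposed
  at any time, which is why an extension is always available. Each unitary has only countably many
  nonzero coefficients in Y, and closing off under supports gives countable blocks, independent of
  one another. All of this takes place over the reals: for self-adjoint x, y the number \<tau>(xy)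
  is real, so real orthonormality is already complex orthonormality, and M is M_sa + \<i>
  M_sa.\<close>

definition nearest :: "'a::real_inner set \<Rightarrow> 'a \<Rightarrow> 'a" where
  "nearest C x = (SOME b. b \<in> C \<and> (\<forall>c\<in>C. inner (x - b) (c - b) \<le> 0))"

text \<open>Closed bounded sets need not be compact here, so the minimiser is obtained from
  completeness: the parallelogram law makes a minimising sequence Cauchy.\<close>

lemma nearest_exists:
  fixes x :: "'a::{real_inner,complete_space}"
  assumes C: "closed C" "convex C" "C \<noteq> {}"
  shows "\<exists>b\<in>C. \<forall>c\<in>C. inner (x - b) (c - b) \<le> 0"
proof -
  define d where "d = infdist x C"
  have d0: "0 \<le> d" unfolding d_def by (rule infdist_nonneg)
  have dle: "d \<le> dist x c" if "c \<in> C" for c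
    unfolding d_def using that by (rule infdist_le)
  have "\<exists>b\<in>C. dist x b < d + 1 / Suc n" for n
  proof -
    have "Inf ((dist x) ` C) < d + 1 / Suc n"
      unfolding d_def infdist_def using C(3) by simp
    then show ?thesis
      using cInf_lessD[of "(dist x) ` C" "d + 1 / Suc n"] C(3) by blast
  qed
  then obtain b where b: "\<And>n. b n \<in> C" "\<And>n. dist x (b n) < d + 1 / Suc n" by metis
  \<comment> \<open>The midpoint of two near-minimisers lies in \<open>C\<close> by convexity, hence
    is at distance at least \<open>d\<close>; the parallelogram identity then bounds their
    distance.\<close>
  have par: "(dist (b m) (b n))\<^sup>2 \<le> 4 * ((d + 1 / Suc N)\<^sup>2 - d\<^sup>2)" if "m \<ge> N" "n \<ge> N" for m n N
  proof -
    let ?mid = "(1/2) *\<^sub>R b m + (1/2) *\<^sub>R b n"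
    have "?mid \<in> C"
      using C(2) b(1)[of m] b(1)[of n] unfolding convex_def by auto
    then have "d\<^sup>2 \<le> (dist x ?mid)\<^sup>2"
      using dle d0 power_mono by blast
    moreover have "(dist (b m) (b n))\<^sup>2 = 2 * (dist x (b m))\<^sup>2 + 2 * (dist x (b n))\<^sup>2 - 4 * (dist x ?mid)\<^sup>2"
      unfolding dist_norm power2_norm_eq_inner by (simp add: algebra_simps inner_commute)
    moreover have "(dist x (b k))\<^sup>2 \<le> (d + 1 / Suc N)\<^sup>2" if "k \<ge> N" for k
    proof -
      have "1 / real (Suc k) \<le> 1 / real (Suc N)"
        using that by (simp add: frac_le)
      then have "dist x (b k) \<le> d + 1 / Suc N" using b(2)[of k] by linarith
      then show ?thesis by (rule power_mono) simp
    qed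
    from this[OF that(1)] this[OF that(2)] have "(dist x (b m))\<^sup>2 \<le> (d + 1 / Suc N)\<^sup>2"
      "(dist x (b n))\<^sup>2 \<le> (d + 1 / Suc N)\<^sup>2" by auto
    ultimately show ?thesis by argo
  qed
  have lim: "(\<lambda>N. 4 * ((d + 1 / real (Suc N))\<^sup>2 - d\<^sup>2)) \<longlonglongrightarrow> 4 * ((d + 0)\<^sup>2 - d\<^sup>2)"
    by (intro tendsto_intros LIMSEQ_Suc[OF lim_1_over_n])
  have "Cauchy b"
  proof (rule metric_CauchyI)
    fix e :: real assume e: "0 < e"
    then have "0 < e\<^sup>2" by simp
    then obtain N where N: "4 * ((d + 1 / real (Suc N))\<^sup>2 - d\<^sup>2) < e\<^sup>2"
      using order_tendstoD(2)[OF lim, of "e\<^sup>2"] unfolding eventually_sequentially by auto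
    show "\<exists>M. \<forall>m\<ge>M. \<forall>n\<ge>M. dist (b m) (b n) < e"
    proof (intro exI allI impI)
      fix m n assume "m \<ge> N" "n \<ge> N"
      then have "(dist (b m) (b n))\<^sup>2 < e\<^sup>2" using par N by fastforce
      then show "dist (b m) (b n) < e" using e power_less_imp_less_base by fastforce
    qed
  qed
  then obtain l where l: "b \<longlonglongrightarrow> l"
    using Cauchy_convergent_iff convergent_def by blast
  have lC: "l \<in> C" using C(1) b(1) l closed_sequentially by blast
  have "dist x l \<le> d"
  proof (rule LIMSEQ_le)
    show "(\<lambda>n. dist x (b n)) \<longlonglongrightarrow> dist x l" by (intro tendsto_intros l)
    show "(\<lambda>n. d + 1 / real (Suc n)) \<longlonglongrightarrow> d"
      using tendsto_add[OF tendsto_const[of d] LIMSEQ_Suc[OF lim_1_over_n]] by simp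
    show "\<exists>N. \<forall>n\<ge>N. dist x (b n) \<le> d + 1 / real (Suc n)"
      using b(2) less_imp_le by blast
  qed
  then have "\<forall>z\<in>C. dist x l \<le> dist x z" using dle by force
  then show ?thesis
    using any_closest_point_dot[OF C(2,1) lC] lC by blast
qed

text \<open>Serves two constructions: sequences with orthogonal increments, where \<open>r\<close>
  is the squared norm, and monotone sequences of operators, where \<open>r\<close> is the quadratic
  form at a vector.\<close>

lemma Cauchy_of_squared_increments:
  fixes x :: "nat \<Rightarrow> 'a::real_normed_vector" and r :: "nat \<Rightarrow> real"
  assumes r: "convergent r" and incr: "\<And>m n. m \<le> n \<Longrightarrow> (norm (x n - x m))\<^sup>2 \<le> r n - r m"
  shows "Cauchy x"
proof (rule metric_CauchyI)
  fix e :: real assume e: "0 < e"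
  then have "0 < e\<^sup>2" by simp
  then obtain N where N: "\<And>m n. m \<ge> N \<Longrightarrow> n \<ge> N \<Longrightarrow> dist (r m) (r n) < e\<^sup>2"
    using metric_CauchyD[OF convergent_Cauchy[OF r]] by metis
  have *: "dist (x m) (x n) < e" if mn: "N \<le> m" "m \<le> n" for m n
  proof -
    have "(norm (x n - x m))\<^sup>2 < e\<^sup>2"
      using incr[OF mn(2)] N[of m n] mn by (auto simp: dist_real_def)
    then show ?thesis
      using e power_less_imp_less_base[of _ 2 e] by (auto simp: dist_norm norm_minus_commute)
  qed
  show "\<exists>N. \<forall>m\<ge>N. \<forall>n\<ge>N. dist (x m) (x n) < e"
  proof (intro exI allI impI)
    fix m n assume "m \<ge> N" "n \<ge> N"
    then show "dist (x m) (x n) < e" using *[of m n] *[of n m] by (cases "m \<le> n") (auto simp: dist_commute)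
  qed
qed

locale closed_convex =
  fixes C :: "'a::{real_inner,complete_space} set"
  assumes closed: "closed C" and convex: "convex C" and nonempty: "C \<noteq> {}"
begin

lemma nearest_mem: "nearest C x \<in> C"
  and nearest_le: "c \<in> C \<Longrightarrow> inner (x - nearest C x) (c - nearest C x) \<le> 0"
  using someI_ex[OF nearest_exists[OF closed convex nonempty, of x, unfolded Bex_def]]
  unfolding nearest_def by auto

lemma nearest_unique:
  assumes "b \<in> C" "\<And>c. c \<in> C \<Longrightarrow> inner (x - b) (c - b) \<le> 0"
  shows "nearest C x = b"
proof -
  have "inner (x - b) (nearest C x - b) \<le> 0" using assms nearest_mem by blast
  moreover have "inner (x - nearest C x) (b - nearest C x) \<le> 0" using assms nearest_le by blast
  ultimately have "inner (nearest C x - b) (nearest C x - b) \<le> 0"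
    by (simp add: algebra_simps inner_commute)
  then show ?thesis by (metis eq_iff_diff_eq_0 inner_eq_zero_iff inner_ge_zero order_antisym)
qed

text \<open>The two variational inequalities, each tested at the other point, add up to firm
  nonexpansiveness. The resulting continuity is what keeps hulls under metric projections
  small.\<close>

lemma nearest_lipschitz: "dist (nearest C x) (nearest C y) \<le> dist x y"
proof -
  let ?p = "nearest C x" and ?q = "nearest C y"
  have "inner (x - ?p) (?q - ?p) \<le> 0" "inner (y - ?q) (?p - ?q) \<le> 0"
    using nearest_le nearest_mem by blast+
  then have "(norm (?p - ?q))\<^sup>2 \<le> inner (x - y) (?p - ?q)"
    unfolding power2_norm_eq_inner by (simp add: algebra_simps inner_commute)
  also have "\<dots> \<le> norm (x - y) * norm (?p - ?q)" by (rule norm_cauchy_schwarz)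
  finally show ?thesis
    unfolding dist_norm power2_eq_square
    by (metis mult_right_le_imp_le norm_ge_zero order_le_less)
qed

lemma continuous_nearest: "continuous_on A (nearest C)"
  unfolding continuous_on_iff using nearest_lipschitz by (metis order_le_less_trans)

lemma nearest_norm_le:
  assumes "c \<in> C" shows "norm (x - nearest C x) \<le> norm (x - c)"
proof -
  have "0 \<le> inner (nearest C x - c) (nearest C x - c)" by simp
  then have "(norm (x - nearest C x))\<^sup>2 \<le> (norm (x - c))\<^sup>2"
    using nearest_le[OF assms, of x] unfolding power2_norm_eq_inner
    by (simp add: algebra_simps inner_commute)
  then show ?thesis by (rule power2_le_imp_le) simp
qed

lemma nearest_unique_norm:
  assumes "b \<in> C" "\<And>c. c \<in> C \<Longrightarrow> norm (x - b) \<le> norm (x - c)"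
  shows "nearest C x = b"
  using any_closest_point_dot[OF convex closed, of b _ x] assms
  by (intro nearest_unique) (auto simp: dist_norm)

end

section \<open>Orthogonal projections onto closed subspaces\<close>

locale closed_subspace =
  fixes C :: "'a::{real_inner,complete_space} set"
  assumes closed: "closed C" and subspace: "subspace C"
begin

sublocale closed_convex C
  using closed subspace subspace_imp_convex subspace_0 by unfold_locales auto

lemma nearest_orth:
  assumes "c \<in> C" shows "inner (x - nearest C x) c = 0"
proof -
  let ?p = "nearest C x"
  have "?p + c \<in> C" "?p - c \<in> C"
    using subspace assms nearest_mem by (auto intro: subspace_add subspace_diff)
  then show ?thesis
    using nearest_le[of "?p + c" x] nearest_le[of "?p - c" x] by simp
qed

lemma nearest_eqI:
  assumes "b \<in> C" "\<And>c. c \<in> C \<Longrightarrow> inner (x - b) c = 0"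
  shows "nearest C x = b"
  using assms subspace by (intro nearest_unique) (auto simp: subspace_diff)

lemma linear_nearest: "linear (nearest C)"
proof (rule linearI)
  fix x y
  show "nearest C (x + y) = nearest C x + nearest C y"
  proof (rule nearest_eqI)
    show "nearest C x + nearest C y \<in> C" using subspace nearest_mem subspace_add by blast
    fix c assume "c \<in> C"
    then show "inner (x + y - (nearest C x + nearest C y)) c = 0"
      using nearest_orth[of c x] nearest_orth[of c y] by (simp add: algebra_simps)
  qed
next
  fix r x
  show "nearest C (r *\<^sub>R x) = r *\<^sub>R nearest C x"
  proof (rule nearest_eqI)
    show "r *\<^sub>R nearest C x \<in> C" using subspace nearest_mem subspace_scale by blast
    fix c assume "c \<in> C"
    then show "inner (r *\<^sub>R x - r *\<^sub>R nearest C x) c = 0"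
      using nearest_orth[of c x] by (simp add: algebra_simps)
  qed
qed

lemma nearest_fixed: "x \<in> C \<Longrightarrow> nearest C x = x"
  by (rule nearest_eqI) auto

lemma nearest_zero_iff: "nearest C x = 0 \<longleftrightarrow> (\<forall>c\<in>C. inner x c = 0)"
proof
  assume "nearest C x = 0"
  then show "\<forall>c\<in>C. inner x c = 0" using nearest_orth[of _ x] by auto
next
  assume "\<forall>c\<in>C. inner x c = 0"
  then show "nearest C x = 0" using subspace subspace_0 by (intro nearest_eqI) auto
qed

lemma nearest_selfadj: "inner (nearest C x) y = inner x (nearest C y)"
  using nearest_orth[OF nearest_mem, of x y] nearest_orth[OF nearest_mem, of y x]
  by (simp add: algebra_simps inner_commute)

end

lemma subspace_closure:
  fixes S :: "'a::real_normed_vector set"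
  assumes S: "subspace S"
  shows "subspace (closure S)"
proof (rule subspaceI)
  show "0 \<in> closure S"
    using S subspace_0 closure_subset by blast
next
  fix x y assume "x \<in> closure S" "y \<in> closure S"
  then obtain f g where "\<And>n. f n \<in> S" "f \<longlonglongrightarrow> x" "\<And>n. g n \<in> S" "g \<longlonglongrightarrow> y"
    unfolding closure_sequential by blast
  then have "\<And>n. f n + g n \<in> S" "(\<lambda>n. f n + g n) \<longlonglongrightarrow> x + y"
    using S by (auto intro: subspace_add tendsto_add)
  then show "x + y \<in> closure S" unfolding closure_sequential by (intro exI[of _ "\<lambda>n. f n + g n"]) auto
next
  fix c x assume "x \<in> closure S"
  then obtain f where "\<And>n. f n \<in> S" "f \<longlonglongrightarrow> x"
    unfolding closure_sequential by blast
  then have "\<And>n. c *\<^sub>R f n \<in> S" "(\<lambda>n. c *\<^sub>R f n) \<longlonglongrightarrow> c *\<^sub>R x"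
    using S by (auto intro: subspace_scale tendsto_scaleR)
  then show "c *\<^sub>R x \<in> closure S" unfolding closure_sequential by (intro exI[of _ "\<lambda>n. c *\<^sub>R f n"]) auto
qed

lemma closed_subspace_closure_span: "closed_subspace (closure (span S))"
  for S :: "'a::{real_inner,complete_space} set"
  by unfold_locales (auto simp: subspace_closure)

lemma closed_orthogonal: "closed {x::'a::real_inner. \<forall>s\<in>S. inner x s = 0}"
proof -
  have "{x. \<forall>s\<in>S. inner x s = 0} = (\<Inter>s\<in>S. {x. inner x s = 0})" by auto
  moreover have "closed {x. inner x s = 0}" for s :: 'a
    by (intro closed_Collect_eq continuous_intros)
  ultimately show ?thesis by auto
qed

lemma subspace_orthogonal: "subspace {x::'a::real_inner. \<forall>s\<in>S. inner x s = 0}"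
  by (auto simp: subspace_def inner_add_left)

lemma closed_orthogonal1: "closed {x::'a::real_inner. inner y x = 0}"
  by (intro closed_Collect_eq continuous_intros)

lemma subspace_orthogonal1: "subspace {x::'a::real_inner. inner y x = 0}"
  by (auto simp: subspace_def inner_add_right)

lemma inner_closure_span_zero:
  fixes y :: "'a::real_inner"
  assumes "\<And>s. s \<in> S \<Longrightarrow> inner y s = 0" "x \<in> closure (span S)"
  shows "inner y x = 0"
proof -
  have "span S \<subseteq> {x. inner y x = 0}"
    by (rule span_minimal) (use assms in \<open>auto intro: subspace_orthogonal1\<close>)
  then have "closure (span S) \<subseteq> {x. inner y x = 0}"
    by (rule closure_minimal) (rule closed_orthogonal1)
  then show ?thesis using assms(2) by auto
qed

lemma closure_span_minimal:
  fixes S :: "'a::real_inner set"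
  assumes "S \<subseteq> closure (span T)"
  shows "closure (span S) \<subseteq> closure (span T)"
  using span_minimal[OF assms subspace_closure[OF subspace_span]] closure_minimal by blast

text \<open>The residual of \<open>w\<close> after projection onto the closed span stays in
  \<open>W\<close> and is orthogonal to \<open>S\<close>, so a totality check suffices.\<close>

lemma closure_span_eqI:
  fixes S :: "'a::{real_inner,complete_space} set"
  assumes W: "closed_subspace W" and S: "S \<subseteq> W"
    and orth: "\<And>w. w \<in> W \<Longrightarrow> (\<And>s. s \<in> S \<Longrightarrow> inner w s = 0) \<Longrightarrow> w = 0"
  shows "closure (span S) = W"
proof
  interpret W: closed_subspace W by fact
  interpret S: closed_subspace "closure (span S)" by (rule closed_subspace_closure_span)
  show sub: "closure (span S) \<subseteq> W"
    using S W.closed W.subspace by (simp add: closure_minimal span_minimal)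
  show "W \<subseteq> closure (span S)"
  proof
    fix w assume w: "w \<in> W"
    let ?p = "nearest (closure (span S)) w"
    have "w - ?p \<in> W" using w sub S.nearest_mem W.subspace subspace_diff by blast
    moreover have "inner (w - ?p) s = 0" if "s \<in> S" for s
      using S.nearest_orth that span_superset closure_subset by (metis subsetD)
    ultimately have "w - ?p = 0" by (rule orth)
    then show "w \<in> closure (span S)" using S.nearest_mem[of w] by simp
  qed
qed

section \<open>Invariant hulls and their density\<close>

lemma countable_ordLess_uncountable:
  assumes "countable A" "uncountable K"
  shows "|A| <o |K|"
proof -
  have "|A| \<le>o |UNIV :: nat set|"
    using assms(1) by (auto simp: countable_def card_of_ordLeq[symmetric])
  moreover have "\<not> |K| \<le>o |UNIV :: nat set|"
    using assms(2) by (auto simp: countable_def card_of_ordLeq[symmetric])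
  ultimately show ?thesis
    using not_ordLeq_iff_ordLess[OF card_of_Well_order card_of_Well_order] ordLeq_ordLess_trans by blast
qed

text \<open>Absorption laws need an infinite bound, while \<open>A\<close> may be finite. Adjoining
  a countably infinite set to a copy of \<open>A\<close> in \<open>K\<close> stays below
  \<open>K\<close> because \<open>K\<close> is uncountable.\<close>

lemma ordLess_infinite_between:
  fixes K :: "'b set"
  assumes K: "uncountable K" and A: "|A| <o |K|"
  shows "\<exists>L\<subseteq>K. infinite L \<and> |A| \<le>o |L| \<and> |L| <o |K|"
proof -
  obtain f where f: "inj_on f A" "f ` A \<subseteq> K"
    using ordLess_imp_ordLeq[OF A] by (auto simp: card_of_ordLeq[symmetric])
  have Kinf: "infinite K" using K countable_finite by blast
  obtain N where N: "N \<subseteq> K" "countable N" "infinite N"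
    using infinite_countable_subset'[OF Kinf] by blast
  have "|f ` A \<union> N| <o |K|"
    using Kinf ordLeq_ordLess_trans[OF card_of_image A] countable_ordLess_uncountable[OF N(2) K]
    by (rule card_of_Un_ordLess_infinite)
  moreover have "|A| \<le>o |f ` A \<union> N|"
    using f(1) by (auto simp: card_of_ordLeq[symmetric])
  ultimately show ?thesis using f(2) N by (intro exI[of _ "f ` A \<union> N"]) auto
qed

lemma card_of_Un_ordLeq:
  assumes "infinite K" "|A| \<le>o |K|" "|B| \<le>o |K|"
  shows "|A \<union> B| \<le>o |K|"
  using card_of_Un_ordLeq_infinite_Field[OF _ assms(2,3) card_of_Card_order] assms(1)
  by (simp add: Field_card_of)

lemma card_of_Times_ordLeq:
  assumes "infinite K" "|A| \<le>o |K|" "|B| \<le>o |K|"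
  shows "|A \<times> B| \<le>o |K|"
  using card_of_Times_ordLeq_infinite_Field[OF _ assms(2,3) card_of_Card_order] assms(1)
  by (simp add: Field_card_of)

lemma countable_ordLeq_infinite:
  assumes "infinite K" "countable A"
  shows "|A| \<le>o |K|"
proof -
  have "|A| \<le>o |UNIV :: nat set|"
    using assms(2) by (auto simp: countable_def card_of_ordLeq[symmetric])
  then show ?thesis using assms(1) infinite_iff_card_of_nat ordLeq_transitive by blast
qed

lemma card_of_image_ordLeq: "|A| \<le>o |K| \<Longrightarrow> |f ` A| \<le>o |K|"
  using card_of_image ordLeq_transitive by blast

text \<open>The members share one bound \<open>|G|\<close>; bounds that merely lie below
  \<open>|K|\<close> would not do, since \<open>|K|\<close> may have countable cofinality.\<close>

lemma card_of_UNION_ordLess: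
  fixes K :: "'b set"
  assumes K: "uncountable K" and I: "countable I" and A: "\<And>i. i \<in> I \<Longrightarrow> |A i| \<le>o |G|" and G: "|G| <o |K|"
  shows "|\<Union>i\<in>I. A i| <o |K|"
proof -
  obtain L :: "'b set" where L: "infinite L" "|G| \<le>o |L|" "|L| <o |K|"
    using ordLess_infinite_between[of K G] K G by metis
  have "|\<Union>i\<in>I. A i| \<le>o |L|"
    by (rule card_of_UNION_ordLeq_infinite[OF L(1) countable_ordLeq_infinite[OF L(1) I]])
      (use A L(2) ordLeq_transitive in blast)
  then show ?thesis using L(3) ordLeq_ordLess_trans by blast
qed

text \<open>The maps in \<open>\<Phi>\<close> may be nonlinear, as metric projections onto convex
  sets are. For empty \<open>\<Phi>\<close> this is the closed linear span.\<close>

definition invariant_hull :: "('a \<Rightarrow> 'a) set \<Rightarrow> 'a::real_inner set \<Rightarrow> 'a set" where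
  "invariant_hull \<Phi> S = \<Inter>{V. closed V \<and> subspace V \<and> S \<subseteq> V \<and> (\<forall>f\<in>\<Phi>. f ` V \<subseteq> V)}"

lemma invariant_hull_superset: "S \<subseteq> invariant_hull \<Phi> S"
  unfolding invariant_hull_def by blast

lemma invariant_hull_mono: "S \<subseteq> T \<Longrightarrow> invariant_hull \<Phi> S \<subseteq> invariant_hull \<Phi> T"
  unfolding invariant_hull_def by blast

lemma invariant_hull_minimal:
  "closed V \<Longrightarrow> subspace V \<Longrightarrow> S \<subseteq> V \<Longrightarrow> (\<And>f. f \<in> \<Phi> \<Longrightarrow> f ` V \<subseteq> V) \<Longrightarrow> invariant_hull \<Phi> S \<subseteq> V"
  unfolding invariant_hull_def by blast

lemma invariant_hull_invariant: "f \<in> \<Phi> \<Longrightarrow> x \<in> invariant_hull \<Phi> S \<Longrightarrow> f x \<in> invariant_hull \<Phi> S"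
  unfolding invariant_hull_def by blast

lemma closed_subspace_invariant_hull:
  "closed_subspace (invariant_hull \<Phi> S :: 'a::{real_inner,complete_space} set)"
proof
  show "closed (invariant_hull \<Phi> S)" unfolding invariant_hull_def by auto
  show "subspace (invariant_hull \<Phi> S)"
    unfolding invariant_hull_def by (rule subspace_Inter) auto
qed

text \<open>Closing off under sums, rational multiples and countably many maps does not leave the
  infinite cardinal \<open>|K|\<close>. Continuity carries invariance to the closure, and density of
  the rationals supplies the real multiples there.\<close>

lemma invariant_hull_dense:
  fixes S :: "'a::{real_inner,complete_space} set" and K :: "'b set"
  assumes K: "infinite K" and S: "|S| \<le>o |K|" and \<Phi>: "countable \<Phi>"
    and cont: "\<And>f. f \<in> \<Phi> \<Longrightarrow> continuous_on UNIV f"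
  shows "\<exists>G. invariant_hull \<Phi> S \<subseteq> closure G \<and> |G| \<le>o |K|"
proof -
  define step where "step A = A \<union> (\<lambda>(x, y). x + y) ` (A \<times> A) \<union>
    (\<lambda>(q, x). q *\<^sub>R x) ` (\<rat> \<times> A) \<union> (\<Union>f\<in>\<Phi>. f ` A)" for A :: "'a set"
  define A where "A n = (step ^^ n) (insert 0 S)" for n
  define G where "G = (\<Union>n. A n)"
  have A_Suc: "A (Suc n) = step (A n)" for n by (simp add: A_def)
  have cardA: "|A n| \<le>o |K|" for n
  proof (induction n)
    case 0
    have "|{0} \<union> S| \<le>o |K|"
      using card_of_Un_ordLeq[OF K countable_ordLeq_infinite[OF K, of "{0}"] S] by simp
    then show ?case by (simp add: A_def)
  next
    case (Suc n)
    have Q: "|\<rat> :: real set| \<le>o |K|"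
      using K countable_rat by (rule countable_ordLeq_infinite)
    have "|\<Union>f\<in>\<Phi>. f ` A n| \<le>o |K|"
      by (rule card_of_UNION_ordLeq_infinite[OF K countable_ordLeq_infinite[OF K \<Phi>]])
        (simp add: card_of_image_ordLeq[OF Suc])
    moreover have "|(\<lambda>(x, y). x + y) ` (A n \<times> A n)| \<le>o |K|" "|(\<lambda>(q, x). q *\<^sub>R x) ` (\<rat> \<times> A n)| \<le>o |K|"
      by (rule card_of_image_ordLeq[OF card_of_Times_ordLeq[OF K]], fact+)+
    ultimately have "|step (A n)| \<le>o |K|"
      unfolding step_def using Suc card_of_Un_ordLeq[OF K] by blast
    then show ?case by (simp add: A_Suc)
  qed
  have cardG: "|G| \<le>o |K|"
    unfolding G_def
    by (rule card_of_UNION_ordLeq_infinite[OF K countable_ordLeq_infinite[OF K]]) (simp_all add: cardA)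
  have incA: "A n \<subseteq> A (Suc n)" for n unfolding A_Suc step_def by auto
  have mono: "A m \<subseteq> A n" if "m \<le> n" for m n
    using lift_Suc_mono_le[of A, OF incA that] .
  have G_add: "x + y \<in> G" if xy: "x \<in> G" "y \<in> G" for x y
  proof -
    obtain m n where mn: "x \<in> A m" "y \<in> A n" using xy unfolding G_def by blast
    have "x \<in> A (max m n)" "y \<in> A (max m n)"
      using mn mono[of m "max m n"] mono[of n "max m n"] by auto
    then have "x + y \<in> A (Suc (max m n))" unfolding A_Suc step_def by force
    then show ?thesis by (auto simp: G_def)
  qed
  have G_scale: "q *\<^sub>R x \<in> G" if q: "q \<in> \<rat>" and x: "x \<in> G" for q x
  proof -
    obtain m where "x \<in> A m" using x by (auto simp: G_def)
    then have "q *\<^sub>R x \<in> A (Suc m)" unfolding A_Suc step_def using q by force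
    then show ?thesis by (auto simp: G_def)
  qed
  have G_inv: "f x \<in> G" if f: "f \<in> \<Phi>" and x: "x \<in> G" for f x
  proof -
    obtain m where "x \<in> A m" using x by (auto simp: G_def)
    then have "f x \<in> A (Suc m)" unfolding A_Suc step_def using f by force
    then show ?thesis by (auto simp: G_def)
  qed
  have zero: "0 \<in> A 0" and SA: "S \<subseteq> A 0" by (auto simp: A_def)
  have "subspace (closure G)"
  proof (rule subspaceI)
    show "0 \<in> closure G" using zero closure_subset[of G] by (auto simp: G_def)
  next
    fix x y assume "x \<in> closure G" "y \<in> closure G"
    then obtain f g where "\<And>n. f n \<in> G" "f \<longlonglongrightarrow> x" "\<And>n. g n \<in> G" "g \<longlonglongrightarrow> y"
      unfolding closure_sequential by blast
    then have "\<And>n. f n + g n \<in> G" "(\<lambda>n. f n + g n) \<longlonglongrightarrow> x + y"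
      using G_add by (auto intro: tendsto_add)
    then show "x + y \<in> closure G" unfolding closure_sequential by (intro exI[of _ "\<lambda>n. f n + g n"]) auto
  next
    fix c x assume "x \<in> closure G"
    then obtain f where f: "\<And>n. f n \<in> G" "f \<longlonglongrightarrow> x"
      unfolding closure_sequential by blast
    have "c \<in> closure (\<rat> :: real set)" using Rats_closure_real by auto
    then obtain q where q: "\<And>n. q n \<in> \<rat>" "q \<longlonglongrightarrow> c"
      unfolding closure_sequential by blast
    have "\<And>n. q n *\<^sub>R f n \<in> G" "(\<lambda>n. q n *\<^sub>R f n) \<longlonglongrightarrow> c *\<^sub>R x"
      using f q G_scale by (auto intro: tendsto_scaleR)
    then show "c *\<^sub>R x \<in> closure G" unfolding closure_sequential by (intro exI[of _ "\<lambda>n. q n *\<^sub>R f n"]) auto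
  qed
  moreover have "f ` closure G \<subseteq> closure G" if "f \<in> \<Phi>" for f
  proof (rule image_closure_subset)
    show "continuous_on (closure G) f" using cont[OF that] continuous_on_subset by blast
    show "f ` G \<subseteq> closure G" using G_inv[OF that] closure_subset by blast
  qed auto
  moreover have "S \<subseteq> closure G"
    using SA closure_subset[of G] by (auto simp: G_def)
  ultimately have "invariant_hull \<Phi> S \<subseteq> closure G"
    by (intro invariant_hull_minimal) auto
  then show ?thesis using cardG by blast
qed

lemma invariant_hull_small:
  fixes S :: "'a::{real_inner,complete_space} set" and K :: "'b set"
  assumes K: "uncountable K" and S: "|S| <o |K|" and \<Phi>: "countable \<Phi>"
    and cont: "\<And>f. f \<in> \<Phi> \<Longrightarrow> continuous_on UNIV f"
  obtains G where "invariant_hull \<Phi> S \<subseteq> closure G" "|G| <o |K|"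
proof -
  obtain L :: "'b set" where L: "infinite L" "|S| \<le>o |L|" "|L| <o |K|"
    using ordLess_infinite_between[OF K S] by metis
  obtain G where "invariant_hull \<Phi> S \<subseteq> closure G" "|G| \<le>o |L|"
    using invariant_hull_dense[OF L(1,2) \<Phi> cont] by auto
  then show thesis using that L(3) ordLeq_ordLess_trans by blast
qed

lemma closure_span_eq_invariant_hull:
  fixes S :: "'a::{real_inner,complete_space} set"
  shows "closure (span S) = invariant_hull {} S"
proof
  interpret closed_subspace "invariant_hull {} S" by (rule closed_subspace_invariant_hull)
  show "closure (span S) \<subseteq> invariant_hull {} S"
    using invariant_hull_superset[of S "{}"] closed subspace by (simp add: closure_minimal span_minimal)
  show "invariant_hull {} S \<subseteq> closure (span S)"
    using span_superset[of S] closure_subset[of "span S"]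
    by (intro invariant_hull_minimal) (auto simp: subspace_closure)
qed

section \<open>Orthonormal sets and the Gram-Schmidt process\<close>

definition orthonormal :: "'a::real_inner set \<Rightarrow> bool" where
  "orthonormal S \<longleftrightarrow> (\<forall>x\<in>S. norm x = 1) \<and> (\<forall>x\<in>S. \<forall>y\<in>S. x \<noteq> y \<longrightarrow> inner x y = 0)"

lemma orthonormal_norm: "orthonormal S \<Longrightarrow> x \<in> S \<Longrightarrow> norm x = 1"
  by (simp add: orthonormal_def)

lemma orthonormal_inner: "orthonormal S \<Longrightarrow> x \<in> S \<Longrightarrow> y \<in> S \<Longrightarrow> x \<noteq> y \<Longrightarrow> inner x y = 0"
  by (simp add: orthonormal_def)

lemma orthonormal_insert:
  "orthonormal S \<Longrightarrow> norm x = 1 \<Longrightarrow> (\<And>s. s \<in> S \<Longrightarrow> inner x s = 0) \<Longrightarrow> orthonormal (insert x S)"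
  unfolding orthonormal_def by (auto simp: inner_commute)

lemma orthonormal_UN_mono:
  fixes S :: "nat \<Rightarrow> 'a::real_inner set"
  assumes "\<And>n. orthonormal (S n)" "\<And>m n. m \<le> n \<Longrightarrow> S m \<subseteq> S n"
  shows "orthonormal (\<Union>n. S n)"
  unfolding orthonormal_def
proof (intro conjI ballI impI)
  fix x assume "x \<in> (\<Union>n. S n)" then show "norm x = 1" using assms(1) orthonormal_norm by blast
next
  fix x y assume "x \<in> (\<Union>n. S n)" "y \<in> (\<Union>n. S n)" and ne: "x \<noteq> y"
  then obtain m n where "x \<in> S m" "y \<in> S n" by blast
  then have "x \<in> S (max m n)" "y \<in> S (max m n)"
    using assms(2)[of m "max m n"] assms(2)[of n "max m n"] by auto
  then show "inner x y = 0" using assms(1) ne orthonormal_inner by blast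
qed

lemma orthonormal_UN_total:
  assumes tot: "total_on D r" and on: "\<And>d. d \<in> D \<Longrightarrow> orthonormal (Y d)"
    and orth: "\<And>d e x y. d \<in> D \<Longrightarrow> e \<in> underS r d \<Longrightarrow> x \<in> Y d \<Longrightarrow> y \<in> Y e \<Longrightarrow> e \<in> D \<Longrightarrow> inner x y = 0"
  shows "orthonormal (\<Union>d\<in>D. Y d)"
  unfolding orthonormal_def
proof (intro conjI ballI impI)
  fix x assume "x \<in> (\<Union>d\<in>D. Y d)"
  then show "norm x = 1" using on orthonormal_norm by blast
next
  fix x y assume "x \<in> (\<Union>d\<in>D. Y d)" "y \<in> (\<Union>d\<in>D. Y d)" and ne: "x \<noteq> y"
  then obtain d e where de: "d \<in> D" "e \<in> D" "x \<in> Y d" "y \<in> Y e" by blast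
  consider "d = e" | "e \<in> underS r d" | "d \<in> underS r e"
    using tot de(1,2) by (auto simp: total_on_def underS_def)
  then show "inner x y = 0"
  proof cases
    case 1
    then show ?thesis using on de ne orthonormal_inner by blast
  next
    case 2
    then show ?thesis using orth de by blast
  next
    case 3
    then have "inner y x = 0" using orth de by blast
    then show ?thesis by (simp add: inner_commute)
  qed
qed

lemma orthonormal_residual:
  fixes S :: "'a::real_inner set"
  assumes S: "finite S" "orthonormal S" and s: "s \<in> S"
  shows "inner (x - (\<Sum>v\<in>S. inner x v *\<^sub>R v)) s = 0"
proof -
  have "inner (\<Sum>v\<in>S. inner x v *\<^sub>R v) s = (\<Sum>v\<in>S. inner x v * inner v s)"
    by (simp add: inner_sum_left)
  also have "\<dots> = (\<Sum>v\<in>S. if v = s then inner x v * inner v v else 0)"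
    using S(2) s by (intro sum.cong) (auto simp: orthonormal_def)
  also have "\<dots> = inner x s"
    using S s by (simp add: orthonormal_def power2_norm_eq_inner[symmetric])
  finally show ?thesis by (simp add: inner_diff_left)
qed

lemma gram_schmidt_step:
  fixes S :: "'a::real_inner set"
  assumes S: "finite S" "orthonormal S"
  shows "\<exists>T. finite T \<and> orthonormal T \<and> S \<subseteq> T \<and> T \<subseteq> span (insert x S) \<and> x \<in> span T"
proof -
  let ?p = "\<Sum>v\<in>S. inner x v *\<^sub>R v"
  define y where "y = x - ?p"
  have p: "?p \<in> span S" by (intro span_sum span_scale span_base)
  show ?thesis
  proof (cases "y = 0")
    case True
    then have "x \<in> span S" using p by (simp add: y_def)
    then show ?thesis using S by (intro exI[of _ S]) (auto intro: span_base)
  next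
    case False
    let ?u = "(1 / norm y) *\<^sub>R y"
    have "inner ?u s = 0" if "s \<in> S" for s
      using orthonormal_residual[OF S that, of x] by (simp add: y_def)
    then have "orthonormal (insert ?u S)"
      using False S(2) by (intro orthonormal_insert) auto
    moreover have "?p \<in> span (insert x S)" using p span_mono[of S "insert x S"] by auto
    then have "y \<in> span (insert x S)"
      unfolding y_def by (rule span_diff[OF span_base[OF insertI1]])
    then have "insert ?u S \<subseteq> span (insert x S)"
      by (auto intro: span_scale span_base)
    moreover have "y \<in> span (insert ?u S)"
      using span_scale[OF span_base[of ?u "insert ?u S"], of "norm y"] False by simp
    have "x \<in> span (insert ?u S)"
    proof -
      have "?p \<in> span (insert ?u S)" using p span_mono[of S "insert ?u S"] by auto
      then have "y + ?p \<in> span (insert ?u S)" by (rule span_add[OF \<open>y \<in> span (insert ?u S)\<close>])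
      then show ?thesis by (simp add: y_def)
    qed
    ultimately show ?thesis using S(1) by (intro exI[of _ "insert ?u S"]) auto
  qed
qed

text \<open>Both inclusions are in algebraic spans, without closure: finite combinations of bounded
  vectors are bounded, limits of them need not be.\<close>

lemma gram_schmidt_countable:
  fixes E :: "'a::real_inner set"
  assumes E: "countable E"
  shows "\<exists>T. orthonormal T \<and> T \<subseteq> span E \<and> E \<subseteq> span T"
proof (cases "E = {}")
  case True
  then show ?thesis by (intro exI[of _ "{}"]) (auto simp: orthonormal_def)
next
  case False
  define x where "x = from_nat_into E"
  have xE: "x n \<in> E" for n unfolding x_def using False by (rule from_nat_into)
  have "\<exists>T. \<forall>n. (finite (T n) \<and> orthonormal (T n) \<and> T n \<subseteq> span E) \<and> (T n \<subseteq> T (Suc n) \<and> x n \<in> span (T (Suc n)))"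
  proof (rule dependent_nat_choice)
    show "\<exists>T. finite T \<and> orthonormal T \<and> T \<subseteq> span E"
      by (intro exI[of _ "{}"]) (auto simp: orthonormal_def)
  next
    fix S n assume S: "finite S \<and> orthonormal S \<and> S \<subseteq> span E"
    then obtain T where T: "finite T" "orthonormal T" "S \<subseteq> T" "T \<subseteq> span (insert (x n) S)" "x n \<in> span T"
      using gram_schmidt_step[of S "x n"] S by auto
    have "span (insert (x n) S) \<subseteq> span E"
      using S xE by (intro span_minimal) (auto intro: span_base)
    then show "\<exists>T. (finite T \<and> orthonormal T \<and> T \<subseteq> span E) \<and> (S \<subseteq> T \<and> x n \<in> span T)"
      using T by blast
  qed
  then obtain T where T: "\<And>n. orthonormal (T n)" "\<And>n. T n \<subseteq> span E" "\<And>n. T n \<subseteq> T (Suc n)"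
    "\<And>n. x n \<in> span (T (Suc n))" by blast
  have "orthonormal (\<Union>n. T n)"
    using T(1) lift_Suc_mono_le[of T, OF T(3)] by (intro orthonormal_UN_mono) auto
  moreover have "E \<subseteq> span (\<Union>n. T n)"
  proof
    fix e assume "e \<in> E"
    then obtain n where "e = x n" unfolding x_def using E from_nat_into_surj by metis
    then show "e \<in> span (\<Union>n. T n)" using T(4)[of n] span_mono[of "T (Suc n)" "\<Union>n. T n"] by blast
  qed
  ultimately show ?thesis using T(2) by (intro exI[of _ "\<Union>n. T n"]) blast
qed

section \<open>Orthonormal bases inside the span of a symmetric convex set\<close>

text \<open>A self-adjoint projection that leaves \<open>V\<close> invariant also leaves its
  orthogonal complement invariant, hence commutes with the projection onto \<open>V\<close>.\<close>

lemma nearest_commute: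
  fixes V W :: "'a::{real_inner,complete_space} set"
  assumes V: "closed_subspace V" and W: "closed_subspace W"
    and inv: "\<And>x. x \<in> V \<Longrightarrow> nearest W x \<in> V"
  shows "nearest V (nearest W x) = nearest W (nearest V x)"
proof -
  interpret V: closed_subspace V by fact
  interpret W: closed_subspace W by fact
  show ?thesis
  proof (rule V.nearest_eqI)
    show "nearest W (nearest V x) \<in> V" by (intro inv V.nearest_mem)
    fix c assume c: "c \<in> V"
    have "inner (nearest W x - nearest W (nearest V x)) c = inner (x - nearest V x) (nearest W c)"
      by (simp add: inner_diff_left W.nearest_selfadj)
    then show "inner (nearest W x - nearest W (nearest V x)) c = 0"
      using V.nearest_orth[OF inv[OF c]] by simp
  qed
qed

locale symmetric_convex =
  fixes B :: "'a::{real_inner,complete_space} set"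
  assumes closed_B: "closed B" and convex_B: "convex B" and zero_B: "0 \<in> B"
    and uminus_B: "x \<in> B \<Longrightarrow> - x \<in> B"
begin

sublocale B: closed_convex B
  using closed_B convex_B zero_B by unfold_locales auto

text \<open>The variational inequality for the metric projection of \<open>B\<close>, evaluated at a point of \<open>V\<close>,
  forces that projection to be the identity on the image of \<open>B\<close> in \<open>V\<close>.\<close>

lemma nearest_subspace_mem:
  assumes V: "closed_subspace V" and inv: "\<And>x. x \<in> V \<Longrightarrow> nearest B x \<in> V" and x: "x \<in> B"
  shows "nearest V x \<in> B"
proof -
  interpret V: closed_subspace V by fact
  let ?p = "nearest V x"
  let ?b = "nearest B ?p"
  have "?p - ?b \<in> V" using V.nearest_mem inv V.subspace subspace_diff by blast
  then have "inner (x - ?p) (?p - ?b) = 0" by (rule V.nearest_orth)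
  moreover have "inner (?p - ?b) (x - ?b) \<le> 0" using x by (rule B.nearest_le)
  moreover have "inner (?p - ?b) (x - ?b) = inner (x - ?p) (?p - ?b) + inner (?p - ?b) (?p - ?b)"
    by (simp add: algebra_simps inner_commute)
  ultimately have "inner (?p - ?b) (?p - ?b) \<le> 0" by simp
  then have "?p - ?b = 0" by (metis inner_eq_zero_iff inner_ge_zero order_antisym)
  then show ?thesis using B.nearest_mem[of ?p] by simp
qed

text \<open>Convexity makes the cone over \<open>B\<close> closed under addition and symmetry
  handles negative scalars, so the cone is already a subspace. The factor \<open>c\<close> is the
  quantity that the greedy expansion has to control.\<close>

lemma span_B_iff: "x \<in> span B \<longleftrightarrow> (\<exists>c>0. \<exists>b\<in>B. x = c *\<^sub>R b)"
proof
  have "subspace {x. \<exists>c>0. \<exists>b\<in>B. x = c *\<^sub>R b}" (is "subspace ?S")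
  proof (rule subspaceI)
    show "0 \<in> ?S" using zero_B by (auto intro!: exI[of _ 1] bexI[of _ 0])
  next
    fix x y assume "x \<in> ?S" "y \<in> ?S"
    then obtain c b d e where *: "c > 0" "b \<in> B" "x = c *\<^sub>R b" "d > 0" "e \<in> B" "y = d *\<^sub>R e" by blast
    have "c / (c + d) + d / (c + d) = 1"
      using * add_divide_distrib[of c d "c + d"] by simp
    then have "(c / (c + d)) *\<^sub>R b + (d / (c + d)) *\<^sub>R e \<in> B"
      using * by (intro convexD[OF convex_B]) auto
    moreover have "x + y = (c + d) *\<^sub>R ((c / (c + d)) *\<^sub>R b + (d / (c + d)) *\<^sub>R e)"
      using * by (simp add: scaleR_add_right)
    ultimately show "x + y \<in> ?S" using * by (metis (mono_tags, lifting) add_pos_pos mem_Collect_eq)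
  next
    fix r :: real and x assume "x \<in> ?S"
    then obtain c b where *: "c > 0" "b \<in> B" "x = c *\<^sub>R b" by blast
    consider "r = 0" | "r > 0" | "r < 0" by linarith
    then show "r *\<^sub>R x \<in> ?S"
    proof cases
      case 1
      then show ?thesis using zero_B by (auto intro!: exI[of _ 1] bexI[of _ 0])
    next
      case 2
      then show ?thesis using * by (auto intro!: exI[of _ "r * c"] bexI[of _ b])
    next
      case 3
      then have "- r * c > 0" "r *\<^sub>R x = (- r * c) *\<^sub>R (- b)" "- b \<in> B"
        using * uminus_B by (auto simp: mult_neg_pos)
      then show ?thesis by blast
    qed
  qed
  then have "span B \<subseteq> ?S"
    by (intro span_minimal) (auto intro!: exI[of _ 1])
  then show "x \<in> span B \<Longrightarrow> \<exists>c>0. \<exists>b\<in>B. x = c *\<^sub>R b" by blast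
qed (auto intro: span_scale span_base)

lemma nearest_subspace_span:
  assumes V: "closed_subspace V" and inv: "\<And>x. x \<in> V \<Longrightarrow> nearest B x \<in> V" and x: "x \<in> span B"
  shows "nearest V x \<in> span B"
proof -
  interpret V: closed_subspace V by fact
  obtain c b where cb: "c > 0" "b \<in> B" "x = c *\<^sub>R b" using x span_B_iff by blast
  then have "nearest V x = c *\<^sub>R nearest V b" using V.linear_nearest linear_scale by blast
  then show ?thesis using nearest_subspace_mem[OF V inv cb(2)] cb(1) by (auto intro: span_scale span_base)
qed

text \<open>Approximants from \<open>span B\<close> are pushed into \<open>W\<close> by its
  projection, which keeps them in \<open>span B\<close>. Thus \<open>span B \<inter> W\<close> has a
  countable subset dense in \<open>W\<close>, to which Gram-Schmidt applies.\<close>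

lemma separable_orthonormal_basis:
  assumes W: "closed_subspace W" and pres: "\<And>x. x \<in> span B \<Longrightarrow> nearest W x \<in> span B"
    and WB: "W \<subseteq> closure (span B)" and D: "countable D" "W \<subseteq> closure (span D)"
  shows "\<exists>Y\<subseteq>span B. orthonormal Y \<and> closure (span Y) = W"
proof -
  interpret W: closed_subspace W by fact
  obtain G where G: "invariant_hull {} D \<subseteq> closure G" "|G| \<le>o |UNIV :: nat set|"
    using invariant_hull_dense[of "UNIV :: nat set" D "{}"] D(1) countable_ordLeq_infinite[of "UNIV :: nat set" D]
    by auto
  have Gc: "countable G"
    using G(2) by (auto simp: countable_def card_of_ordLeq[symmetric])
  have WG: "W \<subseteq> closure G" using D(2) G(1) closure_span_eq_invariant_hull by blast
  have "\<exists>h :: nat \<Rightarrow> 'a. (\<forall>n. h n \<in> span B \<inter> W) \<and> h \<longlonglongrightarrow> nearest W g" for g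
  proof -
    have "nearest W g \<in> closure (span B)" using W.nearest_mem WB by blast
    then obtain f where f: "\<And>n. f n \<in> span B" "f \<longlonglongrightarrow> nearest W g"
      unfolding closure_sequential by blast
    have "(\<lambda>n. nearest W (f n)) \<longlonglongrightarrow> nearest W (nearest W g)"
      using f(2) W.continuous_nearest[of UNIV] continuous_on_tendsto_compose by fastforce
    then show ?thesis
      using f(1) pres W.nearest_mem W.nearest_fixed by (intro exI[of _ "\<lambda>n. nearest W (f n)"]) auto
  qed
  then obtain h :: "'a \<Rightarrow> nat \<Rightarrow> 'a" where h: "\<And>g n. h g n \<in> span B \<inter> W" "\<And>g. h g \<longlonglongrightarrow> nearest W g"
    by metis
  define E where "E = (\<Union>g\<in>G. range (h g))"
  have E: "countable E" "E \<subseteq> span B \<inter> W" using Gc h(1) by (auto simp: E_def)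
  have WE: "W \<subseteq> closure E"
  proof
    fix w assume w: "w \<in> W"
    have "nearest W ` closure G \<subseteq> closure E"
    proof (rule image_closure_subset)
      have "nearest W g \<in> closure E" if "g \<in> G" for g
        unfolding closure_sequential using h(2) that by (intro exI[of _ "h g"]) (auto simp: E_def)
      then show "nearest W ` G \<subseteq> closure E" by blast
    qed (use W.continuous_nearest in auto)
    then show "w \<in> closure E" using w WG W.nearest_fixed[OF w] by (metis image_subset_iff subsetD)
  qed
  obtain Y where Y: "orthonormal Y" "Y \<subseteq> span E" "E \<subseteq> span Y"
    using gram_schmidt_countable[OF E(1)] by blast
  have spE: "span E \<subseteq> span B" "span E \<subseteq> W"
    using E(2) span_minimal[of E "span B"] span_minimal[of E W] W.subspace by auto
  have "closure (span Y) \<subseteq> W"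
    using Y(2) spE(2) W.closed W.subspace by (intro closure_minimal span_minimal) auto
  moreover have "W \<subseteq> closure (span Y)"
    using WE closure_mono[OF Y(3)] by blast
  ultimately show ?thesis using Y(1,2) spE(1) by blast
qed

text \<open>Any closed subspace whose projection preserves \<open>span B\<close> is cut into slices of smaller
  density: along a well-order of a dense set, the hulls of the initial segments under the metric
  projections of \<open>B\<close> and \<open>W\<close> have projections which preserve \<open>span B\<close> and commute with that of \<open>W\<close>.\<close>

theorem orthonormal_basis_in_span:
  assumes "closed_subspace W" and "\<And>x. x \<in> span B \<Longrightarrow> nearest W x \<in> span B"
    and "W \<subseteq> closure (span B)" and "W \<subseteq> closure (span D)"
  shows "\<exists>Y\<subseteq>span B. orthonormal Y \<and> closure (span Y) = W"
  using assms
\<comment> \<open>The induction is on the cardinal of the generating set \<open>D\<close>, uniformly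
  in \<open>W\<close>, because the hypothesis is applied to slices of \<open>W\<close> with smaller
  generating sets.\<close>
proof (induction D arbitrary: W rule: wf_induct_rule[OF wf_inv_image[OF wf_ordLess, of card_of]])
  case (1 D W)
  note IH = "1.IH" and W = "1.prems"(1) and pres = "1.prems"(2) and WB = "1.prems"(3) and WD = "1.prems"(4)
  interpret W: closed_subspace W by (rule W)
  show ?case
  proof (cases "countable D")
    case True
    show ?thesis using W pres WB True WD by (rule separable_orthonormal_basis)
  next
    case D: False
    let ?r = "|D|"
    define \<Phi> where "\<Phi> = {nearest B, nearest W}"
    \<comment> \<open>\<open>V0 d\<close> is generated by what precedes \<open>d\<close>,
      \<open>V1 d\<close> also by \<open>d\<close> itself, and \<open>U d\<close> is the part of
      \<open>W\<close> that is new at stage \<open>d\<close>.\<close>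
    define V0 where "V0 d = invariant_hull \<Phi> (underS ?r d)" for d
    define V1 where "V1 d = invariant_hull \<Phi> (under ?r d)" for d
    define U where "U d = W \<inter> V1 d \<inter> {x. \<forall>v\<in>V0 d. inner x v = 0}" for d
    have wo: "Well_order ?r" by (rule card_of_Well_order)
    then have refl: "refl_on D ?r" and tr: "trans ?r" and antisym: "antisym ?r" and tot: "total_on D ?r"
      and wf: "wf (?r - Id)"
      by (auto simp: well_order_on_def linear_order_on_def partial_order_on_def preorder_on_def Field_card_of)
    have V0: "closed_subspace (V0 d)" and V1: "closed_subspace (V1 d)" for d
      unfolding V0_def V1_def by (rule closed_subspace_invariant_hull)+
    have V01: "V0 d \<subseteq> V1 d" for d
      unfolding V0_def V1_def by (intro invariant_hull_mono underS_subset_under)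
    have V10: "V1 e \<subseteq> V0 d" if "e \<in> underS ?r d" for d e
      unfolding V0_def V1_def
      using that tr antisym by (intro invariant_hull_mono) (auto simp: under_def underS_def dest: transD antisymD)
    have invB0: "nearest B x \<in> V0 d" and invW0: "nearest W x \<in> V0 d" if "x \<in> V0 d" for x d
      using that invariant_hull_invariant unfolding V0_def \<Phi>_def by blast+
    have invB1: "nearest B x \<in> V1 d" and invW1: "nearest W x \<in> V1 d" if "x \<in> V1 d" for x d
      using that invariant_hull_invariant unfolding V1_def \<Phi>_def by blast+
    have U: "closed_subspace (U d)" for d
    proof
      interpret V1: closed_subspace "V1 d" by (rule V1)
      show "closed (U d)" unfolding U_def by (intro closed_Int W.closed V1.closed closed_orthogonal)
      show "subspace (U d)" unfolding U_def by (intro subspace_inter W.subspace V1.subspace subspace_orthogonal)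
    qed
    \<comment> \<open>Written as a composition, the projection onto the slice visibly preserves
      \<open>span B\<close>: each of the three factors does.\<close>
    have nearest_U: "nearest (U d) x = nearest W (nearest (V1 d) x - nearest (V0 d) x)" for d x
    proof -
      interpret U: closed_subspace "U d" by (rule U)
      interpret V0: closed_subspace "V0 d" by (rule V0)
      interpret V1: closed_subspace "V1 d" by (rule V1)
      let ?y = "nearest (V1 d) x - nearest (V0 d) x"
      have y: "?y \<in> V1 d"
        using V1.nearest_mem V0.nearest_mem V01 V1.subspace subspace_diff by blast
      have orth: "inner ?y v = 0" if "v \<in> V0 d" for v
      proof -
        have "inner (x - nearest (V1 d) x) v = 0" "inner (x - nearest (V0 d) x) v = 0"
          using V1.nearest_orth V0.nearest_orth that V01 by blast+
        then show ?thesis by (simp add: inner_diff_left)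
      qed
      show ?thesis
      proof (rule U.nearest_eqI)
        have "inner (nearest W ?y) v = 0" if "v \<in> V0 d" for v
          using orth[OF invW0[OF that]] by (simp add: W.nearest_selfadj)
        then show "nearest W ?y \<in> U d" using W.nearest_mem invW1[OF y] by (simp add: U_def)
        fix c assume "c \<in> U d"
        then have c: "c \<in> W" "c \<in> V1 d" "nearest (V0 d) c = 0"
          by (auto simp: U_def V0.nearest_zero_iff)
        have "inner (nearest W ?y) c = inner (nearest (V1 d) x) c - inner (nearest (V0 d) x) c"
          by (simp add: W.nearest_selfadj W.nearest_fixed[OF c(1)] inner_diff_left)
        also have "\<dots> = inner x c"
          by (simp add: V1.nearest_selfadj V0.nearest_selfadj V1.nearest_fixed[OF c(2)] c(3))
        finally show "inner (x - nearest W ?y) c = 0" by (simp add: inner_diff_left)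
      qed
    qed
    have "\<exists>Y\<subseteq>span B. orthonormal Y \<and> closure (span Y) = U d" if d: "d \<in> D" for d
    proof -
      \<comment> \<open>Proper initial segments of a cardinal well-order are smaller than
        \<open>D\<close>, and the hull has a dense subset bounded by an infinite \<open>L\<close>
        still smaller than \<open>D\<close>; this dense subset is the generating set for the
        induction hypothesis.\<close>
      have "|underS ?r d| <o |D|"
        using d by (intro card_of_underS card_of_Card_order) (simp add: Field_card_of)
      then have "|underS ?r d \<union> {d}| <o |D|"
        using D countable_finite countable_ordLess_uncountable[OF _ D] by (intro card_of_Un_ordLess_infinite) auto
      moreover have "under ?r d \<subseteq> underS ?r d \<union> {d}" by (auto simp: under_def underS_def)
      ultimately have "|under ?r d| <o |D|"
        using card_of_mono1 ordLeq_ordLess_trans by blast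
      then obtain L :: "'a set" where L: "infinite L" "|under ?r d| \<le>o |L|" "|L| <o |D|"
        using ordLess_infinite_between[OF D, of "under ?r d"] by metis
      obtain G where G: "V1 d \<subseteq> closure G" "|G| \<le>o |L|"
        using invariant_hull_dense[OF L(1,2), of \<Phi>] B.continuous_nearest[of UNIV] W.continuous_nearest[of UNIV]
        unfolding V1_def \<Phi>_def by auto
      have "(G, D) \<in> inv_image ordLess card_of"
        using ordLeq_ordLess_trans[OF G(2) L(3)] by simp
      then show ?thesis
      proof (rule IH)
        show "closed_subspace (U d)" by (rule U)
        show "U d \<subseteq> closure (span B)" using WB by (auto simp: U_def)
        show "U d \<subseteq> closure (span G)" using G(1) closure_mono[OF span_superset[of G]] by (auto simp: U_def)
        fix x assume "x \<in> span B"
        then show "nearest (U d) x \<in> span B"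
          unfolding nearest_U using invB0 invB1
          by (intro pres span_diff nearest_subspace_span V0 V1) auto
      qed
    qed
    then have "\<forall>d\<in>D. \<exists>Y. Y \<subseteq> span B \<and> orthonormal Y \<and> closure (span Y) = U d" by blast
    then obtain Y where "\<forall>d\<in>D. Y d \<subseteq> span B \<and> orthonormal (Y d) \<and> closure (span (Y d)) = U d"
      using bchoice[of D "\<lambda>d Y. Y \<subseteq> span B \<and> orthonormal Y \<and> closure (span Y) = U d"] by blast
    then have Y: "\<And>d. d \<in> D \<Longrightarrow> Y d \<subseteq> span B" "\<And>d. d \<in> D \<Longrightarrow> orthonormal (Y d)"
      "\<And>d. d \<in> D \<Longrightarrow> closure (span (Y d)) = U d" by auto
    have YU: "y \<in> U d" if "d \<in> D" "y \<in> Y d" for d y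
      using Y(3)[OF that(1)] that(2) span_superset closure_subset by blast
    have Uorth: "inner x y = 0" if "x \<in> U d" "y \<in> U e" "e \<in> underS ?r d" for d e x y
      using that V10 by (auto simp: U_def)
    have "orthonormal (\<Union>d\<in>D. Y d)"
      by (rule orthonormal_UN_total[OF tot Y(2)]) (use Uorth YU in blast)+
    moreover have "closure (span (\<Union>d\<in>D. Y d)) = W"
    proof (rule closure_span_eqI[OF W])
      show "(\<Union>d\<in>D. Y d) \<subseteq> W" using YU by (auto simp: U_def)
      fix w assume w: "w \<in> W" and orthY: "\<And>s. s \<in> (\<Union>d\<in>D. Y d) \<Longrightarrow> inner w s = 0"
      have orthU: "inner w u = 0" if "d \<in> D" "u \<in> U d" for d u
        using inner_closure_span_zero[of "Y d" w u] orthY Y(3) that by blast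
      \<comment> \<open>Transfinite induction shows that a vector of \<open>W\<close> orthogonal to
        every slice is orthogonal to every \<open>V1 d\<close>, hence to \<open>D\<close>.\<close>
      have "\<forall>v\<in>V1 d. inner w v = 0" if "d \<in> D" for d
        using that
      proof (induction d rule: wf_induct_rule[OF wf])
        case (1 d)
        note IHd = "1.IH" and d = "1.prems"
        interpret V0: closed_subspace "V0 d" by (rule V0)
        interpret V1: closed_subspace "V1 d" by (rule V1)
        have underD: "underS ?r d \<subseteq> D" by (auto dest: underS_Field simp: Field_card_of)
        \<comment> \<open>The earlier hulls form a chain, so their union is an invariant subspace
          whose closure contains \<open>V0 d\<close>. Inserting 0 covers the first \<open>d\<close>,
          where the union is empty.\<close>
        let ?S = "insert 0 (\<Union>e\<in>underS ?r d. V1 e)"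
        have chain: "V1 e \<subseteq> V1 e' \<or> V1 e' \<subseteq> V1 e" if "e \<in> underS ?r d" "e' \<in> underS ?r d" for e e'
        proof -
          have "e = e' \<or> e \<in> underS ?r e' \<or> e' \<in> underS ?r e"
            using tot that underD by (auto simp: total_on_def underS_def)
          then show ?thesis using V10 V01 by blast
        qed
        have "subspace ?S"
        proof (rule subspaceI)
          fix x y assume xy: "x \<in> ?S" "y \<in> ?S"
          show "x + y \<in> ?S"
          proof (cases "x = 0 \<or> y = 0")
            case False
            then obtain e e' where e: "e \<in> underS ?r d" "e' \<in> underS ?r d" "x \<in> V1 e" "y \<in> V1 e'" using xy by blast
            then obtain e'' where "e'' \<in> underS ?r d" "x \<in> V1 e''" "y \<in> V1 e''" using chain by blast
            then show ?thesis using closed_subspace.subspace[OF V1] subspace_add by blast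
          qed (use xy in auto)
        next
          fix c x assume "x \<in> ?S"
          then show "c *\<^sub>R x \<in> ?S" using closed_subspace.subspace[OF V1] subspace_scale by fastforce
        qed auto
        moreover have "f ` closure ?S \<subseteq> closure ?S" if f: "f \<in> \<Phi>" for f
        proof (rule image_closure_subset)
          show "continuous_on (closure ?S) f"
            using f B.continuous_nearest W.continuous_nearest unfolding \<Phi>_def by auto
          have "f 0 = 0"
            using f B.nearest_unique[of 0 0] zero_B W.nearest_fixed[of 0] W.subspace subspace_0
            unfolding \<Phi>_def by auto
          moreover have "f x \<in> V1 e" if "x \<in> V1 e" for x e
            using f that invB1 invW1 unfolding \<Phi>_def by auto
          ultimately have "f ` ?S \<subseteq> ?S" by auto
          then show "f ` ?S \<subseteq> closure ?S" using closure_subset by blast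
        qed auto
        moreover have "e \<in> V1 e" if "e \<in> underS ?r d" for e
          using that underD refl invariant_hull_superset[of "under ?r e" \<Phi>]
          unfolding V1_def under_def refl_on_def by blast
        then have "underS ?r d \<subseteq> closure ?S" using closure_subset[of ?S] by blast
        ultimately have "V0 d \<subseteq> closure ?S"
          unfolding V0_def by (intro invariant_hull_minimal) (auto simp: subspace_closure)
        moreover have "closure ?S \<subseteq> {x. inner w x = 0}"
        proof (intro closure_minimal closed_orthogonal1)
          have "inner w x = 0" if "e \<in> underS ?r d" "x \<in> V1 e" for e x
            using IHd[of e] that underD by (auto simp: underS_def)
          then show "?S \<subseteq> {x. inner w x = 0}" by auto
        qed
        ultimately have w0: "inner w v = 0" if "v \<in> V0 d" for v using that by blast
        show ?case
        proof
          fix v assume v: "v \<in> V1 d"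
          \<comment> \<open>Removing the \<open>V0 d\<close> part does not leave \<open>W\<close>,
            because the two projections commute; the difference therefore lies in the slice
            \<open>U d\<close>.\<close>
          let ?q = "nearest W v - nearest (V0 d) (nearest W v)"
          have "nearest (V0 d) (nearest W v) = nearest W (nearest (V0 d) v)"
            by (rule nearest_commute[OF V0 W invW0])
          then have "?q \<in> W" using W.nearest_mem W.subspace subspace_diff by metis
          moreover have "?q \<in> V1 d"
            using invW1[OF v] V0.nearest_mem V01 V1.subspace subspace_diff by blast
          ultimately have "?q \<in> U d" using V0.nearest_orth by (simp add: U_def)
          then have "inner w ?q = 0" using orthU d by blast
          moreover have "inner w (nearest (V0 d) (nearest W v)) = 0" using w0 V0.nearest_mem by blast
          ultimately have "inner w (nearest W v) = 0" by (simp add: inner_diff_right)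
          then show "inner w v = 0" using W.nearest_selfadj[of w v] W.nearest_fixed[OF w] by simp
        qed
      qed
      moreover have "d \<in> V1 d" if "d \<in> D" for d
        using that refl invariant_hull_superset[of "under ?r d" \<Phi>]
        unfolding V1_def under_def refl_on_def by blast
      ultimately have "inner w d = 0" if "d \<in> D" for d using that by blast
      then have "inner w w = 0" using inner_closure_span_zero[of D w w] WD w by blast
      then show "w = 0" by simp
    qed
    ultimately show ?thesis using Y(1) by (intro exI[of _ "\<Union>d\<in>D. Y d"]) auto
  qed
qed

end

section \<open>Orthonormal bases of unit vectors\<close>

text \<open>Distinct orthonormal vectors have distance greater than 1, so points within distance 1/2
  of them are distinct.\<close>

lemma orthonormal_card_le_dense:
  fixes Y :: "'a::real_inner set"
  assumes Y: "orthonormal Y" and G: "Y \<subseteq> closure G"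
  shows "|Y| \<le>o |G|"
proof -
  have "\<forall>y\<in>Y. \<exists>g\<in>G. dist g y < 1/2"
  proof
    fix y assume "y \<in> Y"
    then have "y \<in> closure G" using G by blast
    then show "\<exists>g\<in>G. dist g y < 1/2" unfolding closure_approachable by (meson half_gt_zero zero_less_one)
  qed
  then obtain f where f: "\<And>y. y \<in> Y \<Longrightarrow> f y \<in> G \<and> dist (f y) y < 1/2" by metis
  have "inj_on f Y"
  proof (rule inj_onI, rule ccontr)
    fix x y assume xy: "x \<in> Y" "y \<in> Y" "f x = f y" "x \<noteq> y"
    have "(norm (x - y))\<^sup>2 = (norm x)\<^sup>2 + (norm y)\<^sup>2 - 2 * inner x y"
      unfolding power2_norm_eq_inner by (simp add: algebra_simps inner_commute)
    then have "1\<^sup>2 \<le> (norm (x - y))\<^sup>2"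
      using xy Y by (simp add: orthonormal_norm orthonormal_inner)
    then have "1 \<le> dist x y" unfolding dist_norm by (rule power2_le_imp_le) simp
    moreover have "dist x y \<le> dist (f x) x + dist (f x) y" by (rule dist_triangle3)
    ultimately show False using f[OF xy(1)] f[OF xy(2)] xy(3) by auto
  qed
  then show ?thesis using f by (auto simp: card_of_ordLeq[symmetric])
qed

text \<open>A sequence of finite combinations involves only countably many members of
  \<open>Y\<close>. The projection of \<open>u\<close> onto the span of its support differs from
  \<open>u\<close> by a vector of the closed span that is orthogonal to all of
  \<open>Y\<close>.\<close>

lemma orthonormal_support:
  fixes Y :: "'a::{real_inner,complete_space} set"
  assumes Y: "orthonormal Y" and u: "u \<in> closure (span Y)"
  shows "countable {y\<in>Y. inner u y \<noteq> 0}"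
    and "u \<in> closure (span {y\<in>Y. inner u y \<noteq> 0})"
proof -
  let ?S = "{y\<in>Y. inner u y \<noteq> 0}"
  obtain v where v: "\<And>n. v n \<in> span Y" "v \<longlonglongrightarrow> u"
    using u unfolding closure_sequential by blast
  have "\<exists>F. finite F \<and> F \<subseteq> Y \<and> v n \<in> span F" for n :: nat
    using v(1)[of n] by (auto simp: span_explicit intro!: span_sum span_scale span_base)
  then obtain F where F: "\<And>n :: nat. finite (F n) \<and> F n \<subseteq> Y \<and> v n \<in> span (F n)" by metis
  have "?S \<subseteq> (\<Union>n. F n)"
  proof
    fix y assume y: "y \<in> ?S"
    show "y \<in> (\<Union>n. F n)"
    proof (rule ccontr)
      assume nin: "y \<notin> (\<Union>n. F n)"
      have "inner y (v n) = 0" for n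
      proof (rule inner_closure_span_zero)
        show "v n \<in> closure (span (F n))" using F closure_subset by blast
        show "inner y s = 0" if "s \<in> F n" for s
          using y that nin F[of n] by (intro orthonormal_inner[OF Y]) auto
      qed
      then have "(\<lambda>n. inner y (v n)) \<longlonglongrightarrow> 0" by simp
      moreover have "(\<lambda>n. inner y (v n)) \<longlonglongrightarrow> inner y u" by (intro tendsto_intros v)
      ultimately show False using y LIMSEQ_unique by (auto simp: inner_commute)
    qed
  qed
  moreover have "countable (\<Union>n. F n)" using F by (auto intro: countable_finite)
  ultimately show "countable ?S" using countable_subset by blast
  interpret S: closed_subspace "closure (span ?S)" by (rule closed_subspace_closure_span)
  let ?p = "nearest (closure (span ?S)) u"
  have orth: "inner (u - ?p) y = 0" if y: "y \<in> Y" for y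
  proof (cases "y \<in> ?S")
    case True
    then have "y \<in> closure (span ?S)" using span_base[of y ?S] closure_subset by blast
    then show ?thesis by (rule S.nearest_orth)
  next
    case False
    then have "inner u y = 0" using y by simp
    moreover have "inner y ?p = 0"
      using False y by (intro inner_closure_span_zero[OF _ S.nearest_mem] orthonormal_inner[OF Y]) auto
    ultimately show ?thesis by (simp add: inner_diff_right inner_commute[of _ y])
  qed
  have "closure (span ?S) \<subseteq> closure (span Y)" by (intro closure_mono span_mono) auto
  then have "u - ?p \<in> closure (span Y)"
    using u S.nearest_mem[of u] subspace_diff[OF subspace_closure[OF subspace_span]] by blast
  then have "inner (u - ?p) (u - ?p) = 0" using orth by (rule inner_closure_span_zero[rotated])
  then have "u = ?p" by simp
  then show "u \<in> closure (span ?S)" using S.nearest_mem[of u] by metis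
qed

text \<open>Interface between operators and Hilbert space geometry: \<open>B\<close> will be the
  self-adjoint unit ball, and \<open>K\<close> a dense set of cardinality kappa. The assumption
  \<open>extend\<close> carries the operator-algebraic content and is verified by the lemma
  \<open>extension\<close>.\<close>

locale extendable_ball = symmetric_convex B for B :: "'a::{real_inner,complete_space} set" +
  fixes K :: "'b set"
  assumes uncountable_K: "uncountable K" and norm_B: "x \<in> B \<Longrightarrow> norm x \<le> 1"
    and extend: "a \<in> B \<Longrightarrow> norm a < 1 \<Longrightarrow> G \<subseteq> span B \<Longrightarrow> |G| <o |K| \<Longrightarrow>
      \<exists>b. b \<noteq> 0 \<and> a + b \<in> B \<and> (\<forall>g\<in>G. inner b g = 0)"
    and dense_K: "\<exists>D :: 'a set. closure (span B) \<subseteq> closure D \<and> |D| \<le>o |K|"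
begin

lemma infinite_K: "infinite K"
  using uncountable_K countable_finite by blast

lemma small_Un_countable: "|G| <o |K| \<Longrightarrow> countable H \<Longrightarrow> |G \<union> H| <o |K|"
  by (rule card_of_Un_ordLess_infinite[OF infinite_K _ countable_ordLess_uncountable[OF _ uncountable_K]])

text \<open>Countably many near-optimal extensions suffice. Every iterate joins the constraints, so
  increments are orthogonal and squared norms add up; if the limit had norm below 1, a further
  extension would beat the near-optimal choices.\<close>

lemma exists_unit_extension:
  assumes a0: "a0 \<in> B" and G0: "G0 \<subseteq> span B" "|G0| <o |K|"
  shows "\<exists>u\<in>B. norm u = 1 \<and> (\<forall>g\<in>G0. inner (u - a0) g = 0)"
proof -
  define P where "P n st \<longleftrightarrow> (n = 0 \<longrightarrow> st = (a0, insert a0 G0)) \<and> fst st \<in> B \<and> fst st \<in> snd st"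
    for n :: nat and st :: "'a \<times> 'a set"
  \<comment> \<open>The last clause says that the new norm reaches at least the midpoint between the
    old norm and the supremum of the norms of all admissible competitors.\<close>
  define Q where "Q st st' \<longleftrightarrow> snd st' = insert (fst st') (snd st) \<and>
      (\<forall>g\<in>snd st. inner (fst st' - fst st) g = 0) \<and>
      (\<forall>c\<in>B. (\<forall>g\<in>snd st. inner (c - fst st) g = 0) \<longrightarrow> norm c \<le> 2 * norm (fst st') - norm (fst st))"
    for st st' :: "'a \<times> 'a set"
  have "\<exists>f. \<forall>n. P n (f n) \<and> Q (f n) (f (Suc n))"
  proof (rule dependent_nat_choice)
    show "\<exists>st. P 0 st" using a0 by (auto simp: P_def)
  next
    fix st n assume "P n st"
    then obtain a G where st: "st = (a, G)" "a \<in> B" "a \<in> G" by (cases st) (auto simp: P_def)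
    let ?C = "{c\<in>B. \<forall>g\<in>G. inner (c - a) g = 0}"
    let ?s = "Sup (norm ` ?C)"
    have aC: "a \<in> ?C" using st by simp
    have bdd: "bdd_above (norm ` ?C)" using norm_B by (intro bdd_aboveI[of _ 1]) auto
    have up: "norm c \<le> ?s" if "c \<in> ?C" for c using that bdd by (intro cSup_upper) auto
    have "\<exists>a'\<in>?C. ?s \<le> 2 * norm a' - norm a"
    proof (cases "?s \<le> norm a")
      case True
      then show ?thesis using aC by (intro bexI[of _ a]) auto
    next
      case False
      then have "(?s + norm a) / 2 < ?s" by simp
      then obtain c where "c \<in> ?C" "(?s + norm a) / 2 < norm c"
        using less_cSup_iff[OF _ bdd] aC by blast
      then show ?thesis by (intro bexI[of _ c]) (auto simp: field_simps)
    qed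
    then obtain a' where a': "a' \<in> ?C" "?s \<le> 2 * norm a' - norm a" by blast
    have "norm c \<le> 2 * norm a' - norm a" if "c \<in> ?C" for c using up[OF that] a'(2) by linarith
    then show "\<exists>st'. P (Suc n) st' \<and> Q st st'"
      using a'(1) st by (intro exI[of _ "(a', insert a' G)"]) (auto simp: P_def Q_def)
  qed
  then obtain f where f: "\<And>n. P n (f n)" "\<And>n. Q (f n) (f (Suc n))" by blast
  define a where "a n = fst (f n)" for n
  define G where "G n = snd (f n)" for n
  have init: "a 0 = a0" "G 0 = insert a0 G0" using f(1)[of 0] by (auto simp: P_def a_def G_def)
  have aB: "a n \<in> B" and aG: "a n \<in> G n" for n using f(1)[of n] by (auto simp: P_def a_def G_def)
  have G_Suc: "G (Suc n) = insert (a (Suc n)) (G n)" for n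
    using f(2)[of n] by (auto simp: Q_def a_def G_def)
  have stepo: "inner (a (Suc n) - a n) g = 0" if "g \<in> G n" for n g
    using f(2)[of n] that by (auto simp: Q_def a_def G_def)
  have sup: "norm c \<le> 2 * norm (a (Suc n)) - norm (a n)"
    if "c \<in> B" "\<And>g. g \<in> G n \<Longrightarrow> inner (c - a n) g = 0" for n c
    using f(2)[of n] that by (auto simp: Q_def a_def G_def)
  have Gmono: "G m \<subseteq> G n" if "m \<le> n" for m n
    using lift_Suc_mono_le[of G, OF _ that] G_Suc by blast
  have orth: "inner (a (m + k) - a m) g = 0" if "g \<in> G m" for m k g
  proof (induction k)
    case (Suc k)
    have "inner (a (Suc (m + k)) - a (m + k)) g = 0" using stepo that Gmono[of m "m + k"] by auto
    then show ?case using Suc by (simp add: inner_diff_left)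
  qed simp
  have pyth: "(norm (a (m + k)))\<^sup>2 = (norm (a m))\<^sup>2 + (norm (a (m + k) - a m))\<^sup>2" for m k
    using orth[OF aG, of m k] unfolding power2_norm_eq_inner
    by (simp add: algebra_simps inner_commute)
  have "incseq (\<lambda>n. (norm (a n))\<^sup>2)"
  proof (rule incseq_SucI)
    show "(norm (a n))\<^sup>2 \<le> (norm (a (Suc n)))\<^sup>2" for n using pyth[of n 1] by simp
  qed
  moreover have "(norm (a n))\<^sup>2 \<le> 1" for n using norm_B[OF aB] by (simp add: power_le_one)
  ultimately have conv: "convergent (\<lambda>n. (norm (a n))\<^sup>2)"
    using incseq_convergent[of "\<lambda>n. (norm (a n))\<^sup>2" 1] by (metis convergent_def)
  have "(norm (a n - a m))\<^sup>2 \<le> (norm (a n))\<^sup>2 - (norm (a m))\<^sup>2" if "m \<le> n" for m n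
    using pyth[of m "n - m"] that by simp
  then have "Cauchy a" by (rule Cauchy_of_squared_increments[OF conv])
  then obtain l where l: "a \<longlonglongrightarrow> l" using Cauchy_convergent_iff convergent_def by blast
  have lB: "l \<in> B" using closed_B aB l closed_sequentially by blast
  have lorth: "inner (l - a m) g = 0" if "g \<in> G m" for m g
  proof (rule LIMSEQ_unique)
    show "(\<lambda>k. inner (a (m + k) - a m) g) \<longlonglongrightarrow> inner (l - a m) g"
      using LIMSEQ_ignore_initial_segment[OF l, of m] by (intro tendsto_intros) (simp add: add.commute)
    show "(\<lambda>k. inner (a (m + k) - a m) g) \<longlonglongrightarrow> 0" using orth[OF that] by simp
  qed
  have "norm l = 1"
  proof (rule ccontr)
    assume "norm l \<noteq> 1"
    then have l1: "norm l < 1" using norm_B[OF lB] by simp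
    let ?G = "G0 \<union> range a"
    have "G n \<subseteq> ?G" for n by (induction n) (use init G_Suc in auto)
    moreover have "?G \<subseteq> span B" using G0(1) aB by (auto intro: span_base)
    moreover have "|?G| <o |K|" using G0(2) by (intro small_Un_countable) auto
    ultimately obtain b where b: "b \<noteq> 0" "l + b \<in> B" "\<And>n g. g \<in> G n \<Longrightarrow> inner b g = 0"
      using extend[OF lB l1, of ?G] by (metis subsetD)
    \<comment> \<open>\<open>l + b\<close> competes at every step, so in the limit its norm is at
      most \<open>norm l\<close>. This contradicts Pythagoras, as \<open>b\<close> is nonzero and
      orthogonal to \<open>l\<close>.\<close>
    have "norm (l + b) \<le> 2 * norm (a (Suc n)) - norm (a n)" for n
    proof (rule sup[OF b(2)])
      show "inner (l + b - a n) g = 0" if "g \<in> G n" for g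
        using lorth[OF that] b(3)[OF that] by (simp add: algebra_simps)
    qed
    moreover have "(\<lambda>n. 2 * norm (a (Suc n)) - norm (a n)) \<longlonglongrightarrow> 2 * norm l - norm l"
      by (intro tendsto_intros l LIMSEQ_Suc[OF l])
    ultimately have "norm (l + b) \<le> 2 * norm l - norm l"
      by (intro LIMSEQ_le_const) auto
    then have "(norm (l + b))\<^sup>2 \<le> (norm l)\<^sup>2" by (intro power_mono) auto
    moreover have "inner b l = 0"
    proof (rule LIMSEQ_unique)
      show "(\<lambda>n. inner b (a n)) \<longlonglongrightarrow> inner b l" by (intro tendsto_intros l)
      show "(\<lambda>n. inner b (a n)) \<longlonglongrightarrow> 0" using b(3)[OF aG] by simp
    qed
    ultimately have "inner b b \<le> 0"
      unfolding power2_norm_eq_inner by (simp add: algebra_simps inner_commute)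
    then show False using b(1) by (metis inner_eq_zero_iff inner_ge_zero order_antisym)
  qed
  moreover have "inner (l - a0) g = 0" if "g \<in> G0" for g
    using lorth[of g 0] that init by simp
  ultimately show ?thesis using lB by blast
qed

text \<open>\<open>A\<close> collects the basis vectors consumed by earlier blocks. In the
  application the unit vectors of \<open>B\<close> in \<open>T\<close> come from self-adjoint
  unitaries.\<close>

definition admissible :: "'a set \<Rightarrow> 'a set \<Rightarrow> bool" where
  "admissible A T \<longleftrightarrow> finite T \<and> orthonormal T \<and> T \<subseteq> B \<and> (\<forall>t\<in>T. \<forall>a\<in>A. inner t a = 0)"

text \<open>One greedy step removes from the residual \<open>z\<close>, a multiple \<open>c b\<close> of some \<open>b \<in> B\<close>, a component of
  length \<open>norm z ^ 2 / c\<close>, while \<open>c ^ 2\<close> grows only linearly in the number of steps; so the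
  removed squared lengths are comparable to a harmonic series and the residual becomes small.\<close>

lemma greedy_steps:
  assumes A: "A \<subseteq> span B" "|A| <o |K|" and T: "admissible A T"
    and z: "c > 0" "(1 / c) *\<^sub>R z \<in> B" "\<And>a. a \<in> A \<union> T \<Longrightarrow> inner z a = 0" and e: "e > 0"
  shows "\<exists>T' z' c'. admissible A T' \<and> T \<subseteq> T' \<and> z - z' \<in> span T' \<and> c' > 0 \<and> (1 / c') *\<^sub>R z' \<in> B \<and>
    (\<forall>a\<in>A \<union> T'. inner z' a = 0) \<and>
    (norm z' < e \<or> c'\<^sup>2 \<le> c\<^sup>2 + 3 * real n * (norm z)\<^sup>2 \<and>
      (norm z')\<^sup>2 \<le> (norm z)\<^sup>2 - (\<Sum>k<n. e^4 / (c\<^sup>2 + 3 * (norm z)\<^sup>2) / (real k + 1)))"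
proof (induction n)
  case 0
  show ?case using T z by (intro exI[of _ T] exI[of _ z] exI[of _ c]) (auto intro: span_zero)
next
  case (Suc n)
  let ?\<delta> = "e^4 / (c\<^sup>2 + 3 * (norm z)\<^sup>2)"
  obtain T' z' c' where IH: "admissible A T'" "T \<subseteq> T'" "z - z' \<in> span T'" "c' > 0" "(1 / c') *\<^sub>R z' \<in> B"
    "\<And>a. a \<in> A \<union> T' \<Longrightarrow> inner z' a = 0"
    and disj: "norm z' < e \<or> c'\<^sup>2 \<le> c\<^sup>2 + 3 * real n * (norm z)\<^sup>2 \<and>
      (norm z')\<^sup>2 \<le> (norm z)\<^sup>2 - (\<Sum>k<n. ?\<delta> / (real k + 1))"
    using Suc by blast
  show ?case
  proof (cases "norm z' < e")
    case True
    then show ?thesis using IH by blast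
  next
    case False
    then have c': "c'\<^sup>2 \<le> c\<^sup>2 + 3 * real n * (norm z)\<^sup>2"
      and z': "(norm z')\<^sup>2 \<le> (norm z)\<^sup>2 - (\<Sum>k<n. ?\<delta> / (real k + 1))" using disj by auto
    have z'_span: "z' \<in> span B" using IH(4,5) span_scale[OF span_base[OF IH(5)], of c'] by simp
    \<comment> \<open>The residual itself is among the constraints, so that \<open>u\<close> and
      \<open>z' / c'\<close> have the same inner product with it.\<close>
    have "insert z' (A \<union> T') \<subseteq> span B" (is "?I \<subseteq> _")
      using z'_span A(1) IH(1) by (auto simp: admissible_def intro: span_base)
    moreover have "|?I| <o |K|"
    proof -
      have "|A \<union> insert z' T'| <o |K|"
        using A(2) IH(1) by (intro small_Un_countable) (auto simp: admissible_def intro: countable_finite)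
      then show ?thesis by simp
    qed
    ultimately obtain u where u: "u \<in> B" "norm u = 1"
      "\<And>g. g \<in> ?I \<Longrightarrow> inner (u - (1 / c') *\<^sub>R z') g = 0"
      using exists_unit_extension[OF IH(5), of ?I] by metis
    define t where "t = (norm z')\<^sup>2 / c'"
    have t0: "t \<ge> 0" using IH(4) by (simp add: t_def)
    have ua: "inner u g = 0" if "g \<in> A \<union> T'" for g
      using u(3)[of g] IH(6)[OF that] that by (simp add: inner_diff_left)
    have uz: "inner u z' = t"
      using u(3)[of z'] by (simp add: inner_diff_left t_def power2_norm_eq_inner)
    have tle: "t \<le> norm z'" using norm_cauchy_schwarz[of u z'] uz u(2) by simp
    define z'' where "z'' = z' - t *\<^sub>R u"
    have uu: "inner u u = 1" using u(2) by (metis norm_eq_1)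
    have nz'': "(norm z'')\<^sup>2 = (norm z')\<^sup>2 - t\<^sup>2"
      unfolding power2_norm_eq_inner z''_def using uz uu
      by (simp add: algebra_simps inner_commute power2_eq_square)
    have adm: "admissible A (insert u T')"
      using IH(1) u(1,2) ua unfolding admissible_def by (auto intro: orthonormal_insert)
    have span: "z - z'' \<in> span (insert u T')"
    proof -
      have "z - z' \<in> span (insert u T')" using IH(3) span_mono[of T' "insert u T'"] by auto
      then have "(z - z') + t *\<^sub>R u \<in> span (insert u T')"
        by (intro span_add span_scale) (auto intro: span_base)
      moreover have "z - z'' = (z - z') + t *\<^sub>R u" by (simp add: z''_def)
      ultimately show ?thesis by (simp only:)
    qed
    have pos: "c' + t > 0" using IH(4) t0 by simp
    \<comment> \<open>The new residual is \<open>c' + t\<close> times a convex combination of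
      \<open>z' / c'\<close> and \<open>- u\<close>: subtracting \<open>t\<close> times a member of
      the symmetric set raises the scale by exactly \<open>t\<close>.\<close>
    have "(c' / (c' + t)) *\<^sub>R ((1 / c') *\<^sub>R z') + (t / (c' + t)) *\<^sub>R (- u) \<in> B"
    proof (rule convexD[OF convex_B IH(5) uminus_B[OF u(1)]])
      show "c' / (c' + t) + t / (c' + t) = 1" using pos add_divide_distrib[of c' t "c' + t"] by simp
    qed (use pos t0 IH(4) in auto)
    moreover have "(c' / (c' + t)) *\<^sub>R ((1 / c') *\<^sub>R z') + (t / (c' + t)) *\<^sub>R (- u) = (1 / (c' + t)) *\<^sub>R z''"
      using IH(4) by (simp add: z''_def scaleR_diff_right)
    ultimately have B'': "(1 / (c' + t)) *\<^sub>R z'' \<in> B" by simp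
    have orth: "inner z'' a = 0" if "a \<in> A \<union> insert u T'" for a
    proof -
      have "inner z'' a = inner z' a - t * inner u a" by (simp add: z''_def inner_diff_left)
      then show ?thesis using that ua[of a] IH(6)[of a] uz uu inner_commute[of z' u] by auto
    qed
    have sum0: "(\<Sum>k<n. ?\<delta> / (real k + 1)) \<ge> 0"
      by (intro sum_nonneg divide_nonneg_nonneg add_nonneg_nonneg) auto
    have zz: "(norm z')\<^sup>2 \<le> (norm z)\<^sup>2" using z' sum0 by linarith
    have t2: "t\<^sup>2 \<le> (norm z')\<^sup>2" using tle t0 by (intro power_mono)
    \<comment> \<open>The constant 3 arises here: \<open>2 * c' * t\<close> equals
      \<open>2 * (norm z')^2\<close>, and \<open>t\<close> is at most
      \<open>norm z'\<close>.\<close>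
    have "(c' + t)\<^sup>2 = c'\<^sup>2 + 2 * (norm z')\<^sup>2 + t\<^sup>2"
      using IH(4) by (simp add: power2_sum t_def)
    also have "\<dots> \<le> (c\<^sup>2 + 3 * real n * (norm z)\<^sup>2) + 3 * (norm z)\<^sup>2"
      using c' zz t2 by linarith
    finally have c'': "(c' + t)\<^sup>2 \<le> c\<^sup>2 + 3 * real (Suc n) * (norm z)\<^sup>2" by (simp add: algebra_simps)
    \<comment> \<open>As long as the residual has norm at least \<open>e\<close>, the removed
      squared length \<open>t^2 = (norm z')^4 / c'^2\<close> dominates a term of a harmonic
      series.\<close>
    have "?\<delta> / (real n + 1) = e^4 / ((c\<^sup>2 + 3 * (norm z)\<^sup>2) * (real n + 1))" by simp
    also have "\<dots> \<le> (norm z')^4 / c'\<^sup>2"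
    proof (rule frac_le)
      show "e^4 \<le> (norm z')^4" using False e by (intro power_mono) auto
      have "(c\<^sup>2 + 3 * (norm z)\<^sup>2) * (real n + 1) =
          (c\<^sup>2 + 3 * real n * (norm z)\<^sup>2) + (c\<^sup>2 * real n + 3 * (norm z)\<^sup>2)"
        by (simp add: algebra_simps)
      moreover have "0 \<le> c\<^sup>2 * real n + 3 * (norm z)\<^sup>2" by simp
      ultimately show "c'\<^sup>2 \<le> (c\<^sup>2 + 3 * (norm z)\<^sup>2) * (real n + 1)" using c' by linarith
    qed (use IH(4) in auto)
    also have "\<dots> = t\<^sup>2" by (simp add: t_def power_divide flip: power_mult)
    finally have "(norm z'')\<^sup>2 \<le> (norm z)\<^sup>2 - (\<Sum>k<Suc n. ?\<delta> / (real k + 1))"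
      using nz'' z' by simp
    then show ?thesis
      using adm span pos B'' orth c'' IH(2)
      by (intro exI[of _ "insert u T'"] exI[of _ z''] exI[of _ "c' + t"]) auto
  qed
qed

text \<open>Once the harmonic sum exceeds \<open>(norm z)^2\<close>, the second alternative of
  \<open>greedy_steps\<close> would make a squared norm negative. Vectors already chosen are kept;
  only the component of \<open>y\<close> outside their span is treated.\<close>

lemma greedy_approximation:
  assumes A: "A \<subseteq> span B" "|A| <o |K|" and T: "admissible A T"
    and y: "y \<in> span B" "\<And>a. a \<in> A \<Longrightarrow> inner y a = 0" and e: "e > 0"
  shows "\<exists>T'. admissible A T' \<and> T \<subseteq> T' \<and> (\<exists>v\<in>span T'. norm (y - v) < e)"
proof -
  define p where "p = (\<Sum>v\<in>T. inner y v *\<^sub>R v)"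
  define z where "z = y - p"
  have p: "p \<in> span T" unfolding p_def by (intro span_sum span_scale span_base)
  have TB: "T \<subseteq> span B" using T by (auto simp: admissible_def intro: span_base)
  have "span T \<subseteq> span B" using TB by (intro span_minimal) auto
  then have "z \<in> span B" unfolding z_def using y(1) p by (intro span_diff) auto
  then obtain c b where cb: "c > 0" "b \<in> B" "z = c *\<^sub>R b" using span_B_iff by blast
  have zT: "inner z a = 0" if "a \<in> A \<union> T" for a
  proof (cases "a \<in> T")
    case True
    then show ?thesis using orthonormal_residual[of T a y] T by (simp add: z_def p_def admissible_def)
  next
    case False
    then have "a \<in> A" using that by simp
    have "inner a p = 0"
    proof (rule inner_closure_span_zero)
      show "p \<in> closure (span T)" using p closure_subset by blast
      show "inner a t = 0" if "t \<in> T" for t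
        using T that \<open>a \<in> A\<close> inner_commute[of a t] by (simp add: admissible_def)
    qed
    then show ?thesis using y(2)[of a] that False by (simp add: z_def inner_diff_left inner_commute[of _ a] inner_diff_right)
  qed
  define d where "d = e^4 / (c\<^sup>2 + 3 * (norm z)\<^sup>2)"
  have d0: "d > 0" using e cb(1) unfolding d_def by (intro divide_pos_pos add_pos_nonneg) auto
  have "\<not> (\<forall>n. (\<Sum>k<n. d / (real k + 1)) \<le> (norm z)\<^sup>2)"
  proof
    assume bd: "\<forall>n. (\<Sum>k<n. d / (real k + 1)) \<le> (norm z)\<^sup>2"
    have "summable (\<lambda>k. d / (real k + 1))"
    proof (rule bounded_imp_summable[where B = "(norm z)\<^sup>2"])
      show "(\<Sum>k\<le>n. d / (real k + 1)) \<le> (norm z)\<^sup>2" for n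
        using bd[rule_format, of "Suc n"] by (simp add: lessThan_Suc_atMost)
    qed (use d0 in auto)
    then have "summable (\<lambda>k. (1 / d) * (d / (real k + 1)))" by (rule summable_mult)
    then have "summable (\<lambda>k. inverse (real (Suc k)))"
      using d0 by (simp add: field_simps)
    then show False using not_summable_harmonic[where 'a = real] summable_Suc_iff[of "\<lambda>k. inverse (real k)"] by simp
  qed
  then obtain n where n: "(norm z)\<^sup>2 < (\<Sum>k<n. d / (real k + 1))" by (meson not_less)
  have "(1 / c) *\<^sub>R z \<in> B" using cb by simp
  then obtain T' z' c' where *: "admissible A T'" "T \<subseteq> T'" "z - z' \<in> span T'"
    "norm z' < e \<or> (norm z')\<^sup>2 \<le> (norm z)\<^sup>2 - (\<Sum>k<n. d / (real k + 1))"
    using greedy_steps[OF A T cb(1) _ zT e, of n] unfolding d_def by metis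
  have "norm z' < e" using *(4) n zero_le_power2[of "norm z'"] by linarith
  moreover have "p + (z - z') \<in> span T'" using *(2,3) p span_mono by (intro span_add) auto
  moreover have "y - (p + (z - z')) = z'" by (simp add: z_def)
  ultimately show ?thesis using *(1,2) by metis
qed

lemma greedy_approximation_finite:
  assumes A: "A \<subseteq> span B" "|A| <o |K|" and T: "admissible A T" and F: "finite F"
    and y: "F \<subseteq> span B" "\<And>y a. y \<in> F \<Longrightarrow> a \<in> A \<Longrightarrow> inner y a = 0" and e: "e > 0"
  shows "\<exists>T'. admissible A T' \<and> T \<subseteq> T' \<and> (\<forall>y\<in>F. \<exists>v\<in>span T'. norm (y - v) < e)"
  using F y
proof (induction F)
  case empty
  then show ?case using T by blast
next
  case (insert y F)
  then obtain T' where T': "admissible A T'" "T \<subseteq> T'" "\<forall>y\<in>F. \<exists>v\<in>span T'. norm (y - v) < e" by auto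
  obtain T'' where T'': "admissible A T''" "T' \<subseteq> T''" "\<exists>v\<in>span T''. norm (y - v) < e"
    using greedy_approximation[OF A T'(1) _ _ e, of y] insert.prems by auto
  have "\<forall>y\<in>F. \<exists>v\<in>span T''. norm (y - v) < e" using T'(3) span_mono[OF T''(2)] by blast
  then show ?case using T'(2) T'' by blast
qed

text \<open>The unit vectors that expand \<open>y\<close> have components along other members of
  \<open>Y\<close>, which must be expanded in turn. Closing off in countably many steps makes the
  two closed spans coincide.\<close>

lemma countable_block:
  assumes Y: "Y \<subseteq> span B" "orthonormal Y" "closure (span Y) = closure (span B)"
    and A: "A \<subseteq> Y" "|A| <o |K|" and y: "y \<in> Y" "y \<notin> A"
  shows "\<exists>C T. countable C \<and> y \<in> C \<and> C \<subseteq> Y - A \<and> T \<subseteq> B \<and> orthonormal T \<and> closure (span T) = closure (span C)"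
proof -
  define supp where "supp u = {v\<in>Y. inner u v \<noteq> 0}" for u
  \<comment> \<open>The finitely many targets of stage \<open>n\<close>: \<open>y\<close> and the
    first \<open>n + 1\<close> entries in an enumeration of each support. Inserting \<open>y\<close>
    keeps the enumerated set nonempty, so \<open>from_nat_into\<close> never leaves it.\<close>
  define Z where "Z n T = insert y (\<Union>u\<in>T. from_nat_into (insert y (supp u)) ` {..n})" for n :: nat and T
  have AB: "A \<subseteq> span B" using A(1) Y(1) by blast
  have BY: "u \<in> closure (span Y)" if "u \<in> B" for u
    using that span_base[of u B] closure_subset Y(3) by blast
  have supp: "countable (supp u)" "u \<in> closure (span (supp u))" if "u \<in> B" for u
    using orthonormal_support[OF Y(2) BY[OF that]] by (simp_all add: supp_def)
  have suppA: "supp u \<subseteq> Y - A" if "admissible A T" "u \<in> T" for u T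
    using that by (auto simp: supp_def admissible_def)
  have ZY: "Z n T \<subseteq> Y - A" if "admissible A T" for n T
  proof
    fix x assume "x \<in> Z n T"
    then consider "x = y" | u k where "u \<in> T" "x = from_nat_into (insert y (supp u)) k" by (auto simp: Z_def)
    then show "x \<in> Y - A"
    proof cases
      case 2
      have "x \<in> insert y (supp u)" unfolding 2(2) by (rule from_nat_into) simp
      then show ?thesis using y suppA[OF that 2(1)] by blast
    qed (use y in simp)
  qed
  have "\<exists>T. \<forall>n. admissible A (T n) \<and> (T n \<subseteq> T (Suc n) \<and>
    (\<forall>x\<in>Z n (T n). \<exists>v\<in>span (T (Suc n)). norm (x - v) < 1 / real (Suc n)))"
  proof (rule dependent_nat_choice)
    show "\<exists>T. admissible A T" by (intro exI[of _ "{}"]) (auto simp: admissible_def orthonormal_def)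
  next
    fix T n assume T: "admissible A T"
    have "finite (Z n T)" using T by (auto simp: Z_def admissible_def)
    moreover have "Z n T \<subseteq> span B" using ZY[OF T] Y(1) by blast
    moreover have "inner x a = 0" if "x \<in> Z n T" "a \<in> A" for x a
      using ZY[OF T, of n] that A(1) by (intro orthonormal_inner[OF Y(2)]) auto
    ultimately show "\<exists>T'. admissible A T' \<and> (T \<subseteq> T' \<and> (\<forall>x\<in>Z n T. \<exists>v\<in>span T'. norm (x - v) < 1 / real (Suc n)))"
      using greedy_approximation_finite[OF AB A(2) T, of "Z n T" "1 / real (Suc n)"] by auto
  qed
  then obtain T where T: "\<And>n. admissible A (T n)" "\<And>n. T n \<subseteq> T (Suc n)"
    "\<And>n x. x \<in> Z n (T n) \<Longrightarrow> \<exists>v\<in>span (T (Suc n)). norm (x - v) < 1 / real (Suc n)" by blast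
  have mono: "T m \<subseteq> T n" if "m \<le> n" for m n using lift_Suc_mono_le[of T, OF T(2) that] .
  define U where "U = (\<Union>n. T n)"
  define C where "C = insert y (\<Union>u\<in>U. supp u)"
  have UB: "U \<subseteq> B" using T(1) by (auto simp: U_def admissible_def)
  have "countable U" unfolding U_def using T(1) by (auto simp: admissible_def intro: countable_finite)
  then have "countable C" using supp(1) UB by (auto simp: C_def)
  moreover have "C \<subseteq> Y - A" using y suppA[OF T(1)] by (auto simp: C_def U_def)
  moreover have "orthonormal U"
    unfolding U_def using T(1) mono by (intro orthonormal_UN_mono) (auto simp: admissible_def)
  moreover have "closure (span U) = closure (span C)"
  proof
    have "u \<in> closure (span C)" if "u \<in> U" for u
    proof -
      have "closure (span (supp u)) \<subseteq> closure (span C)"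
        using that by (intro closure_mono span_mono) (auto simp: C_def)
      then show ?thesis using supp(2)[of u] UB that by blast
    qed
    then show "closure (span U) \<subseteq> closure (span C)" by (intro closure_span_minimal) blast
    \<comment> \<open>A vector that is a target at every late stage is approximated within
      \<open>1 / (n + 1)\<close> for all large \<open>n\<close>. Targets persist because both
      \<open>T n\<close> and the enumerated initial segments grow.\<close>
    have approx: "x \<in> closure (span U)" if x: "\<And>n. n \<ge> N \<Longrightarrow> x \<in> Z n (T n)" for x N
      unfolding closure_approachable
    proof (intro allI impI)
      fix e :: real assume "e > 0"
      then obtain M where M: "1 / real (Suc M) < e" using nat_approx_posE by blast
      have "1 / real (Suc (max M N)) \<le> 1 / real (Suc M)" by (simp add: frac_le)
      moreover obtain v where "v \<in> span (T (Suc (max M N)))" "norm (x - v) < 1 / real (Suc (max M N))"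
        using T(3)[OF x, of "max M N"] by auto
      moreover have "span (T (Suc (max M N))) \<subseteq> span U" unfolding U_def by (intro span_mono) auto
      ultimately show "\<exists>v\<in>span U. dist v x < e"
        using M by (intro bexI[of _ v]) (auto simp: dist_norm norm_minus_commute)
    qed
    have "x \<in> closure (span U)" if xC: "x \<in> C" for x
    proof (cases "x = y")
      case True
      then show ?thesis by (intro approx[of 0]) (simp add: Z_def)
    next
      case False
      then obtain u where u: "u \<in> U" "x \<in> supp u" using xC by (auto simp: C_def)
      then obtain m where m: "u \<in> T m" by (auto simp: U_def)
      have "countable (insert y (supp u))" using supp(1) UB u(1) by auto
      then obtain k where k: "x = from_nat_into (insert y (supp u)) k"
        using from_nat_into_surj[of "insert y (supp u)" x] u(2) by auto
      show ?thesis
      proof (rule approx[of "max m k"])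
        fix n assume "max m k \<le> n"
        then have "u \<in> T n" "k \<in> {..n}" using mono[of m n] m by auto
        then show "x \<in> Z n (T n)" unfolding Z_def k by blast
      qed
    qed
    then show "closure (span C) \<subseteq> closure (span U)" by (intro closure_span_minimal) blast
  qed
  ultimately show ?thesis using UB by (intro exI[of _ C] exI[of _ U]) (auto simp: C_def)
qed

theorem orthonormal_basis_of_unit_vectors:
  "\<exists>S\<subseteq>B. orthonormal S \<and> closure (span S) = closure (span B)"
proof -
  let ?H = "closure (span B)"
  interpret H: closed_subspace ?H by (rule closed_subspace_closure_span)
  have "nearest ?H x \<in> span B" if "x \<in> span B" for x
    using that H.nearest_fixed[of x] closure_subset[of "span B"] by auto
  moreover have "?H \<subseteq> closure (span ?H)" using span_superset closure_subset by blast
  ultimately obtain Y where Y: "Y \<subseteq> span B" "orthonormal Y" "closure (span Y) = ?H"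
    using orthonormal_basis_in_span[OF closed_subspace_closure_span, of B ?H] by blast
  obtain D :: "'a set" where D: "?H \<subseteq> closure D" "|D| \<le>o |K|" using dense_K by blast
  have "Y \<subseteq> closure D" using Y(1) closure_subset[of "span B"] D(1) by blast
  then have YK: "|Y| \<le>o |K|" using orthonormal_card_le_dense[OF Y(2)] D(2) ordLeq_transitive by blast
  let ?r = "|Y|"
  have wo: "Well_order ?r" by (rule card_of_Well_order)
  then have wf: "wf (?r - Id)" and tot: "total_on Y ?r"
    by (auto simp: well_order_on_def linear_order_on_def Field_card_of)
  define pick where "pick A y = (SOME C. countable C \<and> y \<in> C \<and> C \<subseteq> Y - A \<and>
      (\<exists>T\<subseteq>B. orthonormal T \<and> closure (span T) = closure (span C)))" for A y
  have pick: "countable (pick A y)" "y \<in> pick A y" "pick A y \<subseteq> Y - A"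
    "\<exists>T\<subseteq>B. orthonormal T \<and> closure (span T) = closure (span (pick A y))"
    if A: "A \<subseteq> Y" "|A| <o |K|" "y \<in> Y" "y \<notin> A" for A y
  proof -
    have "\<exists>C. countable C \<and> y \<in> C \<and> C \<subseteq> Y - A \<and>
      (\<exists>T\<subseteq>B. orthonormal T \<and> closure (span T) = closure (span C))"
      using countable_block[OF Y A] by blast
    from someI_ex[OF this] show "countable (pick A y)" "y \<in> pick A y" "pick A y \<subseteq> Y - A"
      "\<exists>T\<subseteq>B. orthonormal T \<and> closure (span T) = closure (span (pick A y))"
      by (simp_all add: pick_def)
  qed
  \<comment> \<open>A basis vector swallowed by an earlier block opens no block of its own;
    otherwise it opens one disjoint from all earlier blocks.\<close>
  define F where "F f y = (let A = \<Union>x\<in>underS ?r y. f x in if y \<in> A then {} else pick A y)" for f y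
  define f where "f = wfrec (?r - Id) F"
  define A where "A y = (\<Union>x\<in>underS ?r y. f x)" for y
  have f: "f y = (if y \<in> A y then {} else pick (A y) y)" for y
  proof -
    have "f y = F (cut f (?r - Id) y) y" unfolding f_def by (rule wfrec[OF wf])
    moreover have "(\<Union>x\<in>underS ?r y. cut f (?r - Id) y x) = A y"
      unfolding A_def by (intro SUP_cong) (auto simp: underS_def cut_def)
    ultimately show ?thesis by (simp add: F_def Let_def)
  qed
  have sub: "underS ?r y \<subseteq> Y" for y by (auto dest: underS_Field simp: Field_card_of)
  have main: "countable (f y) \<and> f y \<subseteq> Y - A y \<and> A y \<subseteq> Y \<and> |A y| <o |K|" if "y \<in> Y" for y
    using that
  proof (induction y rule: wf_induct_rule[OF wf])
    case (1 y)
    note IH = "1.IH" and yY = "1.prems"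
    have IHx: "countable (f x) \<and> f x \<subseteq> Y" if "x \<in> underS ?r y" for x
      using IH[of x] that sub by (auto simp: underS_def)
    have AY: "A y \<subseteq> Y" using IHx by (auto simp: A_def)
    \<comment> \<open>Fewer than \<open>|K|\<close> countable blocks precede \<open>y\<close>. Their
      union is bounded by an infinite cardinal below \<open>|K|\<close>, so the next block can be
      chosen, even when \<open>|K|\<close> is singular.\<close>
    have "|underS ?r y| <o |Y|"
      using yY by (intro card_of_underS card_of_Card_order) (simp add: Field_card_of)
    then have "|underS ?r y| <o |K|" using YK ordLess_ordLeq_trans by blast
    then obtain L :: "'b set" where L: "infinite L" "|underS ?r y| \<le>o |L|" "|L| <o |K|"
      using ordLess_infinite_between[OF uncountable_K] by metis
    have "|A y| \<le>o |L|"
      unfolding A_def using IHx countable_ordLeq_infinite[OF L(1)]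
      by (intro card_of_UNION_ordLeq_infinite L) auto
    then have AK: "|A y| <o |K|" using L(3) ordLeq_ordLess_trans by blast
    then show ?case using AY yY pick[OF AY AK yY] f[of y] by auto
  qed
  have "\<exists>T\<subseteq>B. orthonormal T \<and> closure (span T) = closure (span (f y))" if y: "y \<in> Y" for y
  proof (cases "y \<in> A y")
    case True
    then have "f y = {}" using f by simp
    then show ?thesis by (intro exI[of _ "{}"]) (auto simp: orthonormal_def)
  next
    case False
    then have "f y = pick (A y) y" using f by simp
    then show ?thesis using pick(4)[of "A y" y] main[OF y] y False by auto
  qed
  then have "\<forall>y\<in>Y. \<exists>T. T \<subseteq> B \<and> orthonormal T \<and> closure (span T) = closure (span (f y))" by blast
  then obtain T where "\<forall>y\<in>Y. T y \<subseteq> B \<and> orthonormal (T y) \<and> closure (span (T y)) = closure (span (f y))"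
    using bchoice[of Y "\<lambda>y T. T \<subseteq> B \<and> orthonormal T \<and> closure (span T) = closure (span (f y))"] by blast
  then have T: "\<And>y. y \<in> Y \<Longrightarrow> T y \<subseteq> B" "\<And>y. y \<in> Y \<Longrightarrow> orthonormal (T y)"
    "\<And>y. y \<in> Y \<Longrightarrow> closure (span (T y)) = closure (span (f y))" by auto
  have Tf: "t \<in> closure (span (f y))" if "y \<in> Y" "t \<in> T y" for t y
    using T(3)[OF that(1)] span_base[OF that(2)] closure_subset by blast
  have orth: "inner s t = 0" if de: "d \<in> Y" "e \<in> underS ?r d" "s \<in> T d" "t \<in> T e" for d e s t
  proof (rule inner_closure_span_zero[OF _ Tf[OF _ de(4)]])
    show eY: "e \<in> Y" using de(2) sub by blast
    fix x assume x: "x \<in> f e"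
    have "inner x s = 0"
    proof (rule inner_closure_span_zero[OF _ Tf[OF de(1,3)]])
      fix z assume z: "z \<in> f d"
      have "x \<in> A d" using x de(2) by (auto simp: A_def)
      then have "x \<noteq> z" using z main[OF de(1)] by blast
      then show "inner x z = 0"
        using x z main[OF de(1)] main[OF eY] by (intro orthonormal_inner[OF Y(2)]) auto
    qed
    then show "inner s x = 0" by (simp add: inner_commute)
  qed
  have "orthonormal (\<Union>y\<in>Y. T y)"
    by (rule orthonormal_UN_total[OF tot T(2)]) (use orth in blast)+
  moreover have "(\<Union>y\<in>Y. T y) \<subseteq> B" using T(1) by blast
  moreover have "closure (span (\<Union>y\<in>Y. T y)) = ?H"
  proof
    show "closure (span (\<Union>y\<in>Y. T y)) \<subseteq> ?H" using T(1) by (intro closure_mono span_mono) blast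
    have "y \<in> closure (span (\<Union>y\<in>Y. T y))" if y: "y \<in> Y" for y
    proof -
      have "y \<in> A y \<or> y \<in> f y" using f[of y] pick(2)[of "A y" y] main[OF y] y by auto
      then obtain x where x: "x \<in> Y" "y \<in> f x" using y sub by (auto simp: A_def)
      then have "y \<in> closure (span (T x))"
        using T(3)[OF x(1)] span_base[OF x(2)] closure_subset by blast
      moreover have "closure (span (T x)) \<subseteq> closure (span (\<Union>y\<in>Y. T y))"
        using x(1) by (intro closure_mono span_mono) blast
      ultimately show ?thesis by blast
    qed
    then have "closure (span Y) \<subseteq> closure (span (\<Union>y\<in>Y. T y))" by (intro closure_span_minimal) blast
    then show "?H \<subseteq> closure (span (\<Union>y\<in>Y. T y))" using Y(3) by simp
  qed
  ultimately show ?thesis by blast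
qed

end

section \<open>Operators on complex Hilbert spaces\<close>

instance complex_hilbert_space \<subseteq> banach ..

lemma cinner_scaleC_right: "cinner x (c *\<^sub>C y) = cnj c * cinner x y"
  by (metis cinner_commute cinner_scaleC_left complex_cnj_mult)

lemma Im_cinner: "Im (cinner x y) = inner x (\<i> *\<^sub>C y)"
  by (simp add: inner_eq_Re_cinner cinner_scaleC_right)

text \<open>The real inner product determines the complex one, so real arguments apply to
  complex-linear operators once multiplication by \<open>\<i>\<close> is tracked.\<close>

lemma cinner_eq_inner: "cinner x y = Complex (inner x y) (inner x (\<i> *\<^sub>C y))"
  by (simp add: complex_eq_iff Im_cinner inner_eq_Re_cinner)

lemma inner_scaleC_ii: "inner (\<i> *\<^sub>C x) y = - inner x (\<i> *\<^sub>C y)"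
  by (simp add: inner_eq_Re_cinner cinner_scaleC_right cinner_scaleC_left)

lemma norm_scaleC: "norm (c *\<^sub>C x) = cmod c * norm x"
proof -
  have "inner (c *\<^sub>C x) (c *\<^sub>C x) = Re ((c * cnj c) * cinner x x)"
    by (simp only: inner_eq_Re_cinner cinner_scaleC_right cinner_scaleC_left mult_ac)
  also have "\<dots> = (cmod c)\<^sup>2 * inner x x"
    by (simp only: complex_norm_square[symmetric] inner_eq_Re_cinner Re_complex_of_real Im_complex_of_real
        mult_zero_left diff_zero times_complex.sel)
  finally have "(norm (c *\<^sub>C x))\<^sup>2 = (cmod c * norm x)\<^sup>2"
    by (simp add: power2_norm_eq_inner power_mult_distrib)
  then show ?thesis by (simp add: power2_eq_iff_nonneg)
qed

lemma scaleC_scaleR: "c *\<^sub>C (r *\<^sub>R x) = r *\<^sub>R (c *\<^sub>C x)"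
  by (simp add: scaleR_scaleC scaleC_scaleC mult.commute)

lemma bounded_linear_scaleC: "bounded_linear (\<lambda>x :: 'a::complex_hilbert_space. c *\<^sub>C x)"
  by (rule bounded_linear_intro[of _ "cmod c"])
    (simp_all add: scaleC_add_right scaleC_scaleR norm_scaleC mult.commute)

lemma scalar_op_apply [simp]: "blinfun_apply (scalar_op c) x = c *\<^sub>C x"
  by (simp add: scalar_op_def bounded_linear_Blinfun_apply bounded_linear_scaleC)

text \<open>The component of a vector outside the kernel that is orthogonal to the kernel represents
  the functional up to a scalar.\<close>

lemma riesz_representation:
  fixes f :: "'a::{real_inner,complete_space} \<Rightarrow> real"
  assumes f: "bounded_linear f"
  shows "\<exists>z. \<forall>x. f x = inner x z"
proof (cases "\<forall>x. f x = 0")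
  case True
  then show ?thesis by (intro exI[of _ 0]) simp
next
  case False
  then obtain x0 where x0: "f x0 \<noteq> 0" by blast
  interpret f: bounded_linear f by fact
  interpret N: closed_subspace "{x. f x = 0}"
  proof
    show "closed {x. f x = 0}" by (intro closed_Collect_eq continuous_intros f.continuous_on)
    show "subspace {x. f x = 0}" by (auto simp: subspace_def f.add f.scaleR)
  qed
  define y where "y = x0 - nearest {x. f x = 0} x0"
  have fy: "f y \<noteq> 0" using x0 N.nearest_mem[of x0] by (simp add: y_def f.diff)
  then have yy: "inner y y \<noteq> 0" by (auto simp: f.zero)
  have "f x = inner x ((f y / inner y y) *\<^sub>R y)" for x
  proof -
    have "f (x - (f x / f y) *\<^sub>R y) = 0" using fy by (simp add: f.diff f.scaleR)
    then have "inner y (x - (f x / f y) *\<^sub>R y) = 0" unfolding y_def using N.nearest_orth by blast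
    then have "inner x y = f x / f y * inner y y" by (simp add: inner_diff_right inner_commute)
    then show ?thesis using fy yy by simp
  qed
  then show ?thesis by blast
qed

section \<open>Bounded complex-linear operators and their adjoints\<close>

lemma bounded_ops_I: "(\<And>c \<xi>. blinfun_apply T (c *\<^sub>C \<xi>) = c *\<^sub>C blinfun_apply T \<xi>) \<Longrightarrow> T \<in> bounded_ops"
  by (simp add: bounded_ops_def)

lemma bounded_ops_D: "T \<in> bounded_ops \<Longrightarrow> blinfun_apply T (c *\<^sub>C \<xi>) = c *\<^sub>C blinfun_apply T \<xi>"
  by (simp add: bounded_ops_def)

text \<open>The real Riesz theorem gives a real-linear adjoint. Since \<open>T\<close> commutes with
  \<open>\<i>\<close>, so does the adjoint, and complex linearity and the identity for
  \<open>cinner\<close> follow.\<close>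

lemma adjoint_exists:
  fixes T :: "'h::complex_hilbert_space op"
  assumes T: "T \<in> bounded_ops"
  shows "\<exists>S\<in>bounded_ops. norm S \<le> norm T \<and> (\<forall>\<xi> \<eta>. cinner (T \<xi>) \<eta> = cinner \<xi> (blinfun_apply S \<eta>))"
proof -
  have "\<exists>z. \<forall>\<xi>. inner (T \<xi>) \<eta> = inner \<xi> z" for \<eta>
    by (intro riesz_representation bounded_linear_intros)
  then obtain S where S: "\<And>\<xi> \<eta>. inner (T \<xi>) \<eta> = inner \<xi> (S \<eta>)" by metis
  have S_eqI: "S \<eta> = z" if "\<And>\<xi>. inner (T \<xi>) \<eta> = inner \<xi> z" for \<eta> z
    using that S by (metis vector_eq_ldot)
  have bound: "norm (S \<eta>) \<le> norm T * norm \<eta>" for \<eta>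
  proof -
    have "norm (S \<eta>) * norm (S \<eta>) = inner (T (S \<eta>)) \<eta>"
      using S[of "S \<eta>" \<eta>] by (simp add: power2_norm_eq_inner flip: power2_eq_square)
    also have "\<dots> \<le> norm (T (S \<eta>)) * norm \<eta>" by (rule norm_cauchy_schwarz)
    also have "\<dots> \<le> (norm T * norm (S \<eta>)) * norm \<eta>" by (intro mult_right_mono norm_blinfun) simp
    finally have "norm (S \<eta>) * norm (S \<eta>) \<le> (norm T * norm \<eta>) * norm (S \<eta>)" by (simp add: mult_ac)
    then show ?thesis
      by (cases "norm (S \<eta>) = 0") (auto simp: mult_le_cancel_right)
  qed
  have bl: "bounded_linear S"
  proof (rule bounded_linear_intro)
    show "S (x + y) = S x + S y" for x y by (rule S_eqI) (simp add: inner_add_right S)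
    show "S (r *\<^sub>R x) = r *\<^sub>R S x" for r x by (rule S_eqI) (simp add: S)
    show "norm (S x) \<le> norm x * norm T" for x using bound[of x] by (simp add: mult.commute)
  qed
  have app: "blinfun_apply (Blinfun S) = S" by (rule bounded_linear_Blinfun_apply[OF bl])
  have ii: "S (\<i> *\<^sub>C x) = \<i> *\<^sub>C S x" for x
  proof (rule S_eqI)
    fix \<xi>
    have "inner (T \<xi>) (\<i> *\<^sub>C x) = - inner (T (\<i> *\<^sub>C \<xi>)) x"
      by (simp add: bounded_ops_D[OF T] inner_scaleC_ii)
    also have "\<dots> = inner \<xi> (\<i> *\<^sub>C S x)" by (simp add: S inner_scaleC_ii)
    finally show "inner (T \<xi>) (\<i> *\<^sub>C x) = inner \<xi> (\<i> *\<^sub>C S x)" .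
  qed
  have "S (c *\<^sub>C x) = c *\<^sub>C S x" for c x
  proof -
    have c: "c *\<^sub>C y = Re c *\<^sub>R y + Im c *\<^sub>R (\<i> *\<^sub>C y)" for y :: 'h
      by (simp add: scaleR_scaleC scaleC_scaleC flip: scaleC_add_left)
        (metis complex_eq mult.commute)
    interpret bounded_linear S by fact
    show ?thesis unfolding c[of x] c[of "S x"] by (simp add: add scaleR ii)
  qed
  then have "Blinfun S \<in> bounded_ops" by (intro bounded_ops_I) (simp add: app)
  moreover have "norm (Blinfun S) \<le> norm T" by (rule norm_blinfun_bound) (simp_all add: app bound)
  moreover have "cinner (T \<xi>) \<eta> = cinner \<xi> (S \<eta>)" for \<xi> \<eta>
    by (simp add: cinner_eq_inner S ii)
  ultimately show ?thesis by (intro bexI[of _ "Blinfun S"]) (auto simp: app)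
qed

lemma adj_eqI:
  fixes S T :: "'h::complex_hilbert_space op"
  assumes "\<And>\<xi> \<eta>. cinner (T \<xi>) \<eta> = cinner \<xi> (S \<eta>)"
  shows "adj T = S"
  unfolding adj_def
proof (rule the_equality)
  show "\<forall>\<xi> \<eta>. cinner (T \<xi>) \<eta> = cinner \<xi> (S \<eta>)" using assms by blast
  fix R :: "'h op" assume R: "\<forall>\<xi> \<eta>. cinner (T \<xi>) \<eta> = cinner \<xi> (R \<eta>)"
  then have "inner \<xi> (R \<eta>) = inner \<xi> (S \<eta>)" for \<xi> \<eta>
    using assms by (simp add: inner_eq_Re_cinner)
  then show "R = S" by (metis vector_eq_ldot blinfun_eqI)
qed

lemma
  fixes T :: "'h::complex_hilbert_space op"
  assumes T: "T \<in> bounded_ops"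
  shows adj_bounded_ops: "adj T \<in> bounded_ops"
    and norm_adj_le: "norm (adj T) \<le> norm T"
    and cinner_adj: "cinner (T \<xi>) \<eta> = cinner \<xi> (adj T \<eta>)"
  using adjoint_exists[OF T] adj_eqI[of T] by blast+

lemma inner_adj:
  fixes T :: "'h::complex_hilbert_space op"
  shows "T \<in> bounded_ops \<Longrightarrow> inner (T \<xi>) \<eta> = inner \<xi> (adj T \<eta>)"
  by (simp add: inner_eq_Re_cinner cinner_adj)

lemma adj_eqI_inner:
  fixes S T :: "'h::complex_hilbert_space op"
  assumes T: "T \<in> bounded_ops" and S: "\<And>\<xi> \<eta>. inner (T \<xi>) \<eta> = inner \<xi> (S \<eta>)"
  shows "adj T = S"
  using S inner_adj[OF T] by (metis vector_eq_ldot blinfun_eqI)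

lemma bounded_ops_id: "id_blinfun \<in> bounded_ops"
  and bounded_ops_scalar: "scalar_op c \<in> bounded_ops"
  and bounded_ops_zero: "0 \<in> bounded_ops"
  using scaleC_scaleR[of _ 0] by (simp_all add: bounded_ops_def scaleC_scaleC mult.commute)

lemma
  assumes "S \<in> bounded_ops" "T \<in> bounded_ops"
  shows bounded_ops_add: "S + T \<in> bounded_ops"
    and bounded_ops_diff: "S - T \<in> bounded_ops"
    and bounded_ops_compose: "S o\<^sub>L T \<in> bounded_ops"
  using assms
  by (auto simp: bounded_ops_def blinfun.bilinear_simps scaleC_add_right scaleC_scaleR
      linear_diff[OF bounded_linear.linear[OF bounded_linear_scaleC]])

lemma bounded_ops_scaleR: "S \<in> bounded_ops \<Longrightarrow> r *\<^sub>R S \<in> bounded_ops"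
  by (simp add: bounded_ops_def blinfun.bilinear_simps scaleC_scaleR)

lemma adj_adj:
  fixes T :: "'h::complex_hilbert_space op"
  assumes T: "T \<in> bounded_ops" shows "adj (adj T) = T"
  by (rule adj_eqI_inner[OF adj_bounded_ops[OF T]]) (metis inner_adj[OF T] inner_commute)

lemma adj_compose:
  fixes S T :: "'h::complex_hilbert_space op"
  assumes "S \<in> bounded_ops" "T \<in> bounded_ops" shows "adj (S o\<^sub>L T) = adj T o\<^sub>L adj S"
  by (rule adj_eqI_inner) (simp_all add: assms bounded_ops_compose inner_adj)

lemma adj_add:
  fixes S T :: "'h::complex_hilbert_space op"
  assumes "S \<in> bounded_ops" "T \<in> bounded_ops" shows "adj (S + T) = adj S + adj T"
  by (rule adj_eqI_inner)
    (simp_all add: assms bounded_ops_add inner_adj blinfun.bilinear_simps inner_add_left inner_add_right)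

lemma adj_diff:
  fixes S T :: "'h::complex_hilbert_space op"
  assumes "S \<in> bounded_ops" "T \<in> bounded_ops" shows "adj (S - T) = adj S - adj T"
  by (rule adj_eqI_inner)
    (simp_all add: assms bounded_ops_diff inner_adj blinfun.bilinear_simps inner_diff_left inner_diff_right)

lemma adj_scaleR:
  fixes T :: "'h::complex_hilbert_space op"
  assumes "T \<in> bounded_ops" shows "adj (r *\<^sub>R T) = r *\<^sub>R adj T"
  by (rule adj_eqI_inner) (simp_all add: assms bounded_ops_scaleR inner_adj blinfun.bilinear_simps)

lemma adj_id: "adj id_blinfun = (id_blinfun :: 'h::complex_hilbert_space op)"
  by (rule adj_eqI) simp

lemma adj_scalar_op: "adj (scalar_op c) = (scalar_op (cnj c) :: 'h::complex_hilbert_space op)"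
  by (rule adj_eqI) (simp add: cinner_scaleC_left cinner_scaleC_right)

text \<open>Stated with the real inner product. Self-adjointness is a separate clause because a
  quadratic form with nonnegative real part does not imply it.\<close>

definition pos :: "'h::complex_hilbert_space op \<Rightarrow> bool" where
  "pos T \<longleftrightarrow> T \<in> bounded_ops \<and> adj T = T \<and> (\<forall>\<xi>. 0 \<le> inner (T \<xi>) \<xi>)"

lemma posI: "T \<in> bounded_ops \<Longrightarrow> adj T = T \<Longrightarrow> (\<And>\<xi>. 0 \<le> inner (T \<xi>) \<xi>) \<Longrightarrow> pos T"
  and pos_bounded_ops: "pos T \<Longrightarrow> T \<in> bounded_ops"
  and pos_adj: "pos T \<Longrightarrow> adj T = T"
  and pos_inner: "pos T \<Longrightarrow> 0 \<le> inner (T \<xi>) \<xi>"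
  by (simp_all add: pos_def)

lemma selfadj_inner:
  fixes T :: "'h::complex_hilbert_space op"
  shows "T \<in> bounded_ops \<Longrightarrow> adj T = T \<Longrightarrow> inner (T \<xi>) \<eta> = inner \<xi> (T \<eta>)"
  by (metis inner_adj)

lemma pos_positive_op:
  fixes T :: "'h::complex_hilbert_space op"
  assumes "pos T" shows "positive_op T"
proof -
  have T: "T \<in> bounded_ops" "adj T = T" using assms by (simp_all add: pos_def)
  have "inner (T \<xi>) (\<i> *\<^sub>C \<xi>) = - inner (T \<xi>) (\<i> *\<^sub>C \<xi>)" for \<xi>
  proof -
    have "inner (T \<xi>) (\<i> *\<^sub>C \<xi>) = inner \<xi> (\<i> *\<^sub>C T \<xi>)"
      by (simp add: selfadj_inner[OF T] bounded_ops_D[OF T(1)])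
    also have "\<dots> = - inner (T \<xi>) (\<i> *\<^sub>C \<xi>)" using inner_scaleC_ii[of \<xi> "T \<xi>"] by (simp add: inner_commute)
    finally show ?thesis .
  qed
  then have "inner (T \<xi>) (\<i> *\<^sub>C \<xi>) = 0" for \<xi> by (metis equal_neg_zero)
  then have "cinner (T \<xi>) \<xi> \<in> \<real>\<^sub>\<ge>\<^sub>0" for \<xi>
    using pos_inner[OF assms, of \<xi>] by (simp add: cinner_eq_inner complex_nonneg_Reals_iff)
  then show ?thesis using T by (simp add: positive_op_def)
qed

text \<open>This is the operator inequality \<open>T^2 \<le> K T\<close>, obtained without square
  roots by evaluating the form of \<open>T\<close> at
  \<open>\<xi> - (1 / K) T \<xi>\<close>.\<close>

lemma pos_norm_apply_le:
  assumes T: "pos T" and K: "\<And>\<xi>. inner (T \<xi>) \<xi> \<le> K * (norm \<xi>)\<^sup>2" "0 < K"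
  shows "(norm (T \<xi>))\<^sup>2 \<le> K * inner (T \<xi>) \<xi>"
proof -
  let ?v = "T \<xi>" and ?s = "1 / K"
  have expand: "inner (T (\<xi> - s *\<^sub>R ?v)) (\<xi> - s *\<^sub>R ?v) =
      inner ?v \<xi> - 2 * s * (norm ?v)\<^sup>2 + s\<^sup>2 * inner (T ?v) ?v" for s
    using selfadj_inner[OF pos_bounded_ops[OF T] pos_adj[OF T], of ?v \<xi>]
    unfolding power2_norm_eq_inner
    by (simp add: blinfun.bilinear_simps inner_diff_left inner_diff_right power2_eq_square algebra_simps)
  have "0 \<le> inner (T (\<xi> - ?s *\<^sub>R ?v)) (\<xi> - ?s *\<^sub>R ?v)" by (rule pos_inner[OF T])
  also have "\<dots> \<le> inner ?v \<xi> - 2 * ?s * (norm ?v)\<^sup>2 + ?s\<^sup>2 * (K * (norm ?v)\<^sup>2)"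
    unfolding expand using K(1)[of ?v] by (intro add_left_mono mult_left_mono) auto
  also have "\<dots> = inner ?v \<xi> - ?s * (norm ?v)\<^sup>2" using K(2) by (simp add: power2_eq_square)
  finally show ?thesis using K(2) by (simp add: field_simps)
qed

text \<open>The operator \<open>S = K + T\<close> lies between 0 and \<open>2 K\<close>, so
  \<open>S^2 \<le> 2 K S\<close>; expanding this leaves \<open>T^2 \<le> K^2\<close>.\<close>

lemma norm_le_of_pos:
  fixes T :: "'h::complex_hilbert_space op"
  assumes "pos (K *\<^sub>R id_blinfun - T)" "pos (K *\<^sub>R id_blinfun + T)" "0 < K"
  shows "norm T \<le> K"
proof (rule norm_blinfun_bound)
  fix \<xi>
  let ?S = "K *\<^sub>R id_blinfun + T"
  have "inner (?S \<xi>) \<xi> \<le> (2 * K) * (norm \<xi>)\<^sup>2" for \<xi>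
    using pos_inner[OF assms(1), of \<xi>]
    by (simp add: blinfun.bilinear_simps inner_diff_left inner_add_left power2_norm_eq_inner)
  then have "(norm (?S \<xi>))\<^sup>2 \<le> (2 * K) * inner (?S \<xi>) \<xi>"
    using assms by (intro pos_norm_apply_le) auto
  then have "(norm (T \<xi>))\<^sup>2 \<le> (K * norm \<xi>)\<^sup>2"
    unfolding power_mult_distrib power2_norm_eq_inner
    by (simp add: blinfun.bilinear_simps inner_add_left inner_add_right inner_commute power2_eq_square algebra_simps)
  then show "norm (T \<xi>) \<le> K * norm \<xi>"
    by (rule power2_le_imp_le) (use assms(3) in simp)
qed (use assms in simp)

lemma norm_le_1_of_pos:
  fixes T :: "'h::complex_hilbert_space op"
  assumes T: "pos T" "pos (id_blinfun - T)"
  shows "norm T \<le> 1"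
proof (rule norm_le_of_pos)
  have "pos (id_blinfun + T)"
    using T(1) by (auto simp: pos_def bounded_ops_add bounded_ops_id adj_add adj_id
        blinfun.add_left inner_add_left)
  then show "pos (1 *\<^sub>R id_blinfun + T)" by simp
qed (use T in simp_all)

lemma abs_inner_le_norm:
  fixes T :: "'a::real_inner \<Rightarrow>\<^sub>L 'a"
  shows "\<bar>inner (T \<xi>) \<xi>\<bar> \<le> norm T * (norm \<xi>)\<^sup>2"
proof -
  have "\<bar>inner (T \<xi>) \<xi>\<bar> \<le> norm (T \<xi>) * norm \<xi>" by (rule Cauchy_Schwarz_ineq2)
  also have "\<dots> \<le> (norm T * norm \<xi>) * norm \<xi>" by (intro mult_right_mono norm_blinfun) simp
  finally show ?thesis by (simp add: power2_eq_square mult_ac)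
qed

lemma pos_id_minus:
  fixes T :: "'h::complex_hilbert_space op"
  assumes T: "T \<in> bounded_ops" "adj T = T" "norm T \<le> K"
  shows "pos (K *\<^sub>R id_blinfun - T)"
proof (rule posI)
  show "K *\<^sub>R id_blinfun - T \<in> bounded_ops"
    by (intro bounded_ops_diff bounded_ops_scaleR[OF bounded_ops_id] T)
  show "adj (K *\<^sub>R id_blinfun - T) = K *\<^sub>R id_blinfun - T"
    using T by (simp add: adj_diff adj_scaleR adj_id bounded_ops_scaleR[OF bounded_ops_id] bounded_ops_id)
  fix \<xi>
  have "inner (T \<xi>) \<xi> \<le> norm T * (norm \<xi>)\<^sup>2" using abs_inner_le_norm[of T \<xi>] by linarith
  also have "\<dots> \<le> K * (norm \<xi>)\<^sup>2" using T(3) by (intro mult_right_mono) auto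
  finally show "0 \<le> inner ((K *\<^sub>R id_blinfun - T) \<xi>) \<xi>"
    by (simp add: blinfun.bilinear_simps inner_diff_left power2_norm_eq_inner)
qed

lemma pos_adj_compose:
  fixes T :: "'h::complex_hilbert_space op"
  assumes T: "T \<in> bounded_ops" shows "pos (adj T o\<^sub>L T)"
proof (rule posI)
  show "adj T o\<^sub>L T \<in> bounded_ops" by (intro bounded_ops_compose adj_bounded_ops T)
  show "adj (adj T o\<^sub>L T) = adj T o\<^sub>L T" by (simp add: adj_compose adj_bounded_ops T adj_adj)
  show "0 \<le> inner ((adj T o\<^sub>L T) \<xi>) \<xi>" for \<xi>
    using inner_adj[OF T, of \<xi> "T \<xi>"] inner_ge_zero[of "T \<xi>"]
    by (simp only: blinfun_apply_blinfun_compose inner_commute[of _ \<xi>])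
qed

lemma pos_conj:
  fixes S T :: "'h::complex_hilbert_space op"
  assumes S: "pos S" and T: "T \<in> bounded_ops" shows "pos (adj T o\<^sub>L S o\<^sub>L T)"
proof (rule posI)
  have S': "S \<in> bounded_ops" "adj S = S" using S by (simp_all add: pos_def)
  show "adj T o\<^sub>L S o\<^sub>L T \<in> bounded_ops" by (intro bounded_ops_compose adj_bounded_ops T S')
  have "adj (adj T o\<^sub>L S o\<^sub>L T) = adj T o\<^sub>L (S o\<^sub>L T)"
    by (simp add: adj_compose bounded_ops_compose adj_bounded_ops T S' adj_adj)
  then show "adj (adj T o\<^sub>L S o\<^sub>L T) = adj T o\<^sub>L S o\<^sub>L T" by (simp add: blinfun_eqI)
  show "0 \<le> inner ((adj T o\<^sub>L S o\<^sub>L T) \<xi>) \<xi>" for \<xi>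
    using inner_adj[OF T, of \<xi> "S (T \<xi>)"] pos_inner[OF S, of "T \<xi>"] by (simp add: inner_commute)
qed

lemma norm_adj:
  fixes T :: "'h::complex_hilbert_space op"
  assumes T: "T \<in> bounded_ops" shows "norm (adj T) = norm T"
  using norm_adj_le[OF T] norm_adj_le[OF adj_bounded_ops[OF T]] adj_adj[OF T] by simp

text \<open>The inverse of \<open>1 + T\<close>: its range is closed since \<open>1 + T\<close> is bounded below, and dense since
  \<open>1 + T\<close> is self-adjoint and injective.\<close>

lemma pos_inverse:
  fixes T :: "'h::complex_hilbert_space op"
  assumes T: "pos T"
  obtains R :: "'h op" where "R \<in> bounded_ops" "\<And>\<xi>. R (\<xi> + T \<xi>) = \<xi>" "\<And>\<xi>. R \<xi> + T (R \<xi>) = \<xi>"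
    "norm R \<le> 1" "pos R" "pos (id_blinfun - R)"
proof -
  have TB: "T \<in> bounded_ops" and Ta: "adj T = T" using T by (simp_all add: pos_def)
  let ?S = "id_blinfun + T"
  have S_app: "?S \<xi> = \<xi> + T \<xi>" for \<xi> by (simp add: blinfun.bilinear_simps)
  have Sa: "inner (?S \<xi>) \<eta> = inner \<xi> (?S \<eta>)" for \<xi> \<eta>
    using selfadj_inner[OF TB Ta, of \<xi> \<eta>] by (simp add: S_app inner_add_left inner_add_right)
  have below: "(norm \<xi>)\<^sup>2 \<le> inner (?S \<xi>) \<xi>" for \<xi>
    using pos_inner[OF T, of \<xi>] by (simp add: S_app inner_add_left power2_norm_eq_inner)
  have low: "norm \<xi> \<le> norm (?S \<xi>)" for \<xi>
  proof -
    have "norm \<xi> * norm \<xi> \<le> norm (?S \<xi>) * norm \<xi>"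
      using below[of \<xi>] norm_cauchy_schwarz[of "?S \<xi>" \<xi>] by (simp add: power2_eq_square)
    then show ?thesis by (cases "norm \<xi> = 0") (auto simp: mult_le_cancel_right)
  qed
  have lin: "linear (blinfun_apply ?S)" by (simp add: bounded_linear.linear blinfun.bounded_linear_right)
  have inj: "inj (blinfun_apply ?S)"
  proof (rule injI)
    fix x y assume "?S x = ?S y"
    then have "?S (x - y) = 0" by (simp only: blinfun.diff_right diff_self)
    then show "x = y" using low[of "x - y"] by simp
  qed
  have "complete (range ?S)"
    by (rule complete_isometric_image[of 1])
      (simp_all add: low complete_UNIV blinfun.bounded_linear_right)
  then have "closed (range ?S)" by (rule complete_imp_closed)
  then interpret R: closed_subspace "range ?S"
    using linear_subspace_image[OF lin subspace_UNIV] by unfold_locales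
  have surj: "\<exists>x. ?S x = y" for y
  proof -
    let ?w = "y - nearest (range ?S) y"
    have "inner ?w (?S ?w) = 0" by (rule R.nearest_orth) simp
    then have "?w = 0" using below[of ?w] by (simp add: inner_commute)
    then show ?thesis using R.nearest_mem[of y] by auto
  qed
  define g where "g y = (THE x. ?S x = y)" for y
  have ex1: "\<exists>!x. ?S x = y" for y using surj[of y] inj by (auto dest: injD)
  have Sg: "?S (g y) = y" for y unfolding g_def by (rule theI'[OF ex1])
  have gS: "g (?S x) = x" for x using Sg inj by (auto dest: injD)
  have bound: "norm (g x) \<le> norm x" for x using low[of "g x"] by (simp only: Sg)
  have "bounded_linear g"
  proof (rule bounded_linear_intro)
    show "g (x + y) = g x + g y" for x y
      using gS[of "g x + g y"] by (simp only: blinfun.add_right Sg)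
    show "g (r *\<^sub>R x) = r *\<^sub>R g x" for r x
      using gS[of "r *\<^sub>R g x"] by (simp only: blinfun.scaleR_right Sg)
    show "norm (g x) \<le> norm x * 1" for x using bound by simp
  qed
  then have app: "blinfun_apply (Blinfun g) = g" by (rule bounded_linear_Blinfun_apply)
  have SB: "?S \<in> bounded_ops" by (intro bounded_ops_add bounded_ops_id TB)
  have gC: "g (c *\<^sub>C x) = c *\<^sub>C g x" for c x
    using gS[of "c *\<^sub>C g x"] by (simp only: bounded_ops_D[OF SB] Sg)
  have RB: "Blinfun g \<in> bounded_ops" by (intro bounded_ops_I) (simp add: app gC)
  have symm: "inner (g x) y = inner x (g y)" for x y
    using Sa[of "g x" "g y"] by (simp only: Sg)
  have Ra: "adj (Blinfun g) = Blinfun g" by (rule adj_eqI_inner[OF RB]) (simp add: app symm)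
  show thesis
  proof (rule that[of "Blinfun g"])
    show "norm (Blinfun g) \<le> 1" by (rule norm_blinfun_bound) (simp_all add: app bound)
    show "blinfun_apply (Blinfun g) (\<xi> + T \<xi>) = \<xi>" for \<xi> using gS[of \<xi>] by (simp add: app S_app)
    show "blinfun_apply (Blinfun g) \<xi> + T (blinfun_apply (Blinfun g) \<xi>) = \<xi>" for \<xi>
      using Sg[of \<xi>] by (simp add: app S_app)
    show "pos (Blinfun g)"
    proof (rule posI[OF RB Ra])
      fix \<xi>
      have "0 \<le> (norm (g \<xi>))\<^sup>2" by simp
      also have "\<dots> \<le> inner \<xi> (g \<xi>)" using below[of "g \<xi>"] by (simp only: Sg)
      finally show "0 \<le> inner (blinfun_apply (Blinfun g) \<xi>) \<xi>" by (simp add: app inner_commute)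
    qed
    then show "pos (id_blinfun - Blinfun g)"
      using pos_id_minus[OF RB Ra, of 1] norm_blinfun_bound[of 1 "Blinfun g"] bound by (simp add: app)
  qed (fact RB)
qed

text \<open>With \<open>z = R \<xi>\<close> and \<open>e = R' \<xi>\<close>, the form of
  \<open>R - R'\<close> at \<open>\<xi>\<close> is the sum of three nonnegative terms: the form of
  \<open>T\<close> at \<open>z - e\<close>, the form of \<open>T' - T\<close> at \<open>e\<close>,
  and the squared norm of \<open>z - e\<close>.\<close>

lemma pos_inverse_antimono:
  fixes T T' :: "'h::complex_hilbert_space op"
  assumes T: "pos T" and TT': "pos (T' - T)"
    and R: "pos R" "\<And>\<xi>. R \<xi> + T (R \<xi>) = \<xi>" and R': "pos R'" "\<And>\<xi>. R' \<xi> + T' (R' \<xi>) = \<xi>"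
  shows "pos (R - R')"
proof (rule posI)
  show "R - R' \<in> bounded_ops" using R R' by (intro bounded_ops_diff) (simp_all add: pos_def)
  show "adj (R - R') = R - R'" using R R' by (simp add: adj_diff pos_def)
  fix \<xi>
  let ?z = "R \<xi>" and ?e = "R' \<xi>"
  have TB: "T \<in> bounded_ops" "adj T = T" using T by (simp_all add: pos_def)
  have 1: "0 \<le> inner (T (?z - ?e)) (?z - ?e)" by (rule pos_inner[OF T])
  have 2: "0 \<le> inner (T' ?e - T ?e) ?e" using pos_inner[OF TT', of ?e] by (simp add: blinfun.diff_left)
  have 3: "T ?z = \<xi> - ?z" "T' ?e = \<xi> - ?e" using R(2)[of \<xi>] R'(2)[of \<xi>] by (simp_all add: eq_diff_eq add.commute)
  have 4: "inner (T ?e) ?z = inner ?e (\<xi> - ?z)" using selfadj_inner[OF TB, of ?e ?z] 3 by simp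
  have 5: "0 \<le> inner (?z - ?e) (?z - ?e)" by simp
  show "0 \<le> inner ((R - R') \<xi>) \<xi>"
    using 1 2 4 5 unfolding blinfun.diff_right blinfun.diff_left 3
    by (simp add: inner_diff_left inner_diff_right inner_commute)
qed

section \<open>Pointwise limits of sequences of operators\<close>

lemma blinfun_strong_limit:
  fixes T :: "nat \<Rightarrow> 'h::complex_hilbert_space op"
  assumes bd: "\<And>n. norm (T n) \<le> K" and conv: "\<And>\<xi>. convergent (\<lambda>n. T n \<xi>)"
  obtains S :: "'h op" where "\<And>\<xi>. (\<lambda>n. T n \<xi>) \<longlonglongrightarrow> S \<xi>" "norm S \<le> K"
proof -
  define g where "g \<xi> = lim (\<lambda>n. T n \<xi>)" for \<xi>
  have lim: "(\<lambda>n. T n \<xi>) \<longlonglongrightarrow> g \<xi>" for \<xi> using conv[of \<xi>] by (simp add: g_def convergent_LIMSEQ_iff)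
  have bound: "norm (g \<xi>) \<le> K * norm \<xi>" for \<xi>
  proof (rule LIMSEQ_le_const2[OF tendsto_norm[OF lim]])
    have "norm (T n \<xi>) \<le> K * norm \<xi>" for n
      using norm_blinfun[of "T n" \<xi>] mult_right_mono[OF bd[of n], of "norm \<xi>"] by simp
    then show "\<exists>N. \<forall>n\<ge>N. norm (T n \<xi>) \<le> K * norm \<xi>" by blast
  qed
  have K: "0 \<le> K" using bd[of 0] norm_ge_zero order_trans by blast
  have "bounded_linear g"
  proof (rule bounded_linear_intro)
    show "g (x + y) = g x + g y" for x y
      using LIMSEQ_unique[OF lim[of "x + y"]] tendsto_add[OF lim[of x] lim[of y]]
      by (simp add: blinfun.add_right)
    show "g (r *\<^sub>R x) = r *\<^sub>R g x" for r x
      using LIMSEQ_unique[OF lim[of "r *\<^sub>R x"]] tendsto_scaleR[OF tendsto_const lim[of x], of r]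
      by (simp add: blinfun.scaleR_right)
    show "norm (g x) \<le> norm x * K" for x using bound by (simp add: mult.commute)
  qed
  then have app: "blinfun_apply (Blinfun g) = g" by (rule bounded_linear_Blinfun_apply)
  show thesis
    by (rule that[of "Blinfun g"]) (use lim bound K in \<open>auto simp: app intro: norm_blinfun_bound\<close>)
qed

lemma adj_strong_limit:
  fixes T :: "nat \<Rightarrow> 'h::complex_hilbert_space op" and S :: "'h op"
  assumes T: "\<And>n. T n \<in> bounded_ops" "\<And>n. adj (T n) = T n" and lim: "\<And>\<xi>. (\<lambda>n. T n \<xi>) \<longlonglongrightarrow> S \<xi>"
    and S: "S \<in> bounded_ops"
  shows "adj S = S"
proof (rule adj_eqI_inner[OF S])
  fix \<xi> \<eta>
  have "(\<lambda>n. inner (T n \<xi>) \<eta>) \<longlonglongrightarrow> inner (S \<xi>) \<eta>" by (intro tendsto_intros lim)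
  moreover have "(\<lambda>n. inner \<xi> (T n \<eta>)) \<longlonglongrightarrow> inner \<xi> (S \<eta>)" by (intro tendsto_intros lim)
  ultimately show "inner (S \<xi>) \<eta> = inner \<xi> (S \<eta>)"
    using LIMSEQ_unique by (simp add: selfadj_inner[OF T])
qed

text \<open>Quadratic forms increase and are bounded; the inequality
  \<open>(T n - T m)^2 \<le> T n - T m\<close> turns their convergence into convergence at every
  vector.\<close>

lemma monotone_strong_limit:
  fixes T :: "nat \<Rightarrow> 'h::complex_hilbert_space op"
  assumes pos: "\<And>n. pos (T n)" "\<And>n. norm (T n) \<le> 1" and mono: "\<And>m n. m \<le> n \<Longrightarrow> pos (T n - T m)"
  obtains S :: "'h op" where "\<And>\<xi>. (\<lambda>n. T n \<xi>) \<longlonglongrightarrow> S \<xi>" "norm S \<le> 1"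
proof -
  have "convergent (\<lambda>n. T n \<xi>)" for \<xi>
  proof -
    have inc: "incseq (\<lambda>n. inner (T n \<xi>) \<xi>)"
      using pos_inner[OF mono] by (auto simp: incseq_def blinfun.diff_left inner_diff_left)
    have "inner (T n \<xi>) \<xi> \<le> (norm \<xi>)\<^sup>2" for n
      using abs_inner_le_norm[of "T n" \<xi>] mult_right_mono[OF pos(2)[of n], of "(norm \<xi>)\<^sup>2"] by simp
    then have conv: "convergent (\<lambda>n. inner (T n \<xi>) \<xi>)"
      using incseq_convergent[OF inc, of "(norm \<xi>)\<^sup>2"] by (metis convergent_def)
    have key: "(norm (T n \<xi> - T m \<xi>))\<^sup>2 \<le> inner (T n \<xi>) \<xi> - inner (T m \<xi>) \<xi>" if "m \<le> n" for m n
    proof -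
      have "inner ((T n - T m) \<xi>) \<xi> \<le> 1 * (norm \<xi>)\<^sup>2" for \<xi>
        using pos_inner[OF pos(1)[of m], of \<xi>] abs_inner_le_norm[of "T n" \<xi>]
          mult_right_mono[OF pos(2)[of n], of "(norm \<xi>)\<^sup>2"]
        by (simp add: blinfun.diff_left inner_diff_left)
      then have "(norm ((T n - T m) \<xi>))\<^sup>2 \<le> 1 * inner ((T n - T m) \<xi>) \<xi>"
        by (intro pos_norm_apply_le mono that) auto
      then show ?thesis by (simp add: blinfun.diff_left inner_diff_left)
    qed
    have "Cauchy (\<lambda>n. T n \<xi>)" by (rule Cauchy_of_squared_increments[OF conv key])
    then show ?thesis using Cauchy_convergent_iff by blast
  qed
  then show thesis using blinfun_strong_limit[of T, OF pos(2)] that by blast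
qed

section \<open>Von Neumann algebras with a faithful normal tracial state\<close>

lemma id_compose [simp]: "id_blinfun o\<^sub>L x = x" "x o\<^sub>L id_blinfun = x"
  by (rule blinfun_eqI, simp)+

lemma compose_assoc: "(x o\<^sub>L y) o\<^sub>L z = x o\<^sub>L (y o\<^sub>L z)"
  by (rule blinfun_eqI) simp

lemmas compose_simps =
  bounded_bilinear.add_left[OF bounded_bilinear_blinfun_compose]
  bounded_bilinear.add_right[OF bounded_bilinear_blinfun_compose]
  bounded_bilinear.diff_left[OF bounded_bilinear_blinfun_compose]
  bounded_bilinear.diff_right[OF bounded_bilinear_blinfun_compose]
  bounded_bilinear.scaleR_left[OF bounded_bilinear_blinfun_compose]
  bounded_bilinear.scaleR_right[OF bounded_bilinear_blinfun_compose]
  bounded_bilinear.zero_left[OF bounded_bilinear_blinfun_compose]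
  bounded_bilinear.zero_right[OF bounded_bilinear_blinfun_compose]

lemma scalar_op_real: "scalar_op (complex_of_real r) o\<^sub>L x = r *\<^sub>R x"
  by (rule blinfun_eqI) (simp add: blinfun.scaleR_left scaleR_scaleC)

locale tracial_vn =
  fixes M :: "'h::complex_hilbert_space op set"
    and \<tau> :: "'h op \<Rightarrow> complex"
    and hat :: "'h op \<Rightarrow> 'k::complex_hilbert_space"
  assumes vn: "von_neumann_algebra M"
    and tau: "faithful_normal_tracial_state M \<tau>"
    and L2: "L2_completion M \<tau> hat"
begin

lemma bounded: "x \<in> M \<Longrightarrow> x \<in> bounded_ops"
  using vn by (auto simp: von_neumann_algebra_def)

lemma M_adj: "x \<in> M \<Longrightarrow> adj x \<in> M"
  using vn by (simp add: von_neumann_algebra_def)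

lemma commutes:
  assumes "x \<in> M" "A \<in> commutant M" shows "x (A \<xi>) = A (x \<xi>)"
proof -
  have "A o\<^sub>L x = x o\<^sub>L A" using assms by (auto simp: commutant_def)
  then show ?thesis by (metis blinfun_apply_blinfun_compose)
qed

text \<open>The bicommutant condition reduces membership to commutation at vectors, which is easily
  checked for sums, products, inverses and strong limits.\<close>

lemma memI:
  assumes "x \<in> bounded_ops" "\<And>A \<xi>. A \<in> commutant M \<Longrightarrow> x (A \<xi>) = A (x \<xi>)"
  shows "x \<in> M"
proof -
  have "x o\<^sub>L A = A o\<^sub>L x" if "A \<in> commutant M" for A
    by (rule blinfun_eqI) (simp add: assms(2)[OF that])
  then have "x \<in> commutant (commutant M)" using assms(1) by (subst commutant_def) auto
  then show ?thesis using vn by (simp add: von_neumann_algebra_def)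
qed

lemma commutant_bounded: "A \<in> commutant M \<Longrightarrow> A \<in> bounded_ops"
  by (simp add: commutant_def)

lemma M_id: "id_blinfun \<in> M" by (rule memI) (simp_all add: bounded_ops_id)

lemma M_scalar: "scalar_op c \<in> M"
  by (rule memI) (simp_all add: bounded_ops_scalar bounded_ops_D commutant_bounded)

lemma M_add: "x \<in> M \<Longrightarrow> y \<in> M \<Longrightarrow> x + y \<in> M"
  by (rule memI) (simp_all add: bounded_ops_add bounded commutes blinfun.bilinear_simps)

lemma M_diff: "x \<in> M \<Longrightarrow> y \<in> M \<Longrightarrow> x - y \<in> M"
  by (rule memI) (simp_all add: bounded_ops_diff bounded commutes blinfun.bilinear_simps)

lemma M_scaleR: "x \<in> M \<Longrightarrow> r *\<^sub>R x \<in> M"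
  by (rule memI) (simp_all add: bounded_ops_scaleR bounded commutes blinfun.bilinear_simps)

lemma M_uminus: "x \<in> M \<Longrightarrow> - x \<in> M"
  using M_scaleR[of x "-1"] by simp

lemma M_zero: "0 \<in> M"
  using M_scaleR[OF M_id, of 0] by simp

lemma M_compose: "x \<in> M \<Longrightarrow> y \<in> M \<Longrightarrow> x o\<^sub>L y \<in> M"
  by (rule memI) (simp_all add: bounded_ops_compose bounded commutes)

lemma M_sum: "(\<And>i. i \<in> I \<Longrightarrow> f i \<in> M) \<Longrightarrow> sum f I \<in> M"
  by (induction I rule: infinite_finite_induct) (auto intro: M_zero M_add)

lemmas M_intros = M_id M_scalar M_add M_diff M_scaleR M_uminus M_zero M_compose M_adj

lemma M_strong_limit:
  fixes S :: "'h op"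
  assumes T: "\<And>n :: nat. T n \<in> M" and lim: "\<And>\<xi>. (\<lambda>n. T n \<xi>) \<longlonglongrightarrow> S \<xi>"
  shows "S \<in> M"
proof (rule memI)
  show "S \<in> bounded_ops"
  proof (rule bounded_ops_I)
    fix c \<xi>
    have "(\<lambda>n. T n (c *\<^sub>C \<xi>)) \<longlonglongrightarrow> S (c *\<^sub>C \<xi>)" by (rule lim)
    moreover have "(\<lambda>n. c *\<^sub>C T n \<xi>) \<longlonglongrightarrow> c *\<^sub>C S \<xi>"
      by (rule bounded_linear.tendsto[OF bounded_linear_scaleC lim])
    ultimately show "S (c *\<^sub>C \<xi>) = c *\<^sub>C S \<xi>"
      using LIMSEQ_unique by (simp add: bounded_ops_D[OF bounded[OF T]])
  qed
  fix A \<xi> assume A: "A \<in> commutant M"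
  have "(\<lambda>n. T n (A \<xi>)) \<longlonglongrightarrow> S (A \<xi>)" by (rule lim)
  moreover have "(\<lambda>n. A (T n \<xi>)) \<longlonglongrightarrow> A (S \<xi>)" by (intro tendsto_intros lim)
  ultimately show "S (A \<xi>) = A (S \<xi>)"
    using LIMSEQ_unique by (simp add: commutes[OF T A])
qed

lemma M_inverse:
  assumes T: "T \<in> M" and R: "R \<in> bounded_ops" "\<And>\<xi>. R (\<xi> + T \<xi>) = \<xi>" "\<And>\<xi>. R \<xi> + T (R \<xi>) = \<xi>"
  shows "R \<in> M"
proof (rule memI[OF R(1)])
  fix A \<xi> assume A: "A \<in> commutant M"
  have "A (R \<xi>) = R (A (R \<xi>) + T (A (R \<xi>)))" by (simp add: R(2))
  also have "A (R \<xi>) + T (A (R \<xi>)) = A (R \<xi> + T (R \<xi>))"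
    by (simp add: commutes[OF T A] blinfun.add_right)
  finally show "R (A \<xi>) = A (R \<xi>)" by (simp add: R(3))
qed

section \<open>The trace and the 2-norm\<close>

definition tr :: "'h op \<Rightarrow> real" where "tr x = Re (\<tau> x)"

lemma tau_add: "x \<in> M \<Longrightarrow> y \<in> M \<Longrightarrow> \<tau> (x + y) = \<tau> x + \<tau> y"
  and tau_scalar: "x \<in> M \<Longrightarrow> \<tau> (scalar_op c o\<^sub>L x) = c * \<tau> x"
  and tau_pos: "x \<in> M \<Longrightarrow> \<tau> (adj x o\<^sub>L x) \<in> \<real>\<^sub>\<ge>\<^sub>0"
  and tau_id: "\<tau> id_blinfun = 1"
  and normal: "normal_on M \<tau>"
  and faithful: "x \<in> M \<Longrightarrow> \<tau> (adj x o\<^sub>L x) = 0 \<Longrightarrow> x = 0"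
  and tau_commute: "x \<in> M \<Longrightarrow> y \<in> M \<Longrightarrow> \<tau> (x o\<^sub>L y) = \<tau> (y o\<^sub>L x)"
  using tau by (simp_all add: faithful_normal_tracial_state_def state_on_def)

lemma tr_add: "x \<in> M \<Longrightarrow> y \<in> M \<Longrightarrow> tr (x + y) = tr x + tr y"
  by (simp add: tr_def tau_add)

lemma tr_scaleR: "x \<in> M \<Longrightarrow> tr (r *\<^sub>R x) = r * tr x"
  using tau_scalar[of x "complex_of_real r"] by (simp add: tr_def scalar_op_real)

lemma tr_diff: "x \<in> M \<Longrightarrow> y \<in> M \<Longrightarrow> tr (x - y) = tr x - tr y"
  using tr_add[of x "(-1) *\<^sub>R y"] tr_scaleR[of y "-1"] M_scaleR[of y "-1"] by simp

lemma tr_id: "tr id_blinfun = 1" by (simp add: tr_def tau_id)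

lemma tr_zero: "tr 0 = 0" using tr_scaleR[OF M_id, of 0] by simp

lemma tr_sum: "finite I \<Longrightarrow> (\<And>i. i \<in> I \<Longrightarrow> f i \<in> M) \<Longrightarrow> tr (sum f I) = (\<Sum>i\<in>I. tr (f i))"
  by (induction I rule: finite_induct) (auto simp: tr_zero tr_add M_sum)

lemma tr_commute: "x \<in> M \<Longrightarrow> y \<in> M \<Longrightarrow> tr (x o\<^sub>L y) = tr (y o\<^sub>L x)"
  by (simp add: tr_def tau_commute)

lemma tr_square_nonneg: "x \<in> M \<Longrightarrow> 0 \<le> tr (adj x o\<^sub>L x)"
  using tau_pos[of x] by (simp add: tr_def complex_nonneg_Reals_iff)

lemma tr_faithful: "x \<in> M \<Longrightarrow> tr (adj x o\<^sub>L x) = 0 \<Longrightarrow> x = 0"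
  using tau_pos[of x] by (intro faithful) (auto simp: tr_def complex_nonneg_Reals_iff complex_eq_iff)

lemma hat_add: "x \<in> M \<Longrightarrow> y \<in> M \<Longrightarrow> hat (x + y) = hat x + hat y"
  and hat_scalar: "x \<in> M \<Longrightarrow> hat (scalar_op c o\<^sub>L x) = c *\<^sub>C hat x"
  and cinner_hat: "x \<in> M \<Longrightarrow> y \<in> M \<Longrightarrow> cinner (hat x) (hat y) = \<tau> (adj y o\<^sub>L x)"
  and hat_dense: "closure (hat ` M) = UNIV"
  using L2 by (simp_all add: L2_completion_def)

lemma hat_scaleR: "x \<in> M \<Longrightarrow> hat (r *\<^sub>R x) = r *\<^sub>R hat x"
  using hat_scalar[of x "complex_of_real r"] by (simp add: scalar_op_real scaleR_scaleC)

lemma hat_diff: "x \<in> M \<Longrightarrow> y \<in> M \<Longrightarrow> hat (x - y) = hat x - hat y"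
  using hat_add[of x "(-1) *\<^sub>R y"] hat_scaleR[of y "-1"] M_scaleR[of y "-1"] by simp

lemma hat_zero: "hat 0 = 0" using hat_scaleR[OF M_id, of 0] by simp

lemma inner_hat: "x \<in> M \<Longrightarrow> y \<in> M \<Longrightarrow> inner (hat x) (hat y) = tr (adj y o\<^sub>L x)"
  by (simp add: inner_eq_Re_cinner cinner_hat tr_def)

lemma norm_hat: "x \<in> M \<Longrightarrow> (norm (hat x))\<^sup>2 = tr (adj x o\<^sub>L x)"
  by (simp add: power2_norm_eq_inner inner_hat)

lemma hat_eq_0_iff: "x \<in> M \<Longrightarrow> hat x = 0 \<longleftrightarrow> x = 0"
  using norm_hat[of x] tr_faithful[of x] hat_zero by auto

lemma hat_inj: "x \<in> M \<Longrightarrow> y \<in> M \<Longrightarrow> hat x = hat y \<Longrightarrow> x = y"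
  using hat_eq_0_iff[of "x - y"] hat_diff[of x y] M_diff[of x y] by simp

text \<open>The functional is only assumed nonnegative on squares; the square root of \<open>1 - x\<close> is
  \<open>1 - y\<close> for the fixed point \<open>y\<close> of the contraction \<open>y \<mapsto> (x + y\<^sup>2) / 2\<close> of a small ball.\<close>

lemma square_root:
  assumes x: "x \<in> M" "adj x = x" "norm x < 1"
  shows "\<exists>y\<in>M. adj y = y \<and> (id_blinfun - y) o\<^sub>L (id_blinfun - y) = id_blinfun - x"
proof -
  define q where "q = norm x"
  \<comment> \<open>The radius has to satisfy \<open>q + r^2 \<le> 2 r\<close> for the ball to be
    mapped into itself and \<open>r < 1\<close> for the contraction; the midpoint of
    \<open>q\<close> and 1 does both.\<close>
  define r where "r = (1 + q) / 2"
  have q: "0 \<le> q" "q < 1" using x(3) by (simp_all add: q_def)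
  then have r: "0 \<le> r" "r < 1" by (simp_all add: r_def)
  have qr: "(q + r * r) / 2 \<le> r"
  proof -
    have "(1 + q) * (1 + q) \<le> 2 * 2" using q by (intro mult_mono) auto
    then show ?thesis by (simp add: r_def field_simps)
  qed
  define s where "s = {y\<in>M. adj y = y \<and> norm y \<le> r}"
  define f where "f y = (1/2) *\<^sub>R (x + (y o\<^sub>L y))" for y
  have "closed s"
    unfolding closed_sequential_limits
  proof (intro allI impI, elim conjE)
    fix g l assume g: "\<forall>n. g n \<in> s" "g \<longlonglongrightarrow> l"
    have lim: "(\<lambda>n. g n \<xi>) \<longlonglongrightarrow> l \<xi>" for \<xi> by (intro tendsto_intros g(2))
    have gM: "g n \<in> M" "adj (g n) = g n" "norm (g n) \<le> r" for n using g(1) by (auto simp: s_def)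
    have lM: "l \<in> M" using M_strong_limit[OF gM(1) lim] .
    moreover have "adj l = l" by (rule adj_strong_limit[OF bounded[OF gM(1)] gM(2) lim bounded[OF lM]])
    moreover have "norm l \<le> r"
      by (rule LIMSEQ_le_const2[OF tendsto_norm[OF g(2)]]) (use gM(3) in blast)
    ultimately show "l \<in> s" by (simp add: s_def)
  qed
  then have "complete s" by (simp add: complete_eq_closed)
  moreover have "s \<noteq> {}"
  proof -
    have "0 \<in> s" using r M_zero adj_scaleR[OF bounded_ops_id, of 0] by (simp add: s_def)
    then show ?thesis by blast
  qed
  moreover have "f ` s \<subseteq> s"
  proof
    fix z assume "z \<in> f ` s"
    then obtain y where y: "y \<in> M" "adj y = y" "norm y \<le> r" "z = f y" by (auto simp: s_def)
    have "norm (y o\<^sub>L y) \<le> norm y * norm y" by (rule norm_blinfun_compose)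
    also have "\<dots> \<le> r * r" using y(3) r by (intro mult_mono) auto
    finally have "norm (x + (y o\<^sub>L y)) \<le> q + r * r" using norm_triangle_ineq[of x "y o\<^sub>L y"] by (simp add: q_def)
    then have "norm z \<le> r" using qr by (simp add: y(4) f_def)
    moreover have "z \<in> M" unfolding y(4) f_def by (intro M_intros x y)
    moreover have "adj z = z"
      by (simp add: y(4) f_def adj_scaleR adj_add adj_compose bounded_ops_add bounded_ops_compose bounded x y(1,2))
    ultimately show "z \<in> s" by (simp add: s_def)
  qed
  moreover have "dist (f y) (f z) \<le> r * dist y z" if "y \<in> s" "z \<in> s" for y z
  proof -
    have "f y - f z = (1/2) *\<^sub>R ((y o\<^sub>L (y - z)) + ((y - z) o\<^sub>L z))"
      by (simp add: f_def compose_simps algebra_simps flip: scaleR_diff_right)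
    then have "dist (f y) (f z) \<le> (1/2) * (norm (y o\<^sub>L (y - z)) + norm ((y - z) o\<^sub>L z))"
      using norm_triangle_ineq[of "y o\<^sub>L (y - z)" "(y - z) o\<^sub>L z"] by (simp add: dist_norm)
    also have "\<dots> \<le> (1/2) * (norm y * norm (y - z) + norm (y - z) * norm z)"
      by (intro mult_left_mono add_mono norm_blinfun_compose) auto
    also have "\<dots> \<le> (1/2) * (r * norm (y - z) + norm (y - z) * r)"
      using that r by (intro mult_left_mono add_mono mult_mono) (auto simp: s_def)
    finally show ?thesis by (simp add: dist_norm mult.commute)
  qed
  ultimately have "\<exists>!y\<in>s. f y = y"
    using r Banach_fix[of s r f] by blast
  then obtain y where y: "y \<in> M" "adj y = y" "f y = y" by (auto simp: s_def)
  have "2 *\<^sub>R f y = x + (y o\<^sub>L y)" by (simp add: f_def)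
  then have "2 *\<^sub>R y = x + (y o\<^sub>L y)" by (simp add: y(3))
  then have "(id_blinfun - y) o\<^sub>L (id_blinfun - y) = id_blinfun - x"
    by (simp add: compose_simps algebra_simps scaleR_2)
  then show ?thesis using y by blast
qed

text \<open>With \<open>X = 1 - T / K\<close>, the element \<open>1 - q X\<close> is a square of a
  self-adjoint element for every \<open>q < 1\<close>, as \<open>square_root\<close> needs norm
  strictly below 1. Letting \<open>q\<close> tend to 1 gives the trace of
  \<open>T / K\<close>.\<close>

lemma tr_pos:
  assumes T: "T \<in> M" "pos T"
  shows "0 \<le> tr T"
proof -
  define K where "K = norm T + 1"
  have K: "0 < K" "norm T \<le> K" by (simp_all add: K_def add_nonneg_pos)
  have TB: "T \<in> bounded_ops" "adj T = T" using T by (simp_all add: pos_def)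
  let ?X = "id_blinfun - (1 / K) *\<^sub>R T"
  have XM: "?X \<in> M" by (intro M_intros T)
  have Xa: "adj ?X = ?X"
    by (simp add: adj_diff adj_scaleR adj_id bounded_ops_id bounded_ops_scaleR TB)
  have nX: "norm ?X \<le> 1"
  proof (rule norm_le_of_pos)
    have "1 *\<^sub>R id_blinfun - ?X = (1 / K) *\<^sub>R T" by simp
    moreover have "pos ((1 / K) *\<^sub>R T)"
      using K T by (intro posI) (simp_all add: bounded_ops_scaleR TB adj_scaleR blinfun.scaleR_left pos_inner)
    ultimately show "pos (1 *\<^sub>R id_blinfun - ?X)" by simp
    have "norm T \<le> 2 * K" using K by linarith
    then have "norm T / K \<le> 2" using K(1) by (simp add: divide_le_eq)
    then have "pos (2 *\<^sub>R id_blinfun - (1 / K) *\<^sub>R T)"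
      using K(1) by (intro pos_id_minus) (simp_all add: bounded_ops_scaleR TB adj_scaleR)
    moreover have "1 *\<^sub>R id_blinfun + ?X = 2 *\<^sub>R id_blinfun - (1 / K) *\<^sub>R T" by (simp add: scaleR_2)
    ultimately show "pos (1 *\<^sub>R id_blinfun + ?X)" by (simp only:)
  qed simp
  have ineq: "0 \<le> 1 - q + q * (tr T / K)" if q: "0 \<le> q" "q < 1" for q
  proof -
    have "norm (q *\<^sub>R ?X) \<le> q * 1" using nX q by (simp only: norm_scaleR abs_of_nonneg mult_left_mono)
    then have "norm (q *\<^sub>R ?X) < 1" using q by simp
    moreover have "adj (q *\<^sub>R ?X) = q *\<^sub>R ?X" using adj_scaleR[OF bounded[OF XM]] Xa by simp
    ultimately obtain y where y: "y \<in> M" "adj y = y"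
      "(id_blinfun - y) o\<^sub>L (id_blinfun - y) = id_blinfun - q *\<^sub>R ?X"
      using square_root[of "q *\<^sub>R ?X"] M_scaleR[OF XM] by blast
    have "adj (id_blinfun - y) = id_blinfun - y" by (simp add: adj_diff adj_id bounded_ops_id bounded y)
    then have "0 \<le> tr (id_blinfun - q *\<^sub>R ?X)"
      using tr_square_nonneg[of "id_blinfun - y"] y by (simp add: M_intros)
    also have "tr (id_blinfun - q *\<^sub>R ?X) = 1 - q * (1 - tr T / K)"
      by (simp only: tr_diff tr_scaleR tr_id M_intros T XM) simp
    finally show ?thesis by (simp add: algebra_simps)
  qed
  have "0 \<le> 1 - (1::real) + 1 * (tr T / K)"
  proof (rule LIMSEQ_le_const)
    show "(\<lambda>n. 1 - (1 - 1 / real (Suc n)) + (1 - 1 / real (Suc n)) * (tr T / K)) \<longlonglongrightarrow> 1 - 1 + 1 * (tr T / K)"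
      using LIMSEQ_Suc[OF lim_1_over_n[where 'a = real]] tendsto_diff[OF tendsto_const[of 1] LIMSEQ_Suc[OF lim_1_over_n[where 'a = real]]]
      by (intro tendsto_intros) auto
    show "\<exists>N. \<forall>n\<ge>N. 0 \<le> 1 - (1 - 1 / real (Suc n)) + (1 - 1 / real (Suc n)) * (tr T / K)"
      by (intro exI[of _ 0] allI impI ineq) auto
  qed
  then show ?thesis using K by (simp add: zero_le_divide_iff)
qed

lemma tr_mono: "S \<in> M \<Longrightarrow> T \<in> M \<Longrightarrow> pos (T - S) \<Longrightarrow> tr S \<le> tr T"
  using tr_pos[of "T - S"] by (simp add: M_diff tr_diff)

text \<open>Conjugate the operator inequality \<open>adj x o\<^sub>L x \<le> (norm x)^2\<close> by
  \<open>y\<close> and take traces.\<close>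

lemma norm_hat_compose_left:
  assumes x: "x \<in> M" and y: "y \<in> M"
  shows "norm (hat (x o\<^sub>L y)) \<le> norm x * norm (hat y)"
proof -
  let ?K = "(norm x)\<^sup>2"
  have xx: "adj x o\<^sub>L x \<in> M" by (intro M_intros x)
  have "norm (adj x o\<^sub>L x) \<le> norm (adj x) * norm x" by (rule norm_blinfun_compose)
  also have "\<dots> = ?K" by (simp add: norm_adj bounded x power2_eq_square)
  finally have "pos (?K *\<^sub>R id_blinfun - (adj x o\<^sub>L x))"
    using pos_adj_compose[OF bounded[OF x]] by (intro pos_id_minus bounded xx) (simp_all add: pos_def)
  then have "pos (adj y o\<^sub>L (?K *\<^sub>R id_blinfun - (adj x o\<^sub>L x)) o\<^sub>L y)" by (rule pos_conj[OF _ bounded[OF y]])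
  also have "adj y o\<^sub>L (?K *\<^sub>R id_blinfun - (adj x o\<^sub>L x)) o\<^sub>L y =
      ?K *\<^sub>R (adj y o\<^sub>L y) - (adj (x o\<^sub>L y) o\<^sub>L (x o\<^sub>L y))"
    by (simp add: compose_simps adj_compose bounded x y compose_assoc)
  finally have "tr (adj (x o\<^sub>L y) o\<^sub>L (x o\<^sub>L y)) \<le> tr (?K *\<^sub>R (adj y o\<^sub>L y))"
    by (intro tr_mono M_intros x y)
  then have "(norm (hat (x o\<^sub>L y)))\<^sup>2 \<le> (norm x * norm (hat y))\<^sup>2"
    by (simp add: norm_hat x y M_intros tr_scaleR power_mult_distrib)
  then show ?thesis by (rule power2_le_imp_le) simp
qed

lemma norm_hat_adj: "x \<in> M \<Longrightarrow> norm (hat (adj x)) = norm (hat x)"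
proof -
  assume x: "x \<in> M"
  have "(norm (hat (adj x)))\<^sup>2 = (norm (hat x))\<^sup>2"
    using tr_commute[of x "adj x"] by (simp add: norm_hat x M_intros adj_adj bounded)
  then show ?thesis by (simp add: power2_eq_iff_nonneg)
qed

text \<open>Traciality makes the adjoint isometric for the 2-norm, which exchanges left and right
  multiplication.\<close>

lemma norm_hat_compose_right:
  assumes x: "x \<in> M" and y: "y \<in> M"
  shows "norm (hat (y o\<^sub>L x)) \<le> norm (hat y) * norm x"
proof -
  have "norm (hat (y o\<^sub>L x)) = norm (hat (adj x o\<^sub>L adj y))"
    using norm_hat_adj[of "y o\<^sub>L x"] by (simp add: x y M_intros adj_compose bounded)
  also have "\<dots> \<le> norm (adj x) * norm (hat (adj y))" by (intro norm_hat_compose_left M_intros x y)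
  finally show ?thesis by (simp add: norm_adj norm_hat_adj bounded x y mult.commute)
qed

lemma norm_hat_le: "x \<in> M \<Longrightarrow> norm (hat x) \<le> norm x"
proof -
  assume x: "x \<in> M"
  have "(norm (hat id_blinfun))\<^sup>2 = 1" by (simp add: norm_hat M_id adj_id tr_id)
  then have "norm (hat id_blinfun) = 1" by (simp add: power2_eq_1_iff) (metis norm_ge_zero not_one_le_zero neg_0_le_iff_le)
  then show ?thesis using norm_hat_compose_left[OF x M_id] by simp
qed

lemma pos_compose_le:
  assumes z: "pos z" "norm z \<le> 1"
  shows "pos (z - (z o\<^sub>L z))"
proof (rule posI)
  have zB: "z \<in> bounded_ops" "adj z = z" using z by (simp_all add: pos_def)
  show "z - (z o\<^sub>L z) \<in> bounded_ops" by (intro bounded_ops_diff bounded_ops_compose zB)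
  show "adj (z - (z o\<^sub>L z)) = z - (z o\<^sub>L z)" by (simp add: adj_diff adj_compose bounded_ops_compose zB)
  fix \<xi>
  have "inner (z \<eta>) \<eta> \<le> 1 * (norm \<eta>)\<^sup>2" for \<eta>
    using abs_inner_le_norm[of z \<eta>] mult_right_mono[OF z(2), of "(norm \<eta>)\<^sup>2"] by simp
  then have "(norm (z \<xi>))\<^sup>2 \<le> 1 * inner (z \<xi>) \<xi>" by (intro pos_norm_apply_le z) auto
  then show "0 \<le> inner ((z - (z o\<^sub>L z)) \<xi>) \<xi>"
    using selfadj_inner[OF zB, of "z \<xi>" \<xi>] by (simp add: blinfun.diff_left inner_diff_left power2_norm_eq_inner)
qed

lemma norm_hat_pos_le:
  assumes z: "z \<in> M" "pos z" "norm z \<le> 1"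
  shows "(norm (hat z))\<^sup>2 \<le> tr z"
  using tr_mono[OF _ z(1) pos_compose_le[OF z(2,3)]] z(2) by (simp add: norm_hat z M_intros pos_adj)

text \<open>Normality enters here: the strong limit of an increasing sequence is its least upper
  bound in \<open>M\<close>.\<close>

lemma tr_strong_limit_le:
  fixes g :: "'h op" and G :: "nat \<Rightarrow> 'h op"
  assumes G: "\<And>n. G n \<in> M" "\<And>n. pos (G n)" "\<And>m n. m \<le> n \<Longrightarrow> pos (G n - G m)"
    and lim: "\<And>\<xi>. (\<lambda>n. G n \<xi>) \<longlonglongrightarrow> g \<xi>" and b: "\<And>n. tr (G n) \<le> b"
  shows "tr g \<le> b"
proof -
  have gM: "g \<in> M" by (rule M_strong_limit[OF G(1) lim])
  have ga: "adj g = g" by (rule adj_strong_limit[OF bounded[OF G(1)] pos_adj[OF G(2)] lim bounded[OF gM]])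
  have "pos (g - G m)" for m
  proof (rule posI)
    show "g - G m \<in> bounded_ops" by (intro bounded_ops_diff bounded gM G)
    show "adj (g - G m) = g - G m" using ga pos_adj[OF G(2)] by (simp add: adj_diff bounded gM G)
    fix \<xi>
    have "(\<lambda>n. inner ((G n - G m) \<xi>) \<xi>) \<longlonglongrightarrow> inner ((g - G m) \<xi>) \<xi>"
      unfolding blinfun.diff_left by (intro tendsto_intros lim)
    then show "0 \<le> inner ((g - G m) \<xi>) \<xi>"
      by (rule LIMSEQ_le_const) (use pos_inner[OF G(3)] in blast)
  qed
  then have upper: "\<forall>a\<in>range G. op_le a g" by (auto simp: op_le_def intro: pos_positive_op)
  have dir: "\<forall>a\<in>range G. \<forall>b\<in>range G. \<exists>c\<in>range G. op_le a c \<and> op_le b c"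
  proof (intro ballI)
    fix a b assume "a \<in> range G" "b \<in> range G"
    then obtain m n where "a = G m" "b = G n" by auto
    then show "\<exists>c\<in>range G. op_le a c \<and> op_le b c"
      using pos_positive_op[OF G(3)[of m "max m n"]] pos_positive_op[OF G(3)[of n "max m n"]]
      by (auto simp: op_le_def)
  qed
  have least: "op_le g y" if y: "y \<in> M" "\<forall>a\<in>range G. op_le a y" for y
    unfolding op_le_def positive_op_def
  proof (intro conjI allI)
    show "y - g \<in> bounded_ops" by (intro bounded_ops_diff bounded y gM)
    fix \<xi>
    \<comment> \<open>\<open>positive_op\<close> also demands a real quadratic form, so the
      imaginary part has to be followed through the limit as well.\<close>
    have *: "0 \<le> inner ((y - G n) \<xi>) \<xi>" "inner ((y - G n) \<xi>) (\<i> *\<^sub>C \<xi>) = 0" for n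
      using y(2) by (auto simp: op_le_def positive_op_def cinner_eq_inner complex_nonneg_Reals_iff)
    have lim': "(\<lambda>n. inner ((y - G n) \<xi>) \<eta>) \<longlonglongrightarrow> inner ((y - g) \<xi>) \<eta>" for \<eta>
      unfolding blinfun.diff_left by (intro tendsto_intros lim)
    have "0 \<le> inner ((y - g) \<xi>) \<xi>" by (rule LIMSEQ_le_const[OF lim']) (use *(1) in blast)
    moreover have "inner ((y - g) \<xi>) (\<i> *\<^sub>C \<xi>) = 0"
      using lim'[of "\<i> *\<^sub>C \<xi>"] LIMSEQ_unique[OF tendsto_const] unfolding *(2) by metis
    ultimately show "cinner ((y - g) \<xi>) \<xi> \<in> \<real>\<^sub>\<ge>\<^sub>0"
      by (simp add: cinner_eq_inner complex_nonneg_Reals_iff)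
  qed
  have "range G \<subseteq> {a\<in>M. positive_op a}" using G(1,2) pos_positive_op by blast
  then have "Re (\<tau> g) = (SUP a\<in>range G. Re (\<tau> a))"
    using normal[unfolded normal_on_def, rule_format, of "range G" g] upper dir least gM
    by blast
  also have "\<dots> \<le> b" by (rule cSUP_least) (use b in \<open>auto simp: tr_def\<close>)
  finally show ?thesis by (simp add: tr_def)
qed

end

section \<open>Completeness of the unit ball in the 2-norm\<close>

lemma sum_half_powers_le:
  assumes "N \<le> m" shows "(\<Sum>n\<in>{N..<m}. (1/2::real) ^ Suc n) \<le> (1/2) ^ N"
proof -
  have "(\<Sum>n\<in>{N..<m}. (1/2::real) ^ Suc n) = (1/2) ^ N - (1/2) ^ m"
    using assms by (induction m rule: dec_induct) auto
  then show ?thesis by simp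
qed

context tracial_vn
begin

lemma pos_sum_squares:
  assumes "finite I" "\<And>i. i \<in> I \<Longrightarrow> x i \<in> M" "\<And>i. i \<in> I \<Longrightarrow> adj (x i) = x i" "\<And>i. i \<in> I \<Longrightarrow> 0 \<le> c i"
  shows "pos (\<Sum>i\<in>I. c i *\<^sub>R (x i o\<^sub>L x i)) \<and>
    (\<forall>\<xi>. inner ((\<Sum>i\<in>I. c i *\<^sub>R (x i o\<^sub>L x i)) \<xi>) \<xi> = (\<Sum>i\<in>I. c i * (norm (x i \<xi>))\<^sup>2))"
  using assms
proof (induction I rule: finite_induct)
  case empty
  have "adj 0 = (0 :: 'h op)" using adj_scaleR[OF bounded_ops_id, of 0] by simp
  then show ?case by (simp add: pos_def bounded_ops_zero)
next
  case (insert i I)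
  have x: "x i \<in> bounded_ops" "adj (x i) = x i" using insert.prems bounded by auto
  let ?S = "\<Sum>i\<in>I. c i *\<^sub>R (x i o\<^sub>L x i)"
  have IH: "pos ?S" "inner (?S \<xi>) \<xi> = (\<Sum>i\<in>I. c i * (norm (x i \<xi>))\<^sup>2)" for \<xi>
    using insert by auto
  have sq: "inner (x i (x i \<xi>)) \<xi> = (norm (x i \<xi>))\<^sup>2" for \<xi>
    using selfadj_inner[OF x, of "x i \<xi>" \<xi>] by (simp add: power2_norm_eq_inner)
  have form: "inner ((c i *\<^sub>R (x i o\<^sub>L x i) + ?S) \<xi>) \<xi> = c i * (norm (x i \<xi>))\<^sup>2 + (\<Sum>i\<in>I. c i * (norm (x i \<xi>))\<^sup>2)" for \<xi>
    by (simp add: blinfun.add_left blinfun.scaleR_left inner_add_left IH(2) sq)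
  have S: "?S \<in> bounded_ops" "adj ?S = ?S" using IH(1) by (simp_all add: pos_def)
  have "pos (c i *\<^sub>R (x i o\<^sub>L x i) + ?S)"
  proof (rule posI)
    show "c i *\<^sub>R (x i o\<^sub>L x i) + ?S \<in> bounded_ops"
      by (intro bounded_ops_add bounded_ops_scaleR bounded_ops_compose x S)
    show "adj (c i *\<^sub>R (x i o\<^sub>L x i) + ?S) = c i *\<^sub>R (x i o\<^sub>L x i) + ?S"
      by (simp add: adj_add adj_scaleR adj_compose bounded_ops_scaleR bounded_ops_compose x S)
    show "0 \<le> inner ((c i *\<^sub>R (x i o\<^sub>L x i) + ?S) \<xi>) \<xi>" for \<xi>
      unfolding form using insert.prems by (intro add_nonneg_nonneg sum_nonneg mult_nonneg_nonneg) auto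
  qed
  then show ?case using insert.hyps form by simp
qed

text \<open>The unit ball is complete for the 2-norm: after passing to a fast subsequence with
  increments \<open>d n\<close>, the decreasing limits \<open>h N\<close> of \<open>(1 + (\<Sum>n = N..<m. 4 ^ n * d n\<^sup>2))\<^sup>-\<^sup>1\<close> satisfy
  \<open>norm (d n * h N) \<le> 2 ^ (-n)\<close>, and \<open>tr (1 - h N)\<close> tends to 0 by normality. Hence \<open>h N\<close> increases
  to 1 and the subsequence converges strongly.\<close>

lemma complete_along_fast_sequences:
  assumes y: "\<And>n. y n \<in> M" "\<And>n. adj (y n) = y n" "\<And>n. norm (y n) \<le> 1"
    and fast: "\<And>n. norm (hat (y (Suc n) - y n)) \<le> (1/2) * (1/4) ^ n"
  shows "\<exists>x\<in>M. adj x = x \<and> norm x \<le> 1 \<and> (\<lambda>n. hat (y n)) \<longlonglongrightarrow> hat x"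
proof -
  define d where "d n = y (Suc n) - y n" for n
  have dM: "d n \<in> M" for n unfolding d_def by (intro M_intros y)
  have da: "adj (d n) = d n" for n by (simp add: d_def adj_diff bounded y)
  \<comment> \<open>The weights \<open>4 ^ n\<close> are large enough to make \<open>d n\<close> of
    size \<open>(1/2) ^ n\<close> after composition with \<open>h N\<close>, and small enough for
    the assumed rate to give trace at most \<open>(1/2) ^ N\<close>.\<close>
  define T where "T N m = (\<Sum>n\<in>{N..<m}. (4 ^ n) *\<^sub>R (d n o\<^sub>L d n))" for N m :: nat
  have TM: "T N m \<in> M" for N m unfolding T_def by (intro M_sum M_intros dM)
  have Tpos: "pos (T N m)" and Tform: "inner (T N m \<xi>) \<xi> = (\<Sum>n\<in>{N..<m}. 4 ^ n * (norm (d n \<xi>))\<^sup>2)" for N m \<xi>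
    using pos_sum_squares[of "{N..<m}" d "\<lambda>n. 4 ^ n"] dM da unfolding T_def by auto
  have Tdiff: "pos (T N' m' - T N m)" if "{N..<m} \<subseteq> {N'..<m'}" for N m N' m'
  proof -
    have "T N' m' - T N m = (\<Sum>n\<in>{N'..<m'} - {N..<m}. (4 ^ n) *\<^sub>R (d n o\<^sub>L d n))"
      unfolding T_def using that by (simp add: sum_diff)
    then show ?thesis
      using pos_sum_squares[of "{N'..<m'} - {N..<m}" d "\<lambda>n. 4 ^ n"] dM da by simp
  qed
  have trT: "tr (T N m) \<le> (1/2) ^ N" for N m
  proof (cases "N \<le> m")
    case True
    have "tr (T N m) = (\<Sum>n\<in>{N..<m}. 4 ^ n * (norm (hat (d n)))\<^sup>2)"
      unfolding T_def by (subst tr_sum) (simp_all add: tr_scaleR norm_hat da M_intros dM)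
    also have "\<dots> \<le> (\<Sum>n\<in>{N..<m}. (1/2) ^ Suc n)"
    proof (rule sum_mono)
      fix n
      have "(norm (hat (d n)))\<^sup>2 \<le> ((1/2) * (1/4) ^ n)\<^sup>2" unfolding d_def by (intro power_mono fast) simp
      then have "4 ^ n * (norm (hat (d n)))\<^sup>2 \<le> 4 ^ n * ((1/2) * (1/4) ^ n)\<^sup>2" by simp
      also have "\<dots> = (1/4) * (4 * (1/4) * (1/4 :: real)) ^ n"
        by (simp only: power_mult_distrib power2_eq_square)
      also have "\<dots> \<le> (1/2) * (1/2) ^ n" by (intro mult_mono power_mono) auto
      finally show "4 ^ n * (norm (hat (d n)))\<^sup>2 \<le> (1/2) ^ Suc n" by simp
    qed
    also have "\<dots> \<le> (1/2) ^ N" by (rule sum_half_powers_le[OF True])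
    finally show ?thesis .
  next
    case False
    then show ?thesis by (simp add: T_def tr_zero)
  qed
  have "\<exists>R :: 'h op. R \<in> bounded_ops \<and> (\<forall>\<xi>. R (\<xi> + T N m \<xi>) = \<xi>) \<and> (\<forall>\<xi>. R \<xi> + T N m (R \<xi>) = \<xi>) \<and>
      norm R \<le> 1 \<and> pos R \<and> pos (id_blinfun - R)" for N m
    using pos_inverse[OF Tpos[of N m]] by metis
  then obtain H where H: "\<And>N m. H N m \<in> bounded_ops" "\<And>N m \<xi>. blinfun_apply (H N m) (\<xi> + T N m \<xi>) = \<xi>"
    "\<And>N m \<xi>. blinfun_apply (H N m) \<xi> + T N m (blinfun_apply (H N m) \<xi>) = \<xi>" "\<And>N m. norm (H N m) \<le> 1" "\<And>N m. pos (H N m)"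
    "\<And>N m. pos (id_blinfun - H N m)" by metis
  have HM: "H N m \<in> M" for N m by (rule M_inverse[OF TM H(1) H(2,3)])
  define G where "G N m = id_blinfun - H N m" for N m
  have GM: "G N m \<in> M" for N m unfolding G_def by (intro M_intros HM)
  have Gpos: "pos (G N m)" for N m unfolding G_def by (rule H(6))
  have Gnorm: "norm (G N m) \<le> 1" for N m
    using Gpos H(5)[of N m] by (intro norm_le_1_of_pos) (simp_all add: G_def)
  have Gmono: "pos (G N' m' - G N m)" if "{N..<m} \<subseteq> {N'..<m'}" for N m N' m'
    using pos_inverse_antimono[OF Tpos Tdiff[OF that] H(5) H(3) H(5) H(3)] by (simp add: G_def)
  \<comment> \<open>\<open>G\<close> is \<open>T (1 + T)^-1\<close>, which lies below
    \<open>T\<close>; with \<open>\<xi> = z + T z\<close> the difference of the forms is a sum of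
    nonnegative terms.\<close>
  have trG: "tr (G N m) \<le> (1/2) ^ N" for N m
  proof -
    have "pos (T N m - G N m)"
    proof (rule posI)
      show "T N m - G N m \<in> bounded_ops" by (intro bounded_ops_diff bounded TM GM)
      show "adj (T N m - G N m) = T N m - G N m" using pos_adj[OF Tpos] pos_adj[OF Gpos] by (simp add: adj_diff bounded TM GM)
      fix \<xi>
      let ?z = "H N m \<xi>" and ?T = "T N m"
      have xi: "\<xi> = ?z + ?T ?z" using H(3)[of N m \<xi>] by simp
      have "inner (?T \<xi> - (\<xi> - ?z)) \<xi> = inner (?T (?T ?z)) (?z + ?T ?z)"
        using xi blinfun.add_right[of ?T ?z "?T ?z"] by (metis add_diff_cancel_left')
      also have "\<dots> = inner (?T ?z) (?T ?z) + inner (?T (?T ?z)) (?T ?z)"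
        using selfadj_inner[OF bounded[OF TM] pos_adj[OF Tpos], of N m "?T ?z" ?z] by (simp add: inner_add_right)
      also have "\<dots> \<ge> 0" using pos_inner[OF Tpos] by simp
      finally show "0 \<le> inner ((T N m - G N m) \<xi>) \<xi>" by (simp add: G_def blinfun.diff_left)
    qed
    then show ?thesis using tr_mono[OF GM TM] trT order_trans by blast
  qed
  have "\<exists>S. (\<forall>\<xi>. (\<lambda>m. G N m \<xi>) \<longlonglongrightarrow> blinfun_apply S \<xi>) \<and> norm S \<le> 1" for N
    using monotone_strong_limit[of "G N", OF Gpos Gnorm Gmono] by (metis ivl_subset order_refl le_refl)
  then obtain g where g: "\<And>N \<xi>. (\<lambda>m. G N m \<xi>) \<longlonglongrightarrow> blinfun_apply (g N) \<xi>" "\<And>N. norm (g N) \<le> 1" by metis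
  have gM: "g N \<in> M" for N by (rule M_strong_limit[OF GM g(1)])
  have ga: "adj (g N) = g N" for N
    by (rule adj_strong_limit[OF bounded[OF GM] pos_adj[OF Gpos] g(1) bounded[OF gM]])
  have gpos: "pos (g N)" for N
  proof (rule posI[OF bounded[OF gM] ga])
    show "0 \<le> inner (g N \<xi>) \<xi>" for \<xi>
      by (rule LIMSEQ_le_const[OF tendsto_inner[OF g(1) tendsto_const]]) (use pos_inner[OF Gpos] in blast)
  qed
  have trg: "tr (g N) \<le> (1/2) ^ N" for N
    by (rule tr_strong_limit_le[of "G N", OF GM Gpos Gmono g(1) trG]) auto
  define h where "h N = id_blinfun - g N" for N
  have hM: "h N \<in> M" for N unfolding h_def by (intro M_intros gM)
  have Hlim: "(\<lambda>m. H N m \<xi>) \<longlonglongrightarrow> h N \<xi>" for N \<xi>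
    using tendsto_diff[OF tendsto_const g(1), of \<xi> N \<xi>] by (simp add: G_def h_def blinfun.diff_left)
  have ha: "adj (h N) = h N" for N by (simp add: h_def adj_diff bounded_ops_id bounded gM adj_id ga)
  have hpos: "pos (h N)" for N
  proof (rule posI[OF bounded[OF hM] ha])
    show "0 \<le> inner (h N \<xi>) \<xi>" for \<xi>
      by (rule LIMSEQ_le_const[OF tendsto_inner[OF Hlim tendsto_const]]) (use pos_inner[OF H(5)] in blast)
  qed
  have hnorm: "norm (h N) \<le> 1" for N
    by (rule norm_blinfun_bound, simp, rule LIMSEQ_le_const2[OF tendsto_norm[OF Hlim]])
      (metis H(4) norm_blinfun mult_right_mono norm_ge_zero order_trans)
  have hmono: "pos (h N' - h N)" if "N \<le> N'" for N N'
  proof (rule posI)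
    show "h N' - h N \<in> bounded_ops" by (intro bounded_ops_diff bounded hM)
    show "adj (h N' - h N) = h N' - h N" by (simp add: adj_diff bounded hM ha)
    fix \<xi>
    have "(\<lambda>m. inner (H N' m \<xi> - H N m \<xi>) \<xi>) \<longlonglongrightarrow> inner (h N' \<xi> - h N \<xi>) \<xi>"
      by (intro tendsto_intros Hlim)
    moreover have "0 \<le> inner (H N' m \<xi> - H N m \<xi>) \<xi>" for m
      using pos_inner[OF Gmono[of N' m N m], of \<xi>] that by (simp add: G_def blinfun.diff_left)
    ultimately show "0 \<le> inner ((h N' - h N) \<xi>) \<xi>"
      unfolding blinfun.diff_left by (intro LIMSEQ_le_const) auto
  qed
  obtain k where k: "\<And>\<xi>. (\<lambda>N. h N \<xi>) \<longlonglongrightarrow> blinfun_apply k \<xi>" "norm k \<le> 1"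
    using monotone_strong_limit[of h, OF hpos hnorm hmono] by blast
  have kM: "k \<in> M" by (rule M_strong_limit[OF hM k(1)])
  have ka: "adj k = k" by (rule adj_strong_limit[OF bounded[OF hM] ha k(1) bounded[OF kM]])
  have kh: "pos (g N - (id_blinfun - k))" for N
  proof (rule posI)
    show "g N - (id_blinfun - k) \<in> bounded_ops" by (intro bounded M_intros gM kM)
    show "adj (g N - (id_blinfun - k)) = g N - (id_blinfun - k)"
      by (simp add: adj_diff bounded_ops_diff bounded_ops_id bounded gM kM adj_id ga ka)
    fix \<xi>
    have "(\<lambda>N'. inner (h N' \<xi> - h N \<xi>) \<xi>) \<longlonglongrightarrow> inner (k \<xi> - h N \<xi>) \<xi>" by (intro tendsto_intros k)
    moreover have "0 \<le> inner (h N' \<xi> - h N \<xi>) \<xi>" if "N \<le> N'" for N'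
      using pos_inner[OF hmono[OF that], of \<xi>] by (simp add: blinfun.diff_left)
    ultimately have "0 \<le> inner (k \<xi> - h N \<xi>) \<xi>" by (intro LIMSEQ_le_const) auto
    then show "0 \<le> inner ((g N - (id_blinfun - k)) \<xi>) \<xi>"
      by (simp add: h_def blinfun.diff_left blinfun.add_left algebra_simps)
  qed
  have kB: "inner (k \<xi>) \<xi> \<le> inner \<xi> \<xi>" "0 \<le> inner (k \<xi>) \<xi>" for \<xi>
  proof -
    show "inner (k \<xi>) \<xi> \<le> inner \<xi> \<xi>"
      using abs_inner_le_norm[of k \<xi>] mult_right_mono[OF k(2), of "(norm \<xi>)\<^sup>2"] by (simp add: power2_norm_eq_inner)
    show "0 \<le> inner (k \<xi>) \<xi>"
      by (rule LIMSEQ_le_const[OF tendsto_inner[OF k(1) tendsto_const]]) (use pos_inner[OF hpos] in blast)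
  qed
  \<comment> \<open>The defect of the limit \<open>k\<close> lies below every \<open>g N\<close>, so
    its trace is at most every \<open>(1/2) ^ N\<close>; faithfulness then gives
    \<open>k = 1\<close>.\<close>
  let ?z = "id_blinfun - k"
  have zM: "?z \<in> M" by (intro M_intros kM)
  have za: "adj ?z = ?z" by (simp add: adj_diff bounded_ops_id bounded kM adj_id ka)
  have zpos: "pos ?z"
    by (rule posI[OF bounded[OF zM] za]) (simp add: blinfun.diff_left inner_diff_left kB)
  have "pos k" by (simp add: pos_def bounded kM ka kB)
  then have znorm: "norm ?z \<le> 1" using zpos by (intro norm_le_1_of_pos) auto
  have "tr ?z \<le> (1/2) ^ N" for N using tr_mono[OF zM gM kh] trg order_trans by blast
  moreover have "(\<lambda>N. (1/2::real) ^ N) \<longlonglongrightarrow> 0" by (rule LIMSEQ_realpow_zero) auto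
  ultimately have "tr ?z \<le> 0" by (intro LIMSEQ_le_const) auto
  then have "(norm (hat ?z))\<^sup>2 = 0"
    using norm_hat_pos_le[OF zM zpos znorm] zero_le_power2[of "norm (hat ?z)"] by linarith
  then have "hat ?z = 0" by simp
  then have "?z = 0" using hat_eq_0_iff[OF zM] by blast
  then have hid: "(\<lambda>N. h N \<xi>) \<longlonglongrightarrow> \<xi>" for \<xi> using k(1)[of \<xi>] by simp
  \<comment> \<open>For \<open>\<zeta> = (1 + T)^-1 \<xi>\<close>, the form of \<open>T\<close> at
    \<open>\<zeta>\<close> is at most \<open>inner \<xi> \<zeta>\<close>, and it contains the
    summand \<open>4 ^ n * (norm (d n \<zeta>))^2\<close>.\<close>
  have dh: "norm (d n (h N \<xi>)) \<le> (1/2) ^ n * norm \<xi>" if "N \<le> n" for n N \<xi>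
  proof (rule LIMSEQ_le_const2)
    show "(\<lambda>m. norm (d n (H N m \<xi>))) \<longlonglongrightarrow> norm (d n (h N \<xi>))" by (intro tendsto_intros Hlim)
    have "norm (d n (H N m \<xi>)) \<le> (1/2) ^ n * norm \<xi>" if m: "m \<ge> Suc n" for m
    proof -
      let ?\<zeta> = "H N m \<xi>"
      have "4 ^ n * (norm (d n ?\<zeta>))\<^sup>2 \<le> (\<Sum>n\<in>{N..<m}. 4 ^ n * (norm (d n ?\<zeta>))\<^sup>2)"
        using \<open>N \<le> n\<close> m by (intro member_le_sum) auto
      also have "\<dots> = inner (T N m ?\<zeta>) ?\<zeta>" by (simp add: Tform)
      also have "\<dots> \<le> inner \<xi> ?\<zeta>"
        using H(3)[of N m \<xi>] by (metis inner_add_left inner_ge_zero le_add_same_cancel2)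
      also have "\<dots> \<le> norm \<xi> * norm ?\<zeta>" by (rule norm_cauchy_schwarz)
      also have "\<dots> \<le> norm \<xi> * (1 * norm \<xi>)"
        using norm_blinfun[of "H N m" \<xi>] mult_right_mono[OF H(4)[of N m], of "norm \<xi>"]
        by (intro mult_left_mono) auto
      finally have "4 ^ n * (norm (d n ?\<zeta>))\<^sup>2 \<le> (norm \<xi>)\<^sup>2"
        by (simp only: power2_eq_square mult_1_left)
      moreover have "((2::real) ^ n)\<^sup>2 = 4 ^ n"
        by (simp add: power2_eq_square flip: power_mult_distrib)
      ultimately have "(2 ^ n * norm (d n ?\<zeta>))\<^sup>2 \<le> (norm \<xi>)\<^sup>2"
        by (simp only: power_mult_distrib)
      then have "2 ^ n * norm (d n ?\<zeta>) \<le> norm \<xi>" by (rule power2_le_imp_le) simp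
      then show ?thesis by (simp add: power_one_over field_simps)
    qed
    then show "\<exists>M. \<forall>m\<ge>M. norm (d n (H N m \<xi>)) \<le> (1/2) ^ n * norm \<xi>" by blast
  qed
  have yh: "norm (y (n + j) (h N \<xi>) - y n (h N \<xi>)) \<le> 2 * (1/2) ^ n * norm \<xi>" if "N \<le> n" for n j N \<xi>
  proof -
    have "norm (y (n + j) (h N \<xi>) - y n (h N \<xi>)) \<le> (2 * (1/2) ^ n - 2 * (1/2) ^ (n + j)) * norm \<xi>"
    proof (induction j)
      case (Suc j)
      have eq: "y (n + Suc j) (h N \<xi>) - y n (h N \<xi>) = d (n + j) (h N \<xi>) + (y (n + j) (h N \<xi>) - y n (h N \<xi>))"
        by (simp add: d_def blinfun.diff_left)
      have "norm (y (n + Suc j) (h N \<xi>) - y n (h N \<xi>)) \<le>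
          (1/2) ^ (n + j) * norm \<xi> + (2 * (1/2) ^ n - 2 * (1/2) ^ (n + j)) * norm \<xi>"
        unfolding eq using that by (intro norm_triangle_le add_mono dh Suc) simp
      then show ?case by (simp add: algebra_simps)
    qed simp
    also have "\<dots> \<le> (2 * (1/2) ^ n) * norm \<xi>" by (intro mult_right_mono) auto
    finally show ?thesis by simp
  qed
  have ynorm: "norm (y n \<xi>) \<le> norm \<xi>" for n \<xi>
    using norm_blinfun[of "y n" \<xi>] mult_right_mono[OF y(3)[of n], of "norm \<xi>"] by simp
  \<comment> \<open>The sequence is Cauchy on vectors \<open>h N \<xi>\<close> by telescoping. These
    approximate \<open>\<xi>\<close>, and the uniform bound on the norms of \<open>y n\<close>
    covers the error.\<close>
  have conv: "convergent (\<lambda>n. y n \<xi>)" for \<xi>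
  proof -
    have "Cauchy (\<lambda>n. y n \<xi>)"
    proof (rule metric_CauchyI)
      fix e :: real assume e: "0 < e"
      then obtain N where N: "norm (h N \<xi> - \<xi>) < e / 8"
        using LIMSEQ_D[OF hid, of "e / 8" \<xi>] by auto
      have "(\<lambda>n. 2 * (1/2::real) ^ n * norm \<xi>) \<longlonglongrightarrow> 2 * 0 * norm \<xi>"
        by (intro tendsto_intros LIMSEQ_realpow_zero) auto
      then have "eventually (\<lambda>n. 2 * (1/2::real) ^ n * norm \<xi> < e / 8) sequentially"
        using e by (intro order_tendstoD(2)[of _ 0]) auto
      then obtain L where L: "\<And>n. n \<ge> L \<Longrightarrow> 2 * (1/2::real) ^ n * norm \<xi> < e / 8"
        unfolding eventually_sequentially by blast
      let ?L = "max L N"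
      have near: "norm (y n \<xi> - y ?L \<xi>) < e / 2" if n: "n \<ge> ?L" for n
      proof -
        have 1: "norm (y n (h N \<xi>) - y ?L (h N \<xi>)) < e / 8"
          using yh[of N ?L "n - ?L" \<xi>] L[of ?L] n by simp
        have 2: "norm (y j (\<xi> - h N \<xi>)) < e / 8" for j
          using ynorm[of j "\<xi> - h N \<xi>"] N by (simp add: norm_minus_commute)
        have eq: "y n \<xi> - y ?L \<xi> = (y n (h N \<xi>) - y ?L (h N \<xi>)) + (y n (\<xi> - h N \<xi>) - y ?L (\<xi> - h N \<xi>))"
          by (simp add: blinfun.diff_right)
        have "norm (y n \<xi> - y ?L \<xi>) \<le> norm (y n (h N \<xi>) - y ?L (h N \<xi>)) +
            (norm (y n (\<xi> - h N \<xi>)) + norm (y ?L (\<xi> - h N \<xi>)))"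
          unfolding eq by (intro norm_triangle_le add_left_mono norm_triangle_ineq4)
        then show ?thesis using 1 2[of n] 2[of ?L] e by linarith
      qed
      show "\<exists>M. \<forall>m\<ge>M. \<forall>n\<ge>M. dist (y m \<xi>) (y n \<xi>) < e"
      proof (intro exI allI impI)
        fix m n assume "m \<ge> ?L" "n \<ge> ?L"
        then show "dist (y m \<xi>) (y n \<xi>) < e"
          using near[of m] near[of n] dist_triangle_half_l[of "y m \<xi>" "y ?L \<xi>" e "y n \<xi>"]
          by (simp add: dist_norm)
      qed
    qed
    then show ?thesis using Cauchy_convergent_iff by blast
  qed
  obtain x where x: "\<And>\<xi>. (\<lambda>n. y n \<xi>) \<longlonglongrightarrow> blinfun_apply x \<xi>" "norm x \<le> 1"
    using blinfun_strong_limit[of y, OF y(3) conv] by blast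
  have xM: "x \<in> M" by (rule M_strong_limit[OF y(1) x(1)])
  have xa: "adj x = x" by (rule adj_strong_limit[OF bounded[OF y(1)] y(2) x(1) bounded[OF xM]])
  have xyM: "x - y n \<in> M" for n by (intro M_intros xM y)
  have xh: "norm ((x - y n) o\<^sub>L h n) \<le> 2 * (1/2) ^ n" for n
  proof (rule norm_blinfun_bound)
    fix \<xi>
    have "(\<lambda>j. norm (y (n + j) (h n \<xi>) - y n (h n \<xi>))) \<longlonglongrightarrow> norm (x (h n \<xi>) - y n (h n \<xi>))"
      using LIMSEQ_ignore_initial_segment[OF x(1)[of "h n \<xi>"], of n] tendsto_const
      by (intro tendsto_norm tendsto_diff) (simp add: add.commute)
    then have "norm (x (h n \<xi>) - y n (h n \<xi>)) \<le> 2 * (1/2) ^ n * norm \<xi>"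
      by (rule LIMSEQ_le_const2) (use yh in blast)
    then show "norm (((x - y n) o\<^sub>L h n) \<xi>) \<le> 2 * (1/2) ^ n * norm \<xi>" by (simp add: blinfun.diff_left)
  qed simp
  \<comment> \<open>Split along \<open>1 = h n + g n\<close>: the first part is small in operator
    norm, the second in 2-norm because \<open>g n\<close> has small trace.\<close>
  have bound: "norm (hat x - hat (y n)) \<le> 2 * (1/2) ^ n + 2 * sqrt ((1/2) ^ n)" for n
  proof -
    have "x - y n = ((x - y n) o\<^sub>L h n) + ((x - y n) o\<^sub>L g n)"
      by (simp add: h_def compose_simps)
    then have "hat (x - y n) = hat ((x - y n) o\<^sub>L h n) + hat ((x - y n) o\<^sub>L g n)"
      using hat_add[OF M_compose[OF xyM hM] M_compose[OF xyM gM]] by metis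
    then have "norm (hat x - hat (y n)) \<le> norm (hat ((x - y n) o\<^sub>L h n)) + norm (hat ((x - y n) o\<^sub>L g n))"
      using norm_triangle_ineq hat_diff[OF xM y(1)] by metis
    moreover have "norm (hat ((x - y n) o\<^sub>L h n)) \<le> 2 * (1/2) ^ n"
      using norm_hat_le[OF M_compose[OF xyM hM]] xh order_trans by blast
    moreover have "norm (hat ((x - y n) o\<^sub>L g n)) \<le> 2 * sqrt ((1/2) ^ n)"
    proof -
      have "norm (hat ((x - y n) o\<^sub>L g n)) \<le> norm (x - y n) * norm (hat (g n))"
        by (rule norm_hat_compose_left[OF xyM gM])
      also have "\<dots> \<le> 2 * sqrt ((1/2) ^ n)"
      proof (rule mult_mono)
        show "norm (x - y n) \<le> 2" using norm_triangle_ineq4[of x "y n"] x(2) y(3)[of n] by linarith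
        have "(norm (hat (g n)))\<^sup>2 \<le> (1/2) ^ n" using norm_hat_pos_le[OF gM gpos g(2)] trg order_trans by blast
        then show "norm (hat (g n)) \<le> sqrt ((1/2) ^ n)" by (rule real_le_rsqrt)
      qed auto
      finally show ?thesis .
    qed
    ultimately show ?thesis by linarith
  qed
  have "(\<lambda>n. 2 * (1/2::real) ^ n + 2 * sqrt ((1/2) ^ n)) \<longlonglongrightarrow> 2 * 0 + 2 * sqrt 0"
    by (intro tendsto_intros LIMSEQ_realpow_zero) auto
  then have lim0: "(\<lambda>n. 2 * (1/2::real) ^ n + 2 * sqrt ((1/2) ^ n)) \<longlonglongrightarrow> 0" by simp
  have "(\<lambda>n. hat (y n)) \<longlonglongrightarrow> hat x"
    by (rule LIM_zero_cancel, rule tendsto_norm_zero_cancel, rule tendsto_sandwich[OF _ _ tendsto_const lim0])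
      (use bound in \<open>auto simp: norm_minus_commute\<close>)
  then show ?thesis using xM xa x(2) by blast
qed

definition sa_ball :: "'k set" where
  "sa_ball = hat ` {x\<in>M. adj x = x \<and> norm x \<le> 1}"

lemma closed_sa_ball: "closed sa_ball"
  unfolding closed_sequential_limits
proof (intro allI impI, elim conjE)
  fix f v assume f: "\<forall>n. f n \<in> sa_ball" and lim: "f \<longlonglongrightarrow> v"
  \<comment> \<open>The rate \<open>(1/4) ^ Suc n\<close> makes consecutive approximants differ by
    at most \<open>5/16 * (1/4) ^ n\<close>, within what
    \<open>complete_along_fast_sequences\<close> allows.\<close>
  have "\<exists>x. x \<in> M \<and> adj x = x \<and> norm x \<le> 1 \<and> norm (hat x - v) \<le> (1/4) ^ Suc n" for n
  proof -
    have "\<exists>k. norm (f k - v) < (1/4) ^ Suc n" using LIMSEQ_D[OF lim, of "(1/4) ^ Suc n"] by auto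
    then obtain k where k: "norm (f k - v) < (1/4) ^ Suc n" by blast
    obtain x where "x \<in> M" "adj x = x" "norm x \<le> 1" "f k = hat x" using f by (auto simp: sa_ball_def)
    then show ?thesis using k by (intro exI[of _ x]) auto
  qed
  then obtain y where y: "\<And>n. y n \<in> M" "\<And>n. adj (y n) = y n" "\<And>n. norm (y n) \<le> 1"
    "\<And>n. norm (hat (y n) - v) \<le> (1/4) ^ Suc n" by metis
  have "norm (hat (y (Suc n) - y n)) \<le> (1/2) * (1/4) ^ n" for n
  proof -
    have "hat (y (Suc n) - y n) = (hat (y (Suc n)) - v) - (hat (y n) - v)" by (simp add: hat_diff y)
    then have "norm (hat (y (Suc n) - y n)) \<le> norm (hat (y (Suc n)) - v) + norm (hat (y n) - v)"
      using norm_triangle_ineq4 by metis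
    also have "\<dots> \<le> (1/4) ^ Suc (Suc n) + (1/4) ^ Suc n" by (intro add_mono y)
    also have "\<dots> \<le> (1/2) * (1/4) ^ n" by simp
    finally show ?thesis .
  qed
  then obtain x where x: "x \<in> M" "adj x = x" "norm x \<le> 1" "(\<lambda>n. hat (y n)) \<longlonglongrightarrow> hat x"
    using complete_along_fast_sequences[of y, OF y(1-3)] by blast
  have lim4: "(\<lambda>n. (1/4::real) ^ Suc n) \<longlonglongrightarrow> 0" by (intro LIMSEQ_Suc LIMSEQ_realpow_zero) auto
  have "(\<lambda>n. hat (y n)) \<longlonglongrightarrow> v"
    by (rule LIM_zero_cancel, rule tendsto_norm_zero_cancel, rule tendsto_sandwich[OF _ _ tendsto_const lim4])
      (use y(4) in auto)
  then have "v = hat x" using x(4) LIMSEQ_unique by blast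
  then show "v \<in> sa_ball" using x by (auto simp: sa_ball_def)
qed

section \<open>Unitaries and averaging\<close>

text \<open>The operator type carries only real scalars, so multiplication by \<open>\<i>\<close> is
  expressed as composition with this operator.\<close>

definition J :: "'h op" where "J = scalar_op \<i>"

lemma J_apply [simp]: "J \<xi> = \<i> *\<^sub>C \<xi>" by (simp add: J_def)

lemma J_M: "J \<in> M" by (simp add: J_def M_scalar)

lemma adj_J: "adj J = - J"
proof -
  have "scalar_op (- \<i>) = - (scalar_op \<i> :: 'h op)"
    by (rule blinfun_eqI) (simp add: blinfun.minus_left complex_vector.scale_minus_left)
  then show ?thesis by (simp add: J_def adj_scalar_op)
qed

lemma J_J: "J o\<^sub>L (J o\<^sub>L x) = - x"
  by (rule blinfun_eqI) (simp add: blinfun.minus_left scaleC_scaleC complex_vector.scale_minus_left)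

lemma J_commute: "x \<in> M \<Longrightarrow> x o\<^sub>L J = J o\<^sub>L x"
  by (rule blinfun_eqI) (simp add: bounded_ops_D[OF bounded])

lemma J_left_commute: "x \<in> M \<Longrightarrow> x o\<^sub>L (J o\<^sub>L y) = J o\<^sub>L (x o\<^sub>L y)"
  by (rule blinfun_eqI) (simp add: bounded_ops_D[OF bounded])

lemma hat_J: "x \<in> M \<Longrightarrow> hat (J o\<^sub>L x) = \<i> *\<^sub>C hat x"
  unfolding J_def by (rule hat_scalar)

lemma tau_J: "x \<in> M \<Longrightarrow> \<tau> (J o\<^sub>L x) = \<i> * \<tau> x"
  unfolding J_def by (rule tau_scalar)

lemma uminus_compose: "(- x) o\<^sub>L y = - (x o\<^sub>L y)" "x o\<^sub>L (- y) = - (x o\<^sub>L y)"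
  for x y :: "'h op"
  by (rule blinfun_eqI, simp add: blinfun.minus_left blinfun.minus_right)+

lemma adj_J_diff:
  assumes x: "x \<in> M" shows "adj (J o\<^sub>L (x - adj x)) = J o\<^sub>L (x - adj x)"
proof -
  have d: "x - adj x \<in> M" by (intro M_intros x)
  have "adj (J o\<^sub>L (x - adj x)) = (adj x - x) o\<^sub>L (- J)"
    by (simp add: adj_compose bounded J_M d adj_J adj_diff M_adj x adj_adj)
  also have "\<dots> = (x - adj x) o\<^sub>L J" by (simp add: uminus_compose compose_simps)
  finally show ?thesis by (simp add: J_commute[OF d])
qed

lemma adj_add_self: "x \<in> M \<Longrightarrow> adj (x + adj x) = x + adj x"
  by (simp add: adj_add bounded M_adj adj_adj add.commute)

lemma selfadjoint_decomposition:
  assumes x: "x \<in> M"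
  obtains x1 x2 where "x1 \<in> M" "adj x1 = x1" "x2 \<in> M" "adj x2 = x2" "x = x1 + (J o\<^sub>L x2)"
proof
  let ?x1 = "(1/2) *\<^sub>R (x + adj x)" and ?x2 = "(-1/2) *\<^sub>R (J o\<^sub>L (x - adj x))"
  have M: "x + adj x \<in> M" "J o\<^sub>L (x - adj x) \<in> M" by (intro M_intros x J_M)+
  show "?x1 \<in> M" "?x2 \<in> M" by (intro M_intros x J_M)+
  show "adj ?x1 = ?x1" "adj ?x2 = ?x2"
    by (simp_all only: adj_scaleR[OF bounded[OF M(1)]] adj_scaleR[OF bounded[OF M(2)]]
        adj_add_self[OF x] adj_J_diff[OF x])
  have "J o\<^sub>L ?x2 = (1/2) *\<^sub>R (x - adj x)"
    by (simp only: compose_simps J_J) (simp add: scaleR_diff_right)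
  then show "x = ?x1 + (J o\<^sub>L ?x2)"
    by (simp add: algebra_simps flip: scaleR_add_left)
qed

lemma tau_adj: "x \<in> M \<Longrightarrow> \<tau> (adj x) = cnj (\<tau> x)"
  using cinner_hat[OF M_id, of x] cinner_hat[OF _ M_id, of x] cinner_commute[of "hat id_blinfun" "hat x"]
  by (simp add: adj_id)

text \<open>Each self-adjoint \<open>x\<close> can be recovered from a unitary of \<open>M\<close>:
  commuting with that unitary and its adjoint means commuting with \<open>R\<close> and
  \<open>x R\<close>, and \<open>R\<close> is invertible.\<close>

lemma commute_with_unitaries:
  assumes z: "z \<in> M"
    and comm: "\<And>w. w \<in> M \<Longrightarrow> adj w o\<^sub>L w = id_blinfun \<Longrightarrow> w o\<^sub>L adj w = id_blinfun \<Longrightarrow> z o\<^sub>L w = w o\<^sub>L z"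
    and x: "x \<in> M"
  shows "z o\<^sub>L x = x o\<^sub>L z"
proof -
  text \<open>The Cayley transform \<open>1 - 2 R + 2 \<i> x R\<close> with \<open>R = (1 + x\<^sup>2)\<^sup>-\<^sup>1\<close> is unitary.\<close>
  have sa: "z o\<^sub>L x = x o\<^sub>L z" if x: "x \<in> M" "adj x = x" for x
  proof -
    have "pos (x o\<^sub>L x)" using pos_adj_compose[OF bounded[OF x(1)]] x(2) by simp
    then obtain R where R: "R \<in> bounded_ops" "\<And>\<xi>. R (\<xi> + (x o\<^sub>L x) \<xi>) = \<xi>" "\<And>\<xi>. R \<xi> + (x o\<^sub>L x) (R \<xi>) = \<xi>"
      "pos R" using pos_inverse by metis
    have RM: "R \<in> M" by (rule M_inverse[OF M_compose[OF x(1) x(1)] R(1-3)])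
    have Ra: "adj R = R" using R(4) by (simp add: pos_def)
    have Rx: "R o\<^sub>L x = x o\<^sub>L R"
    proof (rule blinfun_eqI)
      fix \<xi>
      have "x \<xi> = x (R \<xi>) + (x o\<^sub>L x) (x (R \<xi>))"
        using R(3)[of \<xi>] blinfun.add_right[of x "R \<xi>" "(x o\<^sub>L x) (R \<xi>)"] by simp
      then have "R (x \<xi>) = x (R \<xi>)" using R(2) by metis
      then show "(R o\<^sub>L x) \<xi> = (x o\<^sub>L R) \<xi>" by simp
    qed
    have inv: "x o\<^sub>L (x o\<^sub>L R) = id_blinfun - R"
    proof (rule blinfun_eqI)
      show "(x o\<^sub>L (x o\<^sub>L R)) \<xi> = (id_blinfun - R) \<xi>" for \<xi>
        using R(3)[of \<xi>] by (simp add: blinfun.diff_left eq_diff_eq add.commute)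
    qed
    \<comment> \<open>\<open>a\<close> and \<open>b\<close> are the real and imaginary parts of the
      unitary; \<open>b^2 = 4 (R - R^2)\<close> because \<open>x^2 R = 1 - R\<close>, whence
      \<open>a^2 + b^2 = 1\<close>.\<close>
    define a where "a = id_blinfun - 2 *\<^sub>R R"
    define b where "b = 2 *\<^sub>R (x o\<^sub>L R)"
    have aM: "a \<in> M" and bM: "b \<in> M" unfolding a_def b_def by (intro M_intros x RM)+
    have aa: "adj a = a" by (simp add: a_def adj_diff adj_scaleR bounded_ops_id bounded_ops_scaleR R(1) adj_id Ra)
    have bb: "adj b = b"
      by (simp add: b_def adj_scaleR adj_compose bounded_ops_compose bounded x RM Ra Rx)
    have ab: "a o\<^sub>L b = b o\<^sub>L a"
    proof -
      have "R o\<^sub>L (x o\<^sub>L R) = (x o\<^sub>L R) o\<^sub>L R" by (simp add: Rx flip: compose_assoc)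
      then show ?thesis by (simp add: a_def b_def compose_simps scaleR_diff_right)
    qed
    have "(x o\<^sub>L R) o\<^sub>L (x o\<^sub>L R) = R - (R o\<^sub>L R)"
    proof -
      have "(x o\<^sub>L R) o\<^sub>L (x o\<^sub>L R) = x o\<^sub>L ((R o\<^sub>L x) o\<^sub>L R)" by (simp only: compose_assoc)
      also have "\<dots> = (x o\<^sub>L (x o\<^sub>L R)) o\<^sub>L R" by (simp only: Rx compose_assoc)
      finally show ?thesis by (simp add: inv compose_simps)
    qed
    then have b2: "b o\<^sub>L b = 4 *\<^sub>R R - 4 *\<^sub>R (R o\<^sub>L R)"
      by (simp add: b_def compose_simps scaleR_diff_right)
    have "2 *\<^sub>R R + 2 *\<^sub>R R = 4 *\<^sub>R R" by (simp flip: scaleR_add_left)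
    then have "a o\<^sub>L a = id_blinfun - 4 *\<^sub>R R + 4 *\<^sub>R (R o\<^sub>L R)"
      by (simp add: a_def compose_simps scaleR_diff_right algebra_simps)
    then have sq: "(a o\<^sub>L a) + (b o\<^sub>L b) = id_blinfun" using b2 by simp
    have JM: "J o\<^sub>L b \<in> M" by (intro M_intros J_M bM)
    have aJ: "adj (J o\<^sub>L b) = - (J o\<^sub>L b)"
      by (simp add: adj_compose bounded J_M bM adj_J bb uminus_compose J_commute)
    have JbJb: "(J o\<^sub>L b) o\<^sub>L (J o\<^sub>L b) = - (b o\<^sub>L b)"
      by (simp add: compose_assoc J_left_commute[OF bM] J_J)
    have aJb: "a o\<^sub>L (J o\<^sub>L b) = (J o\<^sub>L b) o\<^sub>L a"
      by (simp add: compose_assoc J_left_commute[OF aM] ab)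
    define w where "w = a + (J o\<^sub>L b)"
    have wM: "w \<in> M" unfolding w_def by (intro M_intros aM JM)
    have wa: "adj w = a - (J o\<^sub>L b)"
      by (simp add: w_def adj_add bounded aM JM aa aJ)
    have u: "adj w o\<^sub>L w = id_blinfun" "w o\<^sub>L adj w = id_blinfun"
      unfolding wa unfolding w_def by (simp_all add: compose_simps JbJb aJb sq)
    have c1: "z o\<^sub>L w = w o\<^sub>L z" by (rule comm[OF wM u])
    have c2: "z o\<^sub>L adj w = adj w o\<^sub>L z"
      by (rule comm[OF M_adj[OF wM]]) (simp_all add: adj_adj bounded wM u)
    have za: "z o\<^sub>L a = a o\<^sub>L z"
    proof -
      have "w + adj w = 2 *\<^sub>R a" unfolding wa by (simp add: w_def scaleR_2)
      then have "z o\<^sub>L (2 *\<^sub>R a) = (2 *\<^sub>R a) o\<^sub>L z" using c1 c2 by (metis compose_simps(1,2))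
      then show ?thesis by (simp add: compose_simps)
    qed
    have "z o\<^sub>L (J o\<^sub>L b) = (J o\<^sub>L b) o\<^sub>L z"
    proof -
      have "w - adj w = 2 *\<^sub>R (J o\<^sub>L b)" unfolding wa by (simp add: w_def scaleR_2)
      then have "z o\<^sub>L (2 *\<^sub>R (J o\<^sub>L b)) = (2 *\<^sub>R (J o\<^sub>L b)) o\<^sub>L z" using c1 c2 by (metis compose_simps(3,4))
      then show ?thesis by (simp add: compose_simps)
    qed
    then have "J o\<^sub>L (z o\<^sub>L b) = J o\<^sub>L (b o\<^sub>L z)"
      by (simp add: compose_assoc J_left_commute[OF z])
    then have "J o\<^sub>L (J o\<^sub>L (z o\<^sub>L b)) = J o\<^sub>L (J o\<^sub>L (b o\<^sub>L z))" by simp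
    then have zb: "z o\<^sub>L b = b o\<^sub>L z" by (simp add: J_J)
    have zR: "z o\<^sub>L R = R o\<^sub>L z" using za by (simp add: a_def compose_simps)
    have zxR: "z o\<^sub>L (x o\<^sub>L R) = (x o\<^sub>L R) o\<^sub>L z" using zb by (simp add: b_def compose_simps)
    \<comment> \<open>Every \<open>\<xi>\<close> is \<open>R \<eta>\<close> for
      \<open>\<eta> = \<xi> + x (x \<xi>)\<close>, so \<open>R\<close> can be cancelled on the
      right.\<close>
    show ?thesis
    proof (rule blinfun_eqI)
      fix \<xi>
      let ?\<eta> = "\<xi> + (x o\<^sub>L x) \<xi>"
      have 1: "z (x (R ?\<eta>)) = x (R (z ?\<eta>))" using zxR by (metis blinfun_apply_blinfun_compose)
      have 2: "R (z ?\<eta>) = z (R ?\<eta>)" using zR by (metis blinfun_apply_blinfun_compose)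
      show "(z o\<^sub>L x) \<xi> = (x o\<^sub>L z) \<xi>" using 1 unfolding 2 R(2) by simp
    qed
  qed
  obtain x1 x2 where d: "x1 \<in> M" "adj x1 = x1" "x2 \<in> M" "adj x2 = x2" "x = x1 + (J o\<^sub>L x2)"
    using selfadjoint_decomposition[OF x] by blast
  have "z o\<^sub>L (J o\<^sub>L x2) = J o\<^sub>L (z o\<^sub>L x2)"
    by (rule J_left_commute[OF z])
  then show ?thesis using sa[OF d(1,2)] sa[OF d(3,4)] by (simp add: d(5) compose_simps compose_assoc)
qed

definition unitaries :: "'h op set" where
  "unitaries = {u\<in>M. adj u o\<^sub>L u = id_blinfun \<and> u o\<^sub>L adj u = id_blinfun}"

lemma unitary_norm:
  assumes "u \<in> unitaries" shows "norm u \<le> 1" "norm (adj u) \<le> 1"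
proof -
  have u: "u \<in> M" "adj u o\<^sub>L u = id_blinfun" using assms by (auto simp: unitaries_def)
  show n: "norm u \<le> 1"
  proof (rule norm_blinfun_bound)
    fix \<xi>
    have "inner (u \<xi>) (u \<xi>) = inner \<xi> ((adj u o\<^sub>L u) \<xi>)" by (simp add: inner_adj bounded u(1))
    then have "norm (u \<xi>) = norm \<xi>" by (simp add: u(2) norm_eq_sqrt_inner)
    then show "norm (u \<xi>) \<le> 1 * norm \<xi>" by simp
  qed simp
  show "norm (adj u) \<le> 1" using n by (simp add: norm_adj bounded u)
qed

lemma unitaries_compose:
  assumes "w \<in> unitaries" "u \<in> unitaries" shows "w o\<^sub>L u \<in> unitaries"
proof -
  have *: "w \<in> M" "adj w o\<^sub>L w = id_blinfun" "w o\<^sub>L adj w = id_blinfun"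
    "u \<in> M" "adj u o\<^sub>L u = id_blinfun" "u o\<^sub>L adj u = id_blinfun"
    using assms by (auto simp: unitaries_def)
  have "(adj u o\<^sub>L adj w) o\<^sub>L (w o\<^sub>L u) = adj u o\<^sub>L ((adj w o\<^sub>L w) o\<^sub>L u)" by (simp only: compose_assoc)
  moreover have "(w o\<^sub>L u) o\<^sub>L (adj u o\<^sub>L adj w) = w o\<^sub>L ((u o\<^sub>L adj u) o\<^sub>L adj w)" by (simp only: compose_assoc)
  ultimately show ?thesis by (simp add: unitaries_def M_compose * adj_compose bounded)
qed

lemma span_sa_ball: "span sa_ball = hat ` {x\<in>M. adj x = x}"
proof
  have "subspace (hat ` {x\<in>M. adj x = x})" (is "subspace ?S")
  proof (rule subspaceI)
    have "adj 0 = (0 :: 'h op)" using adj_scaleR[OF bounded_ops_id, of 0] by simp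
    then show "0 \<in> ?S" using hat_zero M_zero by force
  next
    fix v w assume "v \<in> ?S" "w \<in> ?S"
    then obtain x y where "x \<in> M" "adj x = x" "v = hat x" "y \<in> M" "adj y = y" "w = hat y" by auto
    then show "v + w \<in> ?S" by (intro image_eqI[of _ _ "x + y"]) (simp_all add: hat_add M_add adj_add bounded)
  next
    fix r v assume "v \<in> ?S"
    then obtain x where "x \<in> M" "adj x = x" "v = hat x" by auto
    then show "r *\<^sub>R v \<in> ?S" by (intro image_eqI[of _ _ "r *\<^sub>R x"]) (simp_all add: hat_scaleR M_scaleR adj_scaleR bounded)
  qed
  then show "span sa_ball \<subseteq> hat ` {x\<in>M. adj x = x}" by (intro span_minimal) (auto simp: sa_ball_def)
  show "hat ` {x\<in>M. adj x = x} \<subseteq> span sa_ball"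
  proof
    fix v assume "v \<in> hat ` {x\<in>M. adj x = x}"
    then obtain x where x: "x \<in> M" "adj x = x" "v = hat x" by auto
    define K where "K = norm x + 1"
    have K: "K > 0" "norm x \<le> K" by (simp_all add: K_def add_nonneg_pos)
    have "hat ((1/K) *\<^sub>R x) \<in> sa_ball" unfolding sa_ball_def
      using K x by (intro imageI) (simp add: M_scaleR adj_scaleR bounded)
    then have "K *\<^sub>R hat ((1/K) *\<^sub>R x) \<in> span sa_ball" by (intro span_scale span_base)
    then show "v \<in> span sa_ball" using K(1) x by (simp add: hat_scaleR)
  qed
qed

lemma convex_selfadjoint_bounded: "convex {x\<in>M. adj x = x \<and> norm x \<le> K}"
proof (rule convexI)
  fix x y u v assume *: "x \<in> {x\<in>M. adj x = x \<and> norm x \<le> K}" "y \<in> {x\<in>M. adj x = x \<and> norm x \<le> K}"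
    "0 \<le> u" "0 \<le> v" "u + v = (1::real)"
  have "norm (u *\<^sub>R x + v *\<^sub>R y) \<le> u * K + v * K"
    using * by (intro norm_triangle_le add_mono) (auto intro: mult_left_mono)
  also have "\<dots> = K" using * by (metis distrib_right mult_1)
  finally show "u *\<^sub>R x + v *\<^sub>R y \<in> {x\<in>M. adj x = x \<and> norm x \<le> K}"
    using * by (simp add: M_add M_scaleR adj_add adj_scaleR bounded bounded_ops_scaleR)
qed

lemma symmetric_convex_sa_ball: "symmetric_convex sa_ball"
proof
  show "closed sa_ball" by (rule closed_sa_ball)
  show "convex sa_ball"
  proof (rule convexI)
    fix v w s t assume *: "v \<in> sa_ball" "w \<in> sa_ball" "0 \<le> s" "0 \<le> t" "s + t = (1::real)"
    then obtain x y where xy: "x \<in> M" "adj x = x" "norm x \<le> 1" "v = hat x" "y \<in> M" "adj y = y" "norm y \<le> 1" "w = hat y"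
      by (auto simp: sa_ball_def)
    then have "s *\<^sub>R x + t *\<^sub>R y \<in> {x\<in>M. adj x = x \<and> norm x \<le> 1}"
      using * by (intro convexD[OF convex_selfadjoint_bounded]) auto
    moreover have "s *\<^sub>R v + t *\<^sub>R w = hat (s *\<^sub>R x + t *\<^sub>R y)"
      by (simp add: xy hat_add hat_scaleR M_scaleR)
    ultimately show "s *\<^sub>R v + t *\<^sub>R w \<in> sa_ball" unfolding sa_ball_def by blast
  qed
  have a0: "adj 0 = (0 :: 'h op)" using adj_scaleR[OF bounded_ops_id, of 0] by simp
  show "0 \<in> sa_ball" unfolding sa_ball_def
    by (rule image_eqI[of _ _ 0]) (simp_all add: hat_zero M_zero a0)
  fix v assume "v \<in> sa_ball"
  then obtain x where x: "x \<in> M" "adj x = x" "norm x \<le> 1" "v = hat x" by (auto simp: sa_ball_def)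
  have "- v = hat ((-1) *\<^sub>R x)" "(-1) *\<^sub>R x \<in> M" "adj ((-1) *\<^sub>R x) = (-1) *\<^sub>R x"
    using hat_scaleR[OF x(1), of "-1"] M_scaleR[OF x(1), of "-1"] adj_scaleR[OF bounded[OF x(1)], of "-1"] x
    by simp_all
  then show "- v \<in> sa_ball" unfolding sa_ball_def using x(3) by (intro image_eqI[of _ _ "(-1) *\<^sub>R x"]) auto
qed

definition conj_by :: "'h op \<Rightarrow> 'h op \<Rightarrow> 'h op" where
  "conj_by u x = u o\<^sub>L (x o\<^sub>L adj u)"

lemma unitary_mem: "u \<in> unitaries \<Longrightarrow> u \<in> M"
  by (simp add: unitaries_def)

lemma conj_by_M: "u \<in> M \<Longrightarrow> x \<in> M \<Longrightarrow> conj_by u x \<in> M"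
  unfolding conj_by_def by (intro M_intros)

lemma conj_by_add: "conj_by u (x + y) = conj_by u x + conj_by u y"
  and conj_by_diff: "conj_by u (x - y) = conj_by u x - conj_by u y"
  and conj_by_scaleR: "conj_by u (r *\<^sub>R x) = r *\<^sub>R conj_by u x"
  by (simp_all add: conj_by_def compose_simps)

lemma conj_by_compose: "w \<in> M \<Longrightarrow> u \<in> M \<Longrightarrow> conj_by w (conj_by u x) = conj_by (w o\<^sub>L u) x"
  by (simp add: conj_by_def adj_compose bounded compose_assoc)

lemma conj_by_selfadjoint: "u \<in> M \<Longrightarrow> x \<in> M \<Longrightarrow> adj x = x \<Longrightarrow> adj (conj_by u x) = conj_by u x"
  by (simp add: conj_by_def adj_compose bounded M_intros adj_adj compose_assoc)

lemma norm_conj_by: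
  assumes "u \<in> unitaries" shows "norm (conj_by u x) \<le> norm x"
proof -
  have "norm (conj_by u x) \<le> norm u * norm (x o\<^sub>L adj u)" unfolding conj_by_def by (rule norm_blinfun_compose)
  also have "\<dots> \<le> 1 * (norm x * norm (adj u))"
    by (intro mult_mono norm_blinfun_compose unitary_norm assms) auto
  also have "\<dots> \<le> 1 * (norm x * 1)" by (intro mult_left_mono unitary_norm assms) auto
  finally show ?thesis by simp
qed

lemma norm_hat_conj_by:
  assumes u: "u \<in> unitaries" and x: "x \<in> M" shows "norm (hat (conj_by u x)) \<le> norm (hat x)"
proof -
  have uM: "u \<in> M" using u by (rule unitary_mem)
  have "norm (hat (conj_by u x)) \<le> norm u * norm (hat (x o\<^sub>L adj u))"
    unfolding conj_by_def by (intro norm_hat_compose_left M_intros uM x)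
  also have "\<dots> \<le> 1 * (norm (hat x) * norm (adj u))"
    by (intro mult_mono norm_hat_compose_right M_intros uM x unitary_norm u) auto
  also have "\<dots> \<le> 1 * (norm (hat x) * 1)" by (intro mult_left_mono unitary_norm u) auto
  finally show ?thesis by simp
qed

lemma tr_conj_by:
  assumes u: "u \<in> unitaries" and x: "x \<in> M" shows "tr (conj_by u x) = tr x"
proof -
  have uM: "u \<in> M" "adj u o\<^sub>L u = id_blinfun" using u by (auto simp: unitaries_def)
  have "tr (conj_by u x) = tr ((x o\<^sub>L adj u) o\<^sub>L u)"
    unfolding conj_by_def by (intro tr_commute M_intros uM x)
  then show ?thesis by (simp add: compose_assoc uM(2))
qed

text \<open>Dixmier averaging in the 2-norm: the element of least 2-norm in the closed convex hull of the
  unitary conjugates of \<open>x\<close> is fixed by conjugation, hence central, hence a scalar, and its trace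
  is that of \<open>x\<close>.\<close>

lemma averaging:
  assumes factor: "factor M" and x: "x \<in> M" "adj x = x" and tr: "tr x \<noteq> 0"
  obtains l where "l \<noteq> 0" "hat (scalar_op l) \<in> closure (hat ` (span ((\<lambda>u. conj_by u x) ` unitaries)))"
proof -
  let ?C = "(\<lambda>u. conj_by u x) ` unitaries"
  let ?H = "convex hull (hat ` ?C)"
  let ?Q = "closure ?H"
  define K where "K = norm x + 1"
  have K: "0 < K" "norm x \<le> K" by (simp_all add: K_def add_nonneg_pos)
  \<comment> \<open>These properties pass to convex combinations, so they hold on the whole hull.
    The norm and trace conditions also survive the closure; the last clause makes the closed hull
    invariant under conjugation.\<close>
  define good where "good = {y\<in>M. adj y = y \<and> norm y \<le> K \<and> tr y = tr x \<and> y \<in> span ?C \<and>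
    (\<forall>w\<in>unitaries. hat (conj_by w y) \<in> ?H)}"
  have H_good: "?H \<subseteq> hat ` good"
  proof (rule hull_minimal)
    show "hat ` ?C \<subseteq> hat ` good"
    proof (rule image_mono, rule subsetI)
      fix y assume "y \<in> ?C"
      then obtain u where u: "u \<in> unitaries" "y = conj_by u x" by auto
      have uM: "u \<in> M" by (rule unitary_mem[OF u(1)])
      have "hat (conj_by w y) \<in> ?H" if w: "w \<in> unitaries" for w
      proof -
        have "conj_by w y \<in> ?C"
          using conj_by_compose[OF unitary_mem[OF w] uM] unitaries_compose[OF w u(1)] by (simp add: u(2))
        then show ?thesis by (intro hull_inc imageI)
      qed
      then show "y \<in> good"
        using u x conj_by_M[OF uM x(1)] conj_by_selfadjoint[OF uM x] norm_conj_by[OF u(1), of x] K(2)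
          tr_conj_by[OF u(1) x(1)]
        by (auto simp: good_def intro: span_base)
    qed
    show "convex (hat ` good)"
    proof (rule convexI)
      fix v w s t assume *: "v \<in> hat ` good" "w \<in> hat ` good" "0 \<le> s" "0 \<le> t" "s + t = (1::real)"
      then obtain y z where yz: "y \<in> good" "z \<in> good" "v = hat y" "w = hat z" by auto
      then have M: "y \<in> M" "z \<in> M" by (auto simp: good_def)
      let ?y = "s *\<^sub>R y + t *\<^sub>R z"
      have "?y \<in> {x\<in>M. adj x = x \<and> norm x \<le> K}"
        using * yz by (intro convexD[OF convex_selfadjoint_bounded]) (auto simp: good_def)
      moreover have "tr ?y = tr x"
      proof -
        have "tr ?y = s * tr x + t * tr x" using yz M by (simp add: good_def tr_add tr_scaleR M_scaleR)
        then show ?thesis using *(5) by (metis distrib_right mult_1)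
      qed
      moreover have "?y \<in> span ?C" using yz by (intro span_add span_scale) (auto simp: good_def)
      moreover have "hat (conj_by u ?y) \<in> ?H" if u: "u \<in> unitaries" for u
      proof -
        have "hat (conj_by u ?y) = s *\<^sub>R hat (conj_by u y) + t *\<^sub>R hat (conj_by u z)"
          using conj_by_M[OF unitary_mem[OF u]] M
          by (simp add: conj_by_add conj_by_scaleR hat_add hat_scaleR M_scaleR)
        moreover have "hat (conj_by u y) \<in> ?H" "hat (conj_by u z) \<in> ?H" using yz u by (auto simp: good_def)
        ultimately show ?thesis using * convexD[OF convex_convex_hull] by metis
      qed
      ultimately have "?y \<in> good" by (simp add: good_def)
      moreover have "s *\<^sub>R v + t *\<^sub>R w = hat ?y" by (simp add: yz M hat_add hat_scaleR M_scaleR)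
      ultimately show "s *\<^sub>R v + t *\<^sub>R w \<in> hat ` good" by blast
    qed
  qed
  have "id_blinfun \<in> unitaries" by (simp add: unitaries_def M_id adj_id)
  then interpret Q: closed_convex ?Q
    by unfold_locales (auto simp: convex_closure)
  define q where "q = nearest ?Q 0"
  have q: "q \<in> ?Q" unfolding q_def by (rule Q.nearest_mem)
  \<comment> \<open>The minimiser is a priori only a vector of the completion. Closedness of
    \<open>sa_ball\<close>, scaled by \<open>K > 0\<close>, shows that it comes from an element of
    \<open>M\<close>, and its trace is still that of \<open>x\<close>.\<close>
  have "?Q \<subseteq> (\<lambda>v. (1/K) *\<^sub>R v) -` sa_ball \<inter> {v. inner (hat id_blinfun) v = tr x}"
  proof (rule closure_minimal)
    show "?H \<subseteq> (\<lambda>v. (1/K) *\<^sub>R v) -` sa_ball \<inter> {v. inner (hat id_blinfun) v = tr x}"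
    proof
      fix v assume "v \<in> ?H"
      then obtain y where y: "y \<in> good" "v = hat y" using H_good by blast
      then have yM: "y \<in> M" "adj y = y" "norm y \<le> K" "tr y = tr x" by (auto simp: good_def)
      have "(1/K) *\<^sub>R y \<in> M \<and> adj ((1/K) *\<^sub>R y) = (1/K) *\<^sub>R y \<and> norm ((1/K) *\<^sub>R y) \<le> 1"
        using yM K by (simp add: M_scaleR adj_scaleR bounded)
      moreover have "(1/K) *\<^sub>R v = hat ((1/K) *\<^sub>R y)" by (simp add: y(2) hat_scaleR yM(1))
      ultimately have "(1/K) *\<^sub>R v \<in> sa_ball" unfolding sa_ball_def by blast
      then show "v \<in> (\<lambda>v. (1/K) *\<^sub>R v) -` sa_ball \<inter> {v. inner (hat id_blinfun) v = tr x}"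
        using yM by (simp add: y(2) inner_hat M_id)
    qed
    have "closed ((\<lambda>v. (1/K) *\<^sub>R v) -` sa_ball)"
      by (intro closed_vimage closed_sa_ball continuous_intros)
    moreover have "closed {v. inner (hat id_blinfun) v = tr x}"
      by (intro closed_Collect_eq continuous_intros)
    ultimately show "closed ((\<lambda>v. (1/K) *\<^sub>R v) -` sa_ball \<inter> {v. inner (hat id_blinfun) v = tr x})" by blast
  qed
  then have qball: "(1/K) *\<^sub>R q \<in> sa_ball" and qtr: "inner (hat id_blinfun) q = tr x" using q by auto
  then obtain y where y: "y \<in> M" "adj y = y" "(1/K) *\<^sub>R q = hat y" by (auto simp: sa_ball_def)
  define z where "z = K *\<^sub>R y"
  have zM: "z \<in> M" unfolding z_def by (intro M_intros y)
  have qz: "q = hat z"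
  proof -
    have "hat z = K *\<^sub>R ((1/K) *\<^sub>R q)" unfolding z_def using hat_scaleR[OF y(1)] y(3) by simp
    then show ?thesis using K(1) by simp
  qed
  have fixed: "conj_by w z = z" if w: "w \<in> unitaries" for w
  proof -
    have wM: "w \<in> M" by (rule unitary_mem[OF w])
    obtain f where f: "\<And>n. f n \<in> ?H" "f \<longlonglongrightarrow> q" using q unfolding closure_sequential by blast
    have "\<exists>y\<in>good. f n = hat y" for n using f(1) H_good by blast
    then obtain g where g: "\<And>n. g n \<in> good" "\<And>n. f n = hat (g n)" by metis
    have gM: "g n \<in> M" for n using g(1)[of n] by (simp add: good_def)
    have "(\<lambda>n. hat (conj_by w (g n))) \<longlonglongrightarrow> hat (conj_by w z)"
    proof (rule LIM_zero_cancel, rule tendsto_norm_zero_cancel, rule tendsto_sandwich[OF _ _ tendsto_const])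
      have "norm (hat (conj_by w (g n)) - hat (conj_by w z)) \<le> norm (f n - q)" for n
        using norm_hat_conj_by[OF w M_diff[OF gM zM], of n]
        by (simp add: conj_by_diff hat_diff conj_by_M wM gM zM g(2) qz)
      then show "\<forall>\<^sub>F n in sequentially. norm (hat (conj_by w (g n)) - hat (conj_by w z)) \<le> norm (f n - q)" by simp
      show "(\<lambda>n. norm (f n - q)) \<longlonglongrightarrow> 0" using tendsto_norm_zero[OF LIM_zero[OF f(2)]] .
    qed simp
    moreover have "hat (conj_by w (g n)) \<in> ?H" for n using g(1)[of n] w by (simp add: good_def)
    ultimately have inQ: "hat (conj_by w z) \<in> ?Q"
      unfolding closure_sequential by (intro exI[of _ "\<lambda>n. hat (conj_by w (g n))"]) auto
    have "nearest ?Q 0 = hat (conj_by w z)"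
    proof (rule Q.nearest_unique_norm[OF inQ])
      fix c assume "c \<in> ?Q"
      then have "norm (0 - q) \<le> norm (0 - c)" unfolding q_def by (rule Q.nearest_norm_le)
      then show "norm (0 - hat (conj_by w z)) \<le> norm (0 - c)"
        using norm_hat_conj_by[OF w zM] by (simp add: qz)
    qed
    then show ?thesis using hat_inj[OF zM conj_by_M[OF wM zM]] by (simp add: qz flip: q_def)
  qed
  have "z o\<^sub>L w = w o\<^sub>L z" if "w \<in> M" for w
  proof (rule commute_with_unitaries[OF zM _ that])
    fix w assume w: "w \<in> M" "adj w o\<^sub>L w = id_blinfun" "w o\<^sub>L adj w = id_blinfun"
    then have "conj_by w z o\<^sub>L w = z o\<^sub>L w" using fixed by (simp add: unitaries_def)
    then show "z o\<^sub>L w = w o\<^sub>L z" by (simp add: conj_by_def compose_assoc w(2))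
  qed
  then have "z \<in> commutant M" by (simp add: commutant_def bounded zM)
  then obtain l where l: "z = scalar_op l" using factor zM unfolding factor_def by blast
  have "tr z \<noteq> 0" using qtr tr by (simp add: qz inner_hat M_id zM) (metis id_compose(2) inner_commute inner_hat M_id zM adj_id id_compose(1))
  then have "z \<noteq> 0" using tr_zero by auto
  then have "l \<noteq> 0" using l by (metis blinfun_eqI scalar_op_apply complex_vector.scale_zero_left blinfun.zero_left)
  moreover have "hat (scalar_op l) \<in> closure (hat ` span ?C)"
  proof -
    have "?H \<subseteq> hat ` span ?C" using H_good by (auto simp: good_def)
    then show ?thesis using q closure_mono unfolding qz l by blast
  qed
  ultimately show thesis by (rule that)
qed

text \<open>By faithfulness \<open>c^2\<close> has nonzero trace, so finite combinations of its
  conjugates converge to a nonzero scalar, and a convergent sequence involves only countably many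
  unitaries. If all the compressions of \<open>z\<close> vanish, so do the products
  \<open>conj_by u (c^2) z conj_by v (c^2)\<close>, and the limit leaves
  \<open>z = 0\<close>.\<close>

lemma separating_unitaries:
  assumes factor: "factor M" and c: "c \<in> M" "adj c = c" "c \<noteq> 0"
  shows "\<exists>U. countable U \<and> U \<subseteq> unitaries \<and>
    (\<forall>z\<in>M. (\<forall>u\<in>U. \<forall>v\<in>U. c o\<^sub>L (adj u o\<^sub>L (z o\<^sub>L (v o\<^sub>L c))) = 0) \<longrightarrow> z = 0)"
proof -
  define f where "f u = conj_by u (c o\<^sub>L c)" for u
  have ccM: "c o\<^sub>L c \<in> M" by (intro M_intros c)
  have "tr (c o\<^sub>L c) \<noteq> 0" using tr_faithful[OF c(1)] c by auto
  then obtain l where l: "l \<noteq> 0" "hat (scalar_op l) \<in> closure (hat ` span (f ` unitaries))"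
    using averaging[OF factor ccM] c unfolding f_def by (auto simp: adj_compose bounded)
  let ?S = "scalar_op l :: 'h op"
  obtain e' where "\<And>n. e' n \<in> hat ` span (f ` unitaries)" "e' \<longlonglongrightarrow> hat ?S"
    using l(2) unfolding closure_sequential by blast
  then have "\<exists>x. x \<in> span (f ` unitaries) \<and> e' n = hat x" for n by blast
  then obtain e where e: "\<And>n. e n \<in> span (f ` unitaries)" "\<And>n. e' n = hat (e n)" by metis
  have elim: "(\<lambda>n. hat (e n)) \<longlonglongrightarrow> hat ?S" using \<open>e' \<longlonglongrightarrow> hat ?S\<close> by (simp flip: e(2))
  have "\<exists>F. finite F \<and> F \<subseteq> f ` unitaries \<and> e n \<in> span F" for n
    using e(1)[of n] by (auto simp: span_explicit intro!: span_sum span_scale span_base)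
  then obtain F where F: "\<And>n. finite (F n) \<and> F n \<subseteq> f ` unitaries \<and> e n \<in> span (F n)" by metis
  have "countable (\<Union>n. F n)" "(\<Union>n. F n) \<subseteq> f ` unitaries" using F by (auto intro: countable_finite)
  then obtain U where U: "countable U" "U \<subseteq> unitaries" "(\<Union>n. F n) = f ` U"
    using countable_subset_image by metis
  have eU: "e n \<in> span (f ` U)" for n using F[of n] U(3) span_mono[of "F n" "f ` U"] by blast
  have eM: "e n \<in> M" for n
  proof -
    have "subspace M" by (auto simp: subspace_def M_intros)
    moreover have "f ` unitaries \<subseteq> M" using ccM unitary_mem by (auto simp: f_def intro: conj_by_M)
    ultimately show ?thesis using e(1)[of n] span_minimal by blast
  qed
  have sep: "z = 0" if z: "z \<in> M" and zero: "\<And>u v. u \<in> U \<Longrightarrow> v \<in> U \<Longrightarrow> c o\<^sub>L (adj u o\<^sub>L (z o\<^sub>L (v o\<^sub>L c))) = 0" for z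
  proof -
    have ff: "f u o\<^sub>L (z o\<^sub>L f v) = 0" if "u \<in> U" "v \<in> U" for u v
    proof -
      have "f u o\<^sub>L (z o\<^sub>L f v) = u o\<^sub>L (c o\<^sub>L ((c o\<^sub>L (adj u o\<^sub>L (z o\<^sub>L (v o\<^sub>L c)))) o\<^sub>L (c o\<^sub>L adj v)))"
        by (simp only: f_def conj_by_def compose_assoc)
      then show ?thesis using zero[OF that] by (simp add: compose_simps)
    qed
    have fe: "f u o\<^sub>L (z o\<^sub>L b) = 0" if "u \<in> U" "b \<in> span (f ` U)" for u b
      using that(2) by (induction rule: span_induct) (auto simp: subspace_def compose_simps ff that(1))
    have ee: "a o\<^sub>L (z o\<^sub>L b) = 0" if "a \<in> span (f ` U)" "b \<in> span (f ` U)" for a b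
      using that(1) by (induction rule: span_induct) (auto simp: subspace_def compose_simps fe that(2))
    have SM: "?S \<in> M" by (rule M_scalar)
    have S_cancel: "x = 0" if "?S o\<^sub>L x = 0" for x
    proof (rule blinfun_eqI)
      fix \<xi>
      have "l *\<^sub>C x \<xi> = 0" using that by (metis blinfun_apply_blinfun_compose scalar_op_apply blinfun.zero_left)
      then show "x \<xi> = blinfun_apply 0 \<xi>" using l(1) by (simp add: complex_vector.scale_eq_0_iff)
    qed
    have S_comm: "x o\<^sub>L ?S = ?S o\<^sub>L x" if "x \<in> M" for x
      by (rule blinfun_eqI) (simp add: bounded_ops_D[OF bounded[OF that]])
    \<comment> \<open>No operator-norm bound on the \<open>e n\<close> is recorded, so the limits
      are taken one factor at a time, against a fixed operator on the other side.\<close>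
    have right: "x o\<^sub>L ?S = 0" if x: "x \<in> M" "\<And>n. x o\<^sub>L e n = 0" for x
    proof -
      have "norm (hat (x o\<^sub>L ?S)) \<le> norm x * norm (hat (e n) - hat ?S)" for n
      proof -
        have "x o\<^sub>L ?S = (-1) *\<^sub>R (x o\<^sub>L (e n - ?S))" using x(2)[of n] by (simp add: compose_simps)
        then have "hat (x o\<^sub>L ?S) = (-1) *\<^sub>R hat (x o\<^sub>L (e n - ?S))"
          using hat_scaleR[of "x o\<^sub>L (e n - ?S)" "-1"] by (simp only: M_intros x(1) eM)
        then have "norm (hat (x o\<^sub>L ?S)) = norm (hat (x o\<^sub>L (e n - ?S)))" by simp
        also have "\<dots> \<le> norm x * norm (hat (e n - ?S))" by (intro norm_hat_compose_left M_intros x eM)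
        finally show ?thesis by (simp add: hat_diff eM SM)
      qed
      moreover have "(\<lambda>n. norm x * norm (hat (e n) - hat ?S)) \<longlonglongrightarrow> norm x * 0"
        by (intro tendsto_intros tendsto_norm_zero LIM_zero elim)
      ultimately have "norm (hat (x o\<^sub>L ?S)) \<le> norm x * 0" by (intro LIMSEQ_le_const) auto
      then have "hat (x o\<^sub>L ?S) = 0" by simp
      then show ?thesis using hat_eq_0_iff[OF M_compose[OF x(1) SM]] by blast
    qed
    have ez: "e n o\<^sub>L z = 0" for n
    proof (rule S_cancel)
      have ezM: "e n o\<^sub>L z \<in> M" by (intro M_intros eM z)
      have "(e n o\<^sub>L z) o\<^sub>L e m = 0" for m using ee[OF eU eU] by (simp add: compose_assoc)
      then have "(e n o\<^sub>L z) o\<^sub>L ?S = 0" by (rule right[OF ezM])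
      then show "?S o\<^sub>L (e n o\<^sub>L z) = 0" using S_comm[OF ezM] by simp
    qed
    have "norm (hat (?S o\<^sub>L z)) \<le> norm (hat (e n) - hat ?S) * norm z" for n
    proof -
      have "?S o\<^sub>L z = (-1) *\<^sub>R ((e n - ?S) o\<^sub>L z)" using ez[of n] by (simp add: compose_simps)
      then have "hat (?S o\<^sub>L z) = (-1) *\<^sub>R hat ((e n - ?S) o\<^sub>L z)"
        using hat_scaleR[of "(e n - ?S) o\<^sub>L z" "-1"] by (simp only: M_intros z eM)
      then have "norm (hat (?S o\<^sub>L z)) = norm (hat ((e n - ?S) o\<^sub>L z))" by simp
      also have "\<dots> \<le> norm (hat (e n - ?S)) * norm z" by (intro norm_hat_compose_right M_intros z eM)
      finally show ?thesis by (simp add: hat_diff eM SM)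
    qed
    moreover have "(\<lambda>n. norm (hat (e n) - hat ?S) * norm z) \<longlonglongrightarrow> 0 * norm z"
      by (intro tendsto_intros tendsto_norm_zero LIM_zero elim)
    ultimately have "norm (hat (?S o\<^sub>L z)) \<le> 0 * norm z" by (intro LIMSEQ_le_const) auto
    then have "hat (?S o\<^sub>L z) = 0" by simp
    then have "?S o\<^sub>L z = 0" using hat_eq_0_iff[OF M_compose[OF SM z]] by blast
    then show "z = 0" by (rule S_cancel)
  qed
  show ?thesis
  proof (intro exI[of _ U] conjI ballI impI U(1,2))
    fix z assume z: "z \<in> M" and zero: "\<forall>u\<in>U. \<forall>v\<in>U. c o\<^sub>L (adj u o\<^sub>L (z o\<^sub>L (v o\<^sub>L c))) = 0"
    show "z = 0" by (rule sep[OF z]) (rule zero[THEN bspec, THEN bspec])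
  qed
qed

section \<open>Extension of contractions orthogonally to a small set\<close>

lemma hat_decomposition:
  assumes x: "x \<in> M"
  obtains v w where "v \<in> span sa_ball" "w \<in> span sa_ball" "hat x = v + \<i> *\<^sub>C w"
proof -
  obtain x1 x2 where d: "x1 \<in> M" "adj x1 = x1" "x2 \<in> M" "adj x2 = x2" "x = x1 + (J o\<^sub>L x2)"
    using selfadjoint_decomposition[OF x] by blast
  show thesis
    by (rule that[of "hat x1" "hat x2"]) (auto simp: d span_sa_ball hat_add hat_J M_compose J_M)
qed

text \<open>Pairs from \<open>G\<close> give a set dense in \<open>M_sa + \<i> M_sa\<close>, hence
  in the whole completion, and squaring an infinite cardinal does not enlarge it.\<close>

lemma span_sa_ball_not_small:
  assumes D: "least_dense_subset (UNIV :: 'k set) D" "uncountable D"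
    and G: "span sa_ball \<subseteq> closure G"
  shows "\<not> |G| <o |D|"
proof
  assume less: "|G| <o |D|"
  obtain L :: "'k set" where L: "infinite L" "|G| \<le>o |L|" "|L| <o |D|"
    using ordLess_infinite_between[OF D(2) less] by metis
  define E where "E = (\<lambda>(v, w). v + \<i> *\<^sub>C w) ` (G \<times> G)"
  have sum: "v + \<i> *\<^sub>C w \<in> closure E" if vw: "v \<in> closure G" "w \<in> closure G" for v w
  proof -
    obtain f g where fg: "\<And>n. f n \<in> G" "f \<longlonglongrightarrow> v" "\<And>n. g n \<in> G" "g \<longlonglongrightarrow> w"
      using vw unfolding closure_sequential by blast
    have "(\<lambda>n. f n + \<i> *\<^sub>C g n) \<longlonglongrightarrow> v + \<i> *\<^sub>C w"
      by (intro tendsto_add fg bounded_linear.tendsto[OF bounded_linear_scaleC])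
    moreover have "f n + \<i> *\<^sub>C g n \<in> E" for n using fg(1,3) unfolding E_def by force
    ultimately show ?thesis
      unfolding closure_sequential by (intro exI[of _ "\<lambda>n. f n + \<i> *\<^sub>C g n"]) auto
  qed
  have "hat ` M \<subseteq> closure E"
  proof
    fix y assume "y \<in> hat ` M"
    then obtain x where "x \<in> M" "y = hat x" by auto
    then obtain v w where "v \<in> span sa_ball" "w \<in> span sa_ball" "y = v + \<i> *\<^sub>C w"
      using hat_decomposition by metis
    then show "y \<in> closure E" using sum G by blast
  qed
  then have "closure E = UNIV" using hat_dense closure_minimal[of "hat ` M" "closure E"] by auto
  then have "|D| \<le>o |E|" using D(1) by (auto simp: least_dense_subset_def)
  also have "|E| \<le>o |L|"
    unfolding E_def using card_of_image_ordLeq[OF card_of_Times_ordLeq[OF L(1,2,2)]] .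
  finally show False using L(3) not_ordLess_ordLeq by blast
qed

text \<open>With \<open>c = 1 - a\<^sup>2 = (1 - a) (1 + a)\<close> one has \<open>c\<^sup>2 \<le> 8 (1 \<plusminus> a)\<close>, so small elements of \<open>c M c\<close> can be
  added to \<open>a\<close> without leaving the unit ball.\<close>

lemma perturbation:
  assumes a: "a \<in> M" "adj a = a" "norm a \<le> 1" and s: "s \<in> M" "adj s = s"
  defines "c \<equiv> id_blinfun - (a o\<^sub>L a)"
  shows "\<exists>r>0. norm (a + r *\<^sub>R (c o\<^sub>L (s o\<^sub>L c))) \<le> 1"
proof -
  have cM: "c \<in> M" unfolding c_def by (intro M_intros a)
  have ca: "adj c = c" by (simp add: c_def adj_diff adj_compose bounded_ops_id bounded M_compose a adj_id)
  define w where "w = c o\<^sub>L (s o\<^sub>L c)"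
  have wM: "w \<in> M" unfolding w_def by (intro M_intros cM s)
  have wa: "adj w = w" by (simp add: w_def adj_compose bounded M_compose cM s ca compose_assoc)
  \<comment> \<open>The 8 matches the constant in \<open>c^2 \<le> 8 (1 \<plusminus> a)\<close>;
    adding 1 keeps the denominator positive when \<open>s = 0\<close>.\<close>
  define r where "r = 1 / (8 * (norm s + 1))"
  have r: "r > 0" unfolding r_def by (simp add: add_nonneg_pos)
  \<comment> \<open>Used for \<open>b = a\<close> and \<open>b = - a\<close>. From
    \<open>c = (1 + b) (1 - b)\<close> comes
    \<open>norm (c \<xi>) \<le> 2 * norm ((1 - b) \<xi>)\<close>, and
    \<open>(1 - b)^2 \<le> 2 (1 - b)\<close>; together \<open>4 * 2 = 8\<close>.\<close>
  have c8: "(norm (c \<xi>))\<^sup>2 \<le> 8 * inner ((id_blinfun - b) \<xi>) \<xi>" if b: "b \<in> M" "adj b = b" "norm b \<le> 1" "b o\<^sub>L b = a o\<^sub>L a" for b \<xi>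
  proof -
    let ?T = "id_blinfun - b"
    have posT: "pos ?T" using pos_id_minus[OF bounded[OF b(1)] b(2,3)] by simp
    have bb: "b (b \<xi>) = a (a \<xi>)" using b(4) by (metis blinfun_apply_blinfun_compose)
    have "c \<xi> = ?T \<xi> + b (?T \<xi>)" by (simp add: c_def blinfun.diff_left blinfun.diff_right bb)
    then have "norm (c \<xi>) \<le> norm (?T \<xi>) + norm (b (?T \<xi>))" using norm_triangle_ineq by metis
    also have "norm (b (?T \<xi>)) \<le> norm (?T \<xi>)"
      using norm_blinfun[of b "?T \<xi>"] mult_right_mono[OF b(3), of "norm (?T \<xi>)"] by simp
    finally have "norm (c \<xi>) \<le> 2 * norm (?T \<xi>)" by simp
    then have "(norm (c \<xi>))\<^sup>2 \<le> 4 * (norm (?T \<xi>))\<^sup>2"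
      using power_mono[of "norm (c \<xi>)" "2 * norm (?T \<xi>)" 2] by (simp add: power_mult_distrib)
    also have "(norm (?T \<xi>))\<^sup>2 \<le> 2 * inner (?T \<xi>) \<xi>"
    proof (rule pos_norm_apply_le[OF posT])
      fix \<eta>
      have "\<bar>inner (b \<eta>) \<eta>\<bar> \<le> 1 * (norm \<eta>)\<^sup>2"
        using abs_inner_le_norm[of b \<eta>] mult_right_mono[OF b(3), of "(norm \<eta>)\<^sup>2"] by simp
      then show "inner (?T \<eta>) \<eta> \<le> 2 * (norm \<eta>)\<^sup>2"
        by (simp add: blinfun.diff_left inner_diff_left power2_norm_eq_inner)
    qed simp
    finally show ?thesis by simp
  qed
  have form: "\<bar>inner ((r *\<^sub>R w) \<xi>) \<xi>\<bar> \<le> (norm (c \<xi>))\<^sup>2 / 8" for \<xi>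
  proof -
    have "inner (w \<xi>) \<xi> = inner (s (c \<xi>)) (c \<xi>)"
      using selfadj_inner[OF bounded[OF cM] ca, of "s (c \<xi>)" \<xi>] by (simp add: w_def)
    then have "\<bar>inner ((r *\<^sub>R w) \<xi>) \<xi>\<bar> = r * \<bar>inner (s (c \<xi>)) (c \<xi>)\<bar>"
      using r by (simp add: blinfun.scaleR_left abs_mult)
    also have "\<dots> \<le> r * (norm s * (norm (c \<xi>))\<^sup>2)"
      using r abs_inner_le_norm by (intro mult_left_mono) auto
    also have "\<dots> = (r * norm s) * (norm (c \<xi>))\<^sup>2" by simp
    also have "\<dots> \<le> (1/8) * (norm (c \<xi>))\<^sup>2"
    proof (rule mult_right_mono)
      have "norm s / (norm s + 1) \<le> 1" by (subst divide_le_eq_1_pos) (simp_all add: add_nonneg_pos)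
      then have "norm s / (norm s + 1) / 8 \<le> 1 / 8" by (rule divide_right_mono) simp
      moreover have "r * norm s = norm s / (norm s + 1) / 8"
        by (simp only: r_def times_divide_eq_left mult_1_left divide_divide_eq_left mult.commute[of 8])
      ultimately show "r * norm s \<le> 1 / 8" by (simp only:)
    qed simp
    finally show ?thesis by simp
  qed
  have abM: "a + r *\<^sub>R w \<in> M" by (intro M_intros a wM)
  have aba: "adj (a + r *\<^sub>R w) = a + r *\<^sub>R w"
    by (simp add: adj_add adj_scaleR bounded bounded_ops_scaleR a wM wa)
  have "norm (a + r *\<^sub>R w) \<le> 1"
  proof (rule norm_le_of_pos)
    show "pos (1 *\<^sub>R id_blinfun - (a + r *\<^sub>R w))"
    proof (rule posI)
      show "1 *\<^sub>R id_blinfun - (a + r *\<^sub>R w) \<in> bounded_ops" by (intro bounded M_intros a wM)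
      show "adj (1 *\<^sub>R id_blinfun - (a + r *\<^sub>R w)) = 1 *\<^sub>R id_blinfun - (a + r *\<^sub>R w)"
        using aba by (simp add: adj_diff bounded_ops_id bounded[OF abM] adj_id)
      show "0 \<le> inner ((1 *\<^sub>R id_blinfun - (a + r *\<^sub>R w)) \<xi>) \<xi>" for \<xi>
        using form[of \<xi>] c8[OF a refl, of \<xi>]
        by (simp add: blinfun.diff_left blinfun.add_left inner_diff_left inner_add_left)
    qed
    show "pos (1 *\<^sub>R id_blinfun + (a + r *\<^sub>R w))"
    proof (rule posI)
      show "1 *\<^sub>R id_blinfun + (a + r *\<^sub>R w) \<in> bounded_ops" by (intro bounded M_intros a wM)
      show "adj (1 *\<^sub>R id_blinfun + (a + r *\<^sub>R w)) = 1 *\<^sub>R id_blinfun + (a + r *\<^sub>R w)"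
        using aba by (simp add: adj_add bounded_ops_id bounded[OF abM] adj_id)
      have ma: "- a \<in> M" "adj (- a) = - a" "norm (- a) \<le> 1" "(- a) o\<^sub>L (- a) = a o\<^sub>L a"
        using M_uminus[OF a(1)] adj_scaleR[OF bounded[OF a(1)], of "-1"] a by (simp_all add: uminus_compose)
      show "0 \<le> inner ((1 *\<^sub>R id_blinfun + (a + r *\<^sub>R w)) \<xi>) \<xi>" for \<xi>
        using form[of \<xi>] c8[OF ma, of \<xi>]
        by (simp add: blinfun.add_left blinfun.diff_left blinfun.minus_left inner_add_left inner_diff_left)
    qed
  qed simp
  then show ?thesis using r unfolding w_def by blast
qed

text \<open>Orthogonality to \<open>G\<close> is moved off the compressed element:
  \<open>c (adj u z v) c\<close> is orthogonal to \<open>\<gamma>\<close> if \<open>z\<close> is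
  orthogonal to \<open>u c \<gamma> c (adj v)\<close>. Countably many \<open>u\<close>,
  \<open>v\<close> suffice to make some compression nonzero, so only fewer than kappa conditions
  fall on \<open>z\<close>, and a bounded nonzero \<open>z\<close> satisfies them.\<close>

lemma extension:
  assumes factor: "factor M" and D: "least_dense_subset (UNIV :: 'k set) D" "uncountable D"
    and a: "a \<in> sa_ball" "norm a < 1" and G: "G \<subseteq> span sa_ball" "|G| <o |D|"
  shows "\<exists>b. b \<noteq> 0 \<and> a + b \<in> sa_ball \<and> (\<forall>g\<in>G. inner b g = 0)"
proof -
  interpret B: symmetric_convex sa_ball by (rule symmetric_convex_sa_ball)
  obtain a0 where a0: "a0 \<in> M" "adj a0 = a0" "norm a0 \<le> 1" "a = hat a0" using a(1) by (auto simp: sa_ball_def)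
  define c where "c = id_blinfun - (a0 o\<^sub>L a0)"
  have cM: "c \<in> M" unfolding c_def by (intro M_intros a0)
  have ca: "adj c = c" by (simp add: c_def adj_diff adj_compose bounded_ops_id bounded M_compose a0 adj_id)
  have "c \<noteq> 0"
  proof
    \<comment> \<open>Otherwise \<open>a0\<close> squares to 1 and its vector has norm 1, against
      \<open>norm a < 1\<close>.\<close>
    assume "c = 0"
    then have "(norm a)\<^sup>2 = 1" by (simp add: a0(4) norm_hat a0(1,2) c_def flip: tr_id)
    then show False using a(2) by (simp add: power2_eq_1_iff) (metis norm_ge_zero not_less zero_le_one order_less_irrefl less_minus_one_simps(1) order_trans not_one_le_zero)
  qed
  obtain U where U: "countable U" "U \<subseteq> unitaries"
    "\<And>z. z \<in> M \<Longrightarrow> (\<And>u v. u \<in> U \<Longrightarrow> v \<in> U \<Longrightarrow> c o\<^sub>L (adj u o\<^sub>L (z o\<^sub>L (v o\<^sub>L c))) = 0) \<Longrightarrow> z = 0"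
  proof -
    obtain U where "countable U" "U \<subseteq> unitaries"
      and sep: "\<forall>z\<in>M. (\<forall>u\<in>U. \<forall>v\<in>U. c o\<^sub>L (adj u o\<^sub>L (z o\<^sub>L (v o\<^sub>L c))) = 0) \<longrightarrow> z = 0"
      using separating_unitaries[OF factor cM ca \<open>c \<noteq> 0\<close>] by (elim exE conjE)
    then show thesis by (intro that[of U]) (auto intro!: sep[rule_format])
  qed
  have "\<forall>g\<in>G. \<exists>x\<in>M. adj x = x \<and> hat x = g" using G(1) unfolding span_sa_ball by blast
  then obtain \<gamma> where \<gamma>: "\<And>g. g \<in> G \<Longrightarrow> \<gamma> g \<in> M" "\<And>g. g \<in> G \<Longrightarrow> adj (\<gamma> g) = \<gamma> g" "\<And>g. g \<in> G \<Longrightarrow> hat (\<gamma> g) = g"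
    by metis
  define k where "k u v g = u o\<^sub>L (c o\<^sub>L (\<gamma> g o\<^sub>L (c o\<^sub>L adj v)))" for u v :: "'h op" and g
  have kM: "k u v g \<in> M" if "u \<in> U" "v \<in> U" "g \<in> G" for u v g
    unfolding k_def using that U(2) unitary_mem by (intro M_intros cM \<gamma>) auto
  define G1 where "G1 = (\<Union>(u, v)\<in>U \<times> U. (\<lambda>g. hat (k u v g)) ` G)"
  \<comment> \<open>Including the multiples by \<open>\<i>\<close> turns real orthogonality into
    vanishing of the complex inner product, which is needed since \<open>k u v g\<close> need not be
    self-adjoint.\<close>
  define G2 where "G2 = (\<Union>(u, v)\<in>U \<times> U. (\<lambda>g. \<i> *\<^sub>C hat (k u v g)) ` G)"
  have "|G1| <o |D|" "|G2| <o |D|"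
    unfolding G1_def G2_def using U(1) G(2)
    by (intro card_of_UNION_ordLess[OF D(2) _ _ G(2)]; auto intro: card_of_image)+
  then have "|G1 \<union> G2| <o |D|"
    using D(2) countable_finite by (intro card_of_Un_ordLess_infinite) auto
  then obtain G' where G': "invariant_hull {nearest sa_ball} (G1 \<union> G2) \<subseteq> closure G'" "|G'| <o |D|"
    using invariant_hull_small[OF D(2), of "G1 \<union> G2" "{nearest sa_ball}"] B.B.continuous_nearest by auto
  define V where "V = invariant_hull {nearest sa_ball} (G1 \<union> G2)"
  interpret V: closed_subspace V unfolding V_def by (rule closed_subspace_invariant_hull)
  have invV: "nearest sa_ball v \<in> V" if "v \<in> V" for v
    using that invariant_hull_invariant[of "nearest sa_ball" "{nearest sa_ball}"] unfolding V_def by blast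
  have "\<not> span sa_ball \<subseteq> closure G'" using span_sa_ball_not_small[OF D] G'(2) by blast
  then have "\<not> sa_ball \<subseteq> V" using G'(1) V.subspace span_minimal[of sa_ball V] unfolding V_def by blast
  \<comment> \<open>\<open>V\<close> has too small a density to contain the ball. The residual
    \<open>z\<close> of \<open>x\<close> is bounded because the projection onto \<open>V\<close>
    preserves the ball.\<close>
  then obtain x where x: "x \<in> sa_ball" "x \<notin> V" by blast
  define z where "z = x - nearest V x"
  have "nearest V x \<in> sa_ball" by (rule B.nearest_subspace_mem[OF V.closed_subspace_axioms invV x(1)])
  then have "z \<in> span sa_ball" unfolding z_def using x(1) by (intro span_diff span_base)
  then obtain z0 where z0: "z0 \<in> M" "adj z0 = z0" "z = hat z0" unfolding span_sa_ball by blast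
  have "z \<noteq> 0" using x(2) V.nearest_mem[of x] unfolding z_def by auto
  then have "z0 \<noteq> 0" using z0(3) hat_zero by auto
  have orth: "inner z v = 0" if "v \<in> G1 \<union> G2" for v
    unfolding z_def using that invariant_hull_superset V.nearest_orth V_def by (metis subsetD)
  obtain u v where uv: "u \<in> U" "v \<in> U" "c o\<^sub>L (adj u o\<^sub>L (z0 o\<^sub>L (v o\<^sub>L c))) \<noteq> 0"
    using U(3)[OF z0(1)] \<open>z0 \<noteq> 0\<close> by blast
  have uM: "u \<in> M" and vM: "v \<in> M" using uv U(2) unitary_mem by auto
  define p where "p = adj u o\<^sub>L (z0 o\<^sub>L v)"
  define q where "q = c o\<^sub>L (p o\<^sub>L c)"
  have pM: "p \<in> M" unfolding p_def by (intro M_intros uM vM z0)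
  have qM: "q \<in> M" unfolding q_def by (intro M_intros cM pM)
  have q0: "q \<noteq> 0" using uv(3) by (simp add: q_def p_def compose_assoc)
  have qg: "\<tau> (\<gamma> g o\<^sub>L q) = 0" if g: "g \<in> G" for g
  proof -
    have "hat (k u v g) \<in> G1 \<union> G2" "\<i> *\<^sub>C hat (k u v g) \<in> G1 \<union> G2"
      using uv g unfolding G1_def G2_def by blast+
    then have "cinner z (hat (k u v g)) = 0" using orth by (simp add: cinner_eq_inner complex_eq_iff)
    then have "\<tau> (adj (k u v g) o\<^sub>L z0) = 0" by (simp add: z0(3) cinner_hat z0(1) kM uv g)
    moreover have "adj (k u v g) = (v o\<^sub>L c) o\<^sub>L (\<gamma> g o\<^sub>L (c o\<^sub>L adj u))"
      by (simp add: k_def adj_compose bounded M_intros uM vM cM \<gamma> g adj_adj ca compose_assoc)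
    moreover have "\<tau> (((v o\<^sub>L c) o\<^sub>L (\<gamma> g o\<^sub>L (c o\<^sub>L adj u))) o\<^sub>L z0) = \<tau> ((v o\<^sub>L c) o\<^sub>L ((\<gamma> g o\<^sub>L (c o\<^sub>L adj u)) o\<^sub>L z0))"
      by (simp only: compose_assoc)
    moreover have "\<dots> = \<tau> (((\<gamma> g o\<^sub>L (c o\<^sub>L adj u)) o\<^sub>L z0) o\<^sub>L (v o\<^sub>L c))"
      by (intro tau_commute M_intros uM vM cM \<gamma> g z0)
    moreover have "((\<gamma> g o\<^sub>L (c o\<^sub>L adj u)) o\<^sub>L z0) o\<^sub>L (v o\<^sub>L c) = \<gamma> g o\<^sub>L q"
      by (simp only: q_def p_def compose_assoc)
    ultimately show ?thesis by simp
  qed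
  have qg': "\<tau> (\<gamma> g o\<^sub>L adj q) = 0" if g: "g \<in> G" for g
  proof -
    have "\<tau> (\<gamma> g o\<^sub>L adj q) = \<tau> (adj (q o\<^sub>L \<gamma> g))" by (simp add: adj_compose bounded qM \<gamma> g)
    also have "\<dots> = cnj (\<tau> (\<gamma> g o\<^sub>L q))" by (simp add: tau_adj M_compose qM \<gamma> g tau_commute)
    finally show ?thesis using qg[OF g] by simp
  qed
  \<comment> \<open>\<open>q\<close> need not be self-adjoint. Its symmetric part, or else
    \<open>\<i>\<close> times its antisymmetric part, is nonzero, and both are again compressions by
    \<open>c\<close>.\<close>
  define s where "s = (if q + adj q \<noteq> 0 then p + adj p else J o\<^sub>L (p - adj p))"
  define w where "w = c o\<^sub>L (s o\<^sub>L c)"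
  have s: "s \<in> M" "adj s = s"
    using pM by (auto simp: s_def adj_add_self adj_J_diff intro!: M_intros J_M)
  have wM: "w \<in> M" unfolding w_def by (intro M_intros cM s)
  have aq: "adj q = c o\<^sub>L (adj p o\<^sub>L c)" by (simp add: q_def adj_compose bounded M_intros cM pM ca compose_assoc)
  have w: "w = (if q + adj q \<noteq> 0 then q + adj q else J o\<^sub>L (q - adj q))"
    unfolding w_def s_def aq unfolding q_def
    by (simp add: compose_simps compose_assoc J_left_commute[OF cM])
  have w0: "w \<noteq> 0"
  proof
    assume "w = 0"
    then have "q + adj q = 0" "J o\<^sub>L (q - adj q) = 0" using w by (auto split: if_splits)
    then have "q + adj q = 0" "q - adj q = 0" using J_J[of "q - adj q"] by (auto simp: compose_simps)
    then have "2 *\<^sub>R q = 0" by (metis add_diff_cancel_right' diff_add_cancel eq_iff_diff_eq_0 scaleR_2 add.right_neutral)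
    then show False using q0 by simp
  qed
  have wg: "inner (hat w) g = 0" if g: "g \<in> G" for g
  proof -
    have gM: "\<gamma> g \<in> M" using \<gamma> g by blast
    have "inner (hat w) g = tr (\<gamma> g o\<^sub>L w)"
      using inner_hat[OF wM gM] \<gamma>[OF g] by simp
    also have "\<tau> (\<gamma> g o\<^sub>L w) = 0"
    proof (cases "q + adj q = 0")
      case False
      then have "w = q + adj q" using w by simp
      then have "\<gamma> g o\<^sub>L w = (\<gamma> g o\<^sub>L q) + (\<gamma> g o\<^sub>L adj q)" by (simp add: compose_simps)
      then show ?thesis using qg[OF g] qg'[OF g] by (simp add: tau_add M_compose M_adj gM qM)
    next
      case True
      then have "w = J o\<^sub>L (q + (-1) *\<^sub>R adj q)" using w by simp
      then have "\<gamma> g o\<^sub>L w = J o\<^sub>L ((\<gamma> g o\<^sub>L q) + (-1) *\<^sub>R (\<gamma> g o\<^sub>L adj q))"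
        by (simp add: J_left_commute[OF gM] compose_simps)
      moreover have "\<tau> ((-1) *\<^sub>R (\<gamma> g o\<^sub>L adj q)) = 0"
        using tau_scalar[of "\<gamma> g o\<^sub>L adj q" "complex_of_real (-1)"] qg'[OF g]
        by (simp only: scalar_op_real M_compose M_adj gM qM mult_zero_right)
      ultimately show ?thesis
        using qg[OF g] by (simp only: tau_J tau_add M_intros gM qM) simp
    qed
    then have "tr (\<gamma> g o\<^sub>L w) = 0" by (simp add: tr_def)
    finally show ?thesis .
  qed
  obtain r where r: "r > 0" "norm (a0 + r *\<^sub>R w) \<le> 1"
    using perturbation[OF a0(1-3) s] unfolding w_def c_def by blast
  have "adj w = w" by (simp add: w_def adj_compose bounded M_compose cM s ca compose_assoc)
  then have "a0 + r *\<^sub>R w \<in> {x\<in>M. adj x = x \<and> norm x \<le> 1}"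
    using r(2) by (simp add: M_add M_scaleR adj_add adj_scaleR bounded bounded_ops_scaleR a0(1,2) wM)
  then have "hat (a0 + r *\<^sub>R w) \<in> sa_ball" unfolding sa_ball_def by blast
  then have "a + r *\<^sub>R hat w \<in> sa_ball" by (simp add: a0(4) hat_add hat_scaleR M_scaleR a0(1) wM)
  moreover have "r *\<^sub>R hat w \<noteq> 0" using r(1) hat_eq_0_iff[OF wM] w0 by simp
  ultimately show ?thesis using wg by (intro exI[of _ "r *\<^sub>R hat w"]) simp
qed

text \<open>The element \<open>1 - x^2\<close> is positive with trace
  \<open>1 - (norm (hat x))^2 = 0\<close>, hence zero by faithfulness.\<close>

lemma unit_vector_self_adjoint_unitary:
  assumes x: "x \<in> M" "adj x = x" "norm x \<le> 1" and n: "norm (hat x) = 1"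
  shows "self_adjoint_unitary x"
proof -
  let ?z = "id_blinfun - (x o\<^sub>L x)"
  have xxM: "x o\<^sub>L x \<in> M" by (intro M_intros x)
  have zM: "?z \<in> M" by (intro M_intros x)
  have xx: "pos (x o\<^sub>L x)" using pos_adj_compose[OF bounded[OF x(1)]] x(2) by simp
  have nxx: "norm (x o\<^sub>L x) \<le> 1"
    using norm_blinfun_compose[of x x] mult_mono[OF x(3) x(3)] by simp
  then have zpos: "pos ?z" using pos_id_minus[OF bounded[OF xxM] pos_adj[OF xx], of 1] by simp
  have "norm ?z \<le> 1" using zpos xx by (intro norm_le_1_of_pos) auto
  then have "(norm (hat ?z))\<^sup>2 \<le> tr ?z" by (rule norm_hat_pos_le[OF zM zpos])
  also have "tr ?z = 0" using norm_hat[OF x(1)] n x(2) by (simp add: tr_diff M_id xxM tr_id)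
  finally have "hat ?z = 0" by simp
  then have "?z = 0" using hat_eq_0_iff[OF zM] by blast
  then show ?thesis using x(2) by (simp add: self_adjoint_unitary_def)
qed

end

theorem theorem1p2:
  fixes M :: "'h::complex_hilbert_space op set"
    and \<tau> :: "'h op \<Rightarrow> complex"
    and hat :: "'h op \<Rightarrow> 'k::complex_hilbert_space"
    and \<kappa> :: "'k rel"
  assumes "type_II1_factor M"
    and "faithful_normal_tracial_state M \<tau>"
    and "L2_completion M \<tau> hat"
    and "\<kappa> = dens (UNIV :: 'k set)"
    and "natLeq <o \<kappa>"
  shows "\<exists>(I :: 'k set) s.
           |I| =o \<kappa> \<and>
           (\<forall>i\<in>I. s i \<in> M \<and> self_adjoint_unitary (s i)) \<and>
           orthonormal_basis_on I (\<lambda>i. hat (s i))"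
proof -
  have factor: "factor M" using assms(1) by (simp add: type_II1_factor_def)
  interpret tracial_vn M \<tau> hat
    using factor assms(2,3) by unfold_locales (simp_all add: factor_def)
  obtain D where D: "least_dense_subset (UNIV :: 'k set) D" "dens (UNIV :: 'k set) = |D|"
    by (rule dens_least_dense_subset)
  have unc: "uncountable D"
  proof
    assume "countable D"
    then have "|D| \<le>o |UNIV :: nat set|" by (auto simp: countable_def card_of_ordLeq[symmetric])
    then have "|D| \<le>o natLeq" using card_of_nat ordLeq_ordIso_trans by blast
    then show False using assms(4,5) D(2) not_ordLess_ordLeq by auto
  qed
  have Dd: "closure D = UNIV" using D(1) by (auto simp: least_dense_subset_def)
  interpret B: symmetric_convex sa_ball by (rule symmetric_convex_sa_ball)
  interpret E: extendable_ball sa_ball D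
  proof unfold_locales
    show "uncountable D" by (rule unc)
    show "norm v \<le> 1" if "v \<in> sa_ball" for v
      using that norm_hat_le order_trans unfolding sa_ball_def by blast
    show "\<exists>b. b \<noteq> 0 \<and> a + b \<in> sa_ball \<and> (\<forall>g\<in>G. inner b g = 0)"
      if "a \<in> sa_ball" "norm a < 1" "G \<subseteq> span sa_ball" "|G| <o |D|" for a G
      by (rule extension[OF factor D(1) unc that])
    show "\<exists>D' :: 'k set. closure (span sa_ball) \<subseteq> closure D' \<and> |D'| \<le>o |D|"
      using Dd by (intro exI[of _ D]) (auto intro: ordLeq_refl card_of_Card_order)
  qed
  obtain S where S: "S \<subseteq> sa_ball" "orthonormal S" "closure (span S) = closure (span sa_ball)"
    using E.orthonormal_basis_of_unit_vectors by blast
  have "|S| \<le>o |D|" by (rule orthonormal_card_le_dense[OF S(2)]) (simp add: Dd)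
  \<comment> \<open>A smaller basis would give the closed real span, and with it the complex
    completion, a dense subset smaller than the density character.\<close>
  moreover have "\<not> |S| <o |D|"
  proof
    assume "|S| <o |D|"
    then obtain G where "invariant_hull {} S \<subseteq> closure G" "|G| <o |D|"
      using invariant_hull_small[OF unc, of S "{}"] by auto
    moreover have "span sa_ball \<subseteq> invariant_hull {} S"
      using S(3) closure_subset[of "span sa_ball"] by (simp flip: closure_span_eq_invariant_hull)
    ultimately show False using span_sa_ball_not_small[OF D(1) unc] by blast
  qed
  ultimately have card: "|S| =o \<kappa>" using assms(4) D(2) ordLeq_iff_ordLess_or_ordIso by auto
  have "\<forall>v\<in>S. \<exists>x. x \<in> M \<and> adj x = x \<and> norm x \<le> 1 \<and> hat x = v"
    using S(1) unfolding sa_ball_def by blast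
  then obtain s where s: "\<And>v. v \<in> S \<Longrightarrow> s v \<in> M" "\<And>v. v \<in> S \<Longrightarrow> adj (s v) = s v"
    "\<And>v. v \<in> S \<Longrightarrow> norm (s v) \<le> 1" "\<And>v. v \<in> S \<Longrightarrow> hat (s v) = v" by metis
  have sau: "self_adjoint_unitary (s v)" if "v \<in> S" for v
    using that s orthonormal_norm[OF S(2)] by (intro unit_vector_self_adjoint_unitary) auto
  \<comment> \<open>Traciality makes the inner product of two self-adjoint elements symmetric, so it
    equals its own conjugate; this upgrades real orthonormality to complex orthonormality.\<close>
  have real: "cinner v w = complex_of_real (inner v w)" if "v \<in> S" "w \<in> S" for v w
  proof -
    have "cinner v w = \<tau> (s w o\<^sub>L s v)" "cinner w v = \<tau> (s v o\<^sub>L s w)"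
      using cinner_hat[of "s v" "s w"] cinner_hat[of "s w" "s v"] s that by auto
    then have "cinner v w = cinner w v" using tau_commute s that by simp
    then have "cinner v w = cnj (cinner v w)" using cinner_commute[of v w] by simp
    then have "Im (cinner v w) = 0" by (simp add: complex_eq_iff)
    then show ?thesis by (simp add: complex_eq_iff inner_eq_Re_cinner)
  qed
  have "cinner v w = (if v = w then 1 else 0)" if "v \<in> S" "w \<in> S" for v w
    using real[OF that] that orthonormal_norm[OF S(2)] orthonormal_inner[OF S(2)]
    by (auto simp: dot_square_norm)
  moreover have "closure (cspan S) = UNIV"
  proof -
    \<comment> \<open>The real span only reaches the self-adjoint vectors; complex scalars then
      supply \<open>v + \<i> w\<close>, which exhausts the image of \<open>M\<close>.\<close>
    have "span S \<subseteq> cspan S"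
      by (intro span_minimal)
        (auto simp: subspace_def scaleR_scaleC intro: complex_vector.span_base complex_vector.span_zero
          complex_vector.span_add complex_vector.span_scale)
    then have "closure (span sa_ball) \<subseteq> closure (cspan S)" using closure_mono S(3) by blast
    then have sa_ball: "span sa_ball \<subseteq> closure (cspan S)" using closure_subset by blast
    have "v + \<i> *\<^sub>C w \<in> closure (cspan S)" if vw: "v \<in> span sa_ball" "w \<in> span sa_ball" for v w
    proof -
      have "v \<in> closure (cspan S)" "w \<in> closure (cspan S)" using vw sa_ball by auto
      then obtain f g where "\<And>n. f n \<in> cspan S" "f \<longlonglongrightarrow> v" "\<And>n. g n \<in> cspan S" "g \<longlonglongrightarrow> w"
        unfolding closure_sequential by blast
      then show ?thesis unfolding closure_sequential
        by (intro exI[of _ "\<lambda>n. f n + \<i> *\<^sub>C g n"])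
          (auto intro: tendsto_add bounded_linear.tendsto[OF bounded_linear_scaleC]
            complex_vector.span_add complex_vector.span_scale)
    qed
    then have "hat ` M \<subseteq> closure (cspan S)" using hat_decomposition by (metis image_subsetI)
    then show ?thesis using hat_dense closure_minimal[of "hat ` M" "closure (cspan S)"] by auto
  qed
  ultimately have "orthonormal_basis_on S (\<lambda>v. hat (s v))"
    unfolding orthonormal_basis_on_def using s(4) by simp
  then show ?thesis using card s(1) sau by (intro exI[of _ S] exI[of _ s]) auto
qed

end
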